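(* Let $\mathscr{A}$ be a $\mathbb{Q}$-linear Abelian category endowed with a shift functor, let $\mathbb{V}=(V,F)$ be an object of $\mathscr{AF}$ of type $[-r,r]$, and let $e:\mathbb{V}\to\mathbb{V}[2](1)$ be an arrow in $\mathscr{AF}$ such that $e^k:V_{-k}\to V_k(k)$ is an isomorphism for every $k\ge0$. If an $e$-good splitting $\mathbb{V}_*\cong\mathbb{V}$ exists, then it is unique and it coincides with the third Deligne isomorphism $\phi_{\rm III}(e)$. In this case $$\omega_{\rm I}(e)=\omega_{\rm II}(e)=\phi_{\rm I}(e)=\phi_{\rm II}(e)=\phi_{\rm III}(e).$$
   Context: **Filtered category.** The shift functor $(1)$ is an additive exact autoequivalence of $\mathscr{A}$, with iterates $(m)$. $\mathscr{AF}$ is the category of pairs $\mathbb{V}=(V,F)$, $F$ a finite increasing filtration of $V\in\mathscr{A}$, with arrows the arrows of $\mathscr{A}$ respecting filtrations. $F[n]_p:=F_{n+p}$, $\mathbb{V}[n]:=(V,F[n])$, $\mathbb{V}(m):=(V(m),F)$. $T$ is the trivial filtration ($T_{-1}V=0$, $T_0V=V$). $V_p:=F_pV/F_{p-1}V$, $\mathbb{V}_p:=(V_p,T[-p])$, $\mathbb{V}_{\ge p}:=V/F_{p-1}V$ with the induced filtration, $\mathbb{V}_*:=\bigoplus_p\mathbb{V}_p$. $\mathbb{V}$ has type $[a,b]$ if $V_p=0$ for $p\notin[a,b]$. A splitting is an isomorphism $\varphi:\mathbb{V}_*\cong\mathbb{V}$ in $\mathscr{AF}$; it is good if it induces the identity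 on each $V_p$. Shifts and translates of an arrow are denoted by the same letter. "HL" is the condition that $e^k:V_{-k}\to V_k(k)$ is an isomorphism for all $k\ge0$. **$e$-good.** For a splitting $\varphi$ let $\tilde e(\varphi):=\varphi^{-1}\circ e\circ\varphi:\mathbb{V}_*\to\mathbb{V}_*[2](1)$ and let $\tilde e(\varphi)^{\{d\}}$ be the sum of its components $V_p\to V_{p+d}(1)$ (zero for $d>2$). $\varphi$ is $e$-good if it is good and $\tilde e(\varphi)=\tilde e(\varphi)^{\{2\}}$. **$\omega_{\rm I}(e)$.** By recursion on $r$. If $r=0$, it is the identity. If $r\ge1$, let $i:\mathbb{V}_{-r}\to\mathbb{V}$ be the inclusion of $F_{-r}V$, $p:\mathbb{V}\to\mathbb{V}_r$ the last quotient, $\mathbb{K}$ the kernel of $(p\circ e^r,p):V\to V_r(r)\oplus V_r$ with the filtration induced by $F$, $\iota:\mathbb{K}\to\mathbb{V}$ the inclusion, and $e_r:V_{-r}\cong V_r(r)$ the isomorphism induced by $e^r$. Then $w=i+\iota+e^r\circ i\circ e_r^{-1}:\mathbb{V}_{-r}\oplus\mathbb{K}\oplus\mathbb{V}_r\to\mathbb{V}$ is an isomorphism, $\iota$ induces $K_p\cong V_p$ for $|p|\le r-1$, and the $\mathbb{K}$-component $e':\mathbb{K}\to\mathbb{K}[2](1)$ of $w^{-1}ew$ satisfies HL. Set $\omega_{\rm I}(e):=w\circ(\mathrm{id}\oplus\omega_{\rm I}(e')\oplus\mathrm{id})$, identifying $K_p=V_p$. **$\phi_{\rm I}(e)$.**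 For $i\ge0$ let $P_{-i}:=\mathrm{Ker}(e^{i+1}:V_{-i}\to V_{i+2}(i+1))$, $\mathbb{P}_{-i}=(P_{-i},T[i])$. The maps $e^j:P_{-i}(-j)\to V_{-i+2j}$ give an isomorphism $\epsilon:\bigoplus_{0\le j\le i}\mathbb{P}_{-i}(-j)[-2j]\cong\mathbb{V}_*$. Let $f_i:\mathbb{P}_{-i}\to\mathbb{V}$ be the unique arrow in $\mathscr{AF}$ lifting the natural arrow $\mathbb{P}_{-i}\to\mathbb{V}_{\ge-i}$ and such that for all $s>i$ the composite $P_{-i}\xrightarrow{e^s\circ f_i}V(s)\to V_{\ge s}(s)$ is zero. Set $\phi_{\rm I}(e):=\big(\sum_{0\le j\le i}e^j\circ f_i\big)\circ\epsilon^{-1}$. **$\omega_{\rm II}(e)$, $\phi_{\rm II}(e)$.** Write $(-)^o$ for passage to the opposite category $\mathscr{A}^o$, with shift $V^o(m)^o:=(V(-m))^o$; put $\mathbb{V}^o=(V^o,F^o)$ with $F^o_iV^o:=(V/F_{-i-1}V)^o$, so $(V^o)_i=(V_{-i})^o$. Then $e$ yields $e^o:\mathbb{V}^o\to\mathbb{V}^o[2]^o(1)^o$, which satisfies HL. Set $\omega_{\rm II}(e):=((\omega_{\rm I}(e^o))^o)^{-1}$ and $\phi_{\rm II}(e):=((\phi_{\rm I}(e^o))^o)^{-1}$. **$\phi_{\rm III}(e)$.** Let $e'=\sum_p(e:V_p\to V_{p+2}(1))$ be the graded map and for $u:V_*\to V_*(m)$ put $\mathrm{ad}(u):=e'\circ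 u-u\circ e'$. The third Deligne isomorphism $\phi_{\rm III}(e)$ is the unique good splitting $\varphi$ with $\mathrm{ad}^{1-d}(\tilde e(\varphi)^{\{d\}})=0$ for all $d\le1$. *)

theory Defs
  imports Complex_Main "HOL-Algebra.Module"
begin

section \<open>Linear Abelian categories\<close>

text \<open>Arrows carry their source and target. \<open>Cmp\<close> is meaningful on composable arrows only,
  and \<open>g \<cdot> f\<close> is \<open>g\<close> after \<open>f\<close>.\<close>

record ('o, 'a) lincat =
  Ob :: "'o set"
  Mor :: "'a set"
  Src :: "'a \<Rightarrow> 'o"
  Tgt :: "'a \<Rightarrow> 'o"
  Idn :: "'o \<Rightarrow> 'a"
  Cmp :: "'a \<Rightarrow> 'a \<Rightarrow> 'a"  (infixl \<open>\<cdot>\<index>\<close> 70)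
  Zero :: "'o \<Rightarrow> 'o \<Rightarrow> 'a"
  Add :: "'a \<Rightarrow> 'a \<Rightarrow> 'a"
  Scal :: "rat \<Rightarrow> 'a \<Rightarrow> 'a"

definition Hom :: "('o, 'a, 'm) lincat_scheme \<Rightarrow> 'o \<Rightarrow> 'o \<Rightarrow> 'a set" where
  "Hom C X Y = {f \<in> Mor C. Src C f = X \<and> Tgt C f = Y}"

definition rat_ring :: "rat ring" where
  "rat_ring = \<lparr>carrier = UNIV, mult = (*), one = 1, zero = 0, add = (+)\<rparr>"

text \<open>The rational vector space of arrows from \<open>X\<close> to \<open>Y\<close>; the fields \<open>mult\<close> and \<open>one\<close> play
  no role in a module.\<close>

definition hmod :: "('o, 'a, 'm) lincat_scheme \<Rightarrow> 'o \<Rightarrow> 'o \<Rightarrow> (rat, 'a) module" where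
  "hmod C X Y = \<lparr>carrier = Hom C X Y, mult = Add C, one = Zero C X Y,
     zero = Zero C X Y, add = Add C, smult = Scal C\<rparr>"

definition hsum :: "('o, 'a, 'm) lincat_scheme \<Rightarrow> 'o \<Rightarrow> 'o \<Rightarrow> ('i \<Rightarrow> 'a) \<Rightarrow> 'i set \<Rightarrow> 'a" where
  "hsum C X Y f I = finsum (hmod C X Y) f I"

definition is_iso :: "('o, 'a, 'm) lincat_scheme \<Rightarrow> 'a \<Rightarrow> bool" where
  "is_iso C f \<longleftrightarrow> f \<in> Mor C \<and> (\<exists>g \<in> Hom C (Tgt C f) (Src C f).
     g \<cdot>\<^bsub>C\<^esub> f = Idn C (Src C f) \<and> f \<cdot>\<^bsub>C\<^esub> g = Idn C (Tgt C f))"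

definition cinv :: "('o, 'a, 'm) lincat_scheme \<Rightarrow> 'a \<Rightarrow> 'a" where
  "cinv C f = (THE g. g \<in> Hom C (Tgt C f) (Src C f) \<and>
     g \<cdot>\<^bsub>C\<^esub> f = Idn C (Src C f) \<and> f \<cdot>\<^bsub>C\<^esub> g = Idn C (Tgt C f))"

definition is_mono :: "('o, 'a, 'm) lincat_scheme \<Rightarrow> 'a \<Rightarrow> bool" where
  "is_mono C m \<longleftrightarrow> m \<in> Mor C \<and> (\<forall>X \<in> Ob C. \<forall>f \<in> Hom C X (Src C m). \<forall>g \<in> Hom C X (Src C m).
     m \<cdot>\<^bsub>C\<^esub> f = m \<cdot>\<^bsub>C\<^esub> g \<longrightarrow> f = g)"

definition is_epi :: "('o, 'a, 'm) lincat_scheme \<Rightarrow> 'a \<Rightarrow> bool" where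
  "is_epi C q \<longleftrightarrow> q \<in> Mor C \<and> (\<forall>Y \<in> Ob C. \<forall>f \<in> Hom C (Tgt C q) Y. \<forall>g \<in> Hom C (Tgt C q) Y.
     f \<cdot>\<^bsub>C\<^esub> q = g \<cdot>\<^bsub>C\<^esub> q \<longrightarrow> f = g)"

definition is_ker :: "('o, 'a, 'm) lincat_scheme \<Rightarrow> 'a \<Rightarrow> 'a \<Rightarrow> bool" where
  "is_ker C f k \<longleftrightarrow> f \<in> Mor C \<and> k \<in> Mor C \<and> Tgt C k = Src C f \<and>
     f \<cdot>\<^bsub>C\<^esub> k = Zero C (Src C k) (Tgt C f) \<and>
     (\<forall>h \<in> Mor C. Tgt C h = Src C f \<and> f \<cdot>\<^bsub>C\<^esub> h = Zero C (Src C h) (Tgt C f) \<longrightarrow>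
        (\<exists>!u. u \<in> Hom C (Src C h) (Src C k) \<and> k \<cdot>\<^bsub>C\<^esub> u = h))"

definition is_coker :: "('o, 'a, 'm) lincat_scheme \<Rightarrow> 'a \<Rightarrow> 'a \<Rightarrow> bool" where
  "is_coker C f c \<longleftrightarrow> f \<in> Mor C \<and> c \<in> Mor C \<and> Src C c = Tgt C f \<and>
     c \<cdot>\<^bsub>C\<^esub> f = Zero C (Src C f) (Tgt C c) \<and>
     (\<forall>h \<in> Mor C. Src C h = Tgt C f \<and> h \<cdot>\<^bsub>C\<^esub> f = Zero C (Src C f) (Tgt C h) \<longrightarrow>
        (\<exists>!u. u \<in> Hom C (Tgt C c) (Tgt C h) \<and> u \<cdot>\<^bsub>C\<^esub> c = h))"

definition coker :: "('o, 'a, 'm) lincat_scheme \<Rightarrow> 'a \<Rightarrow> 'a" where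
  "coker C f = (SOME c. is_coker C f c)"

definition is_zero_ob :: "('o, 'a, 'm) lincat_scheme \<Rightarrow> 'o \<Rightarrow> bool" where
  "is_zero_ob C Z \<longleftrightarrow> Z \<in> Ob C \<and>
     (\<forall>X \<in> Ob C. (\<exists>!f. f \<in> Hom C X Z) \<and> (\<exists>!f. f \<in> Hom C Z X))"

text \<open>\<open>D\<close> is the direct sum of the finite family \<open>X\<close>, with injections \<open>\<iota>\<close> and projections \<open>\<pi>\<close>.\<close>

definition is_dsum ::
  "('o, 'a, 'm) lincat_scheme \<Rightarrow> 'i set \<Rightarrow> ('i \<Rightarrow> 'o) \<Rightarrow> 'o \<Rightarrow> ('i \<Rightarrow> 'a) \<Rightarrow> ('i \<Rightarrow> 'a) \<Rightarrow> bool" where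
  "is_dsum C I X D \<iota> \<pi> \<longleftrightarrow> finite I \<and> D \<in> Ob C \<and>
     (\<forall>i\<in>I. X i \<in> Ob C \<and> \<iota> i \<in> Hom C (X i) D \<and> \<pi> i \<in> Hom C D (X i)) \<and>
     (\<forall>i\<in>I. \<forall>j\<in>I. \<pi> j \<cdot>\<^bsub>C\<^esub> \<iota> i = (if i = j then Idn C (X i) else Zero C (X i) (X j))) \<and>
     hsum C D D (\<lambda>i. \<iota> i \<cdot>\<^bsub>C\<^esub> \<pi> i) I = Idn C D"

definition is_pullback ::
  "('o, 'a, 'm) lincat_scheme \<Rightarrow> 'a \<Rightarrow> 'a \<Rightarrow> 'a \<Rightarrow> 'a \<Rightarrow> bool" where
  "is_pullback C f g f' g' \<longleftrightarrow>
     f \<in> Mor C \<and> g \<in> Mor C \<and> f' \<in> Mor C \<and> g' \<in> Mor C \<and> Tgt C f = Tgt C g \<and>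
     Src C f' = Src C g' \<and> Tgt C f' = Src C f \<and> Tgt C g' = Src C g \<and>
     f \<cdot>\<^bsub>C\<^esub> f' = g \<cdot>\<^bsub>C\<^esub> g' \<and>
     (\<forall>h \<in> Mor C. \<forall>k \<in> Mor C. Src C h = Src C k \<and> Tgt C h = Src C f \<and> Tgt C k = Src C g \<and>
        f \<cdot>\<^bsub>C\<^esub> h = g \<cdot>\<^bsub>C\<^esub> k \<longrightarrow>
        (\<exists>!u. u \<in> Hom C (Src C h) (Src C f') \<and> f' \<cdot>\<^bsub>C\<^esub> u = h \<and> g' \<cdot>\<^bsub>C\<^esub> u = k))"

definition factors :: "('o, 'a, 'm) lincat_scheme \<Rightarrow> 'a \<Rightarrow> 'a \<Rightarrow> bool" where
  "factors C m f \<longleftrightarrow> (\<exists>h \<in> Hom C (Src C f) (Src C m). m \<cdot>\<^bsub>C\<^esub> h = f)"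

definition fac :: "('o, 'a, 'm) lincat_scheme \<Rightarrow> 'a \<Rightarrow> 'a \<Rightarrow> 'a" where
  "fac C m f = (THE h. h \<in> Hom C (Src C f) (Src C m) \<and> m \<cdot>\<^bsub>C\<^esub> h = f)"

locale linear_category =
  fixes C :: "('o, 'a, 'm) lincat_scheme" (structure)
  assumes Src_Ob: "f \<in> Mor C \<Longrightarrow> Src C f \<in> Ob C"
    and Tgt_Ob: "f \<in> Mor C \<Longrightarrow> Tgt C f \<in> Ob C"
    and Idn_Hom: "X \<in> Ob C \<Longrightarrow> Idn C X \<in> Hom C X X"
    and Cmp_Hom: "\<lbrakk>f \<in> Hom C X Y; g \<in> Hom C Y Z\<rbrakk> \<Longrightarrow> g \<cdot> f \<in> Hom C X Z"
    and Cmp_Idn_right: "f \<in> Hom C X Y \<Longrightarrow> f \<cdot> Idn C X = f"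
    and Cmp_Idn_left: "f \<in> Hom C X Y \<Longrightarrow> Idn C Y \<cdot> f = f"
    and Cmp_assoc: "\<lbrakk>f \<in> Hom C X Y; g \<in> Hom C Y Z; h \<in> Hom C Z W\<rbrakk> \<Longrightarrow> (h \<cdot> g) \<cdot> f = h \<cdot> (g \<cdot> f)"
    and Hom_module: "\<lbrakk>X \<in> Ob C; Y \<in> Ob C\<rbrakk> \<Longrightarrow> module rat_ring (hmod C X Y)"
    and Cmp_Add_right:
      "\<lbrakk>f \<in> Hom C X Y; f' \<in> Hom C X Y; g \<in> Hom C Y Z\<rbrakk> \<Longrightarrow> g \<cdot> Add C f f' = Add C (g \<cdot> f) (g \<cdot> f')"
    and Cmp_Add_left:
      "\<lbrakk>f \<in> Hom C X Y; g \<in> Hom C Y Z; g' \<in> Hom C Y Z\<rbrakk> \<Longrightarrow> Add C g g' \<cdot> f = Add C (g \<cdot> f) (g' \<cdot> f)"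
    and Cmp_Scal_right: "\<lbrakk>f \<in> Hom C X Y; g \<in> Hom C Y Z\<rbrakk> \<Longrightarrow> g \<cdot> Scal C a f = Scal C a (g \<cdot> f)"
    and Cmp_Scal_left: "\<lbrakk>f \<in> Hom C X Y; g \<in> Hom C Y Z\<rbrakk> \<Longrightarrow> Scal C a g \<cdot> f = Scal C a (g \<cdot> f)"

locale linear_abelian = linear_category +
  assumes ex_zero_ob: "\<exists>Z. is_zero_ob C Z"
    and ex_dsum: "\<lbrakk>X \<in> Ob C; Y \<in> Ob C\<rbrakk> \<Longrightarrow>
      \<exists>D \<iota> \<pi>. is_dsum C {0::nat, 1} (\<lambda>i. if i = 0 then X else Y) D \<iota> \<pi>"
    and ex_ker: "f \<in> Mor C \<Longrightarrow> \<exists>k. is_ker C f k"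
    and ex_coker: "f \<in> Mor C \<Longrightarrow> \<exists>c. is_coker C f c"
    and mono_ker: "is_mono C m \<Longrightarrow> \<exists>f. is_ker C f m"
    and epi_coker: "is_epi C q \<Longrightarrow> \<exists>f. is_coker C f q"


section \<open>Shift functors\<close>

text \<open>An autoequivalence is given together with a quasi-inverse \<open>UnO, UnA\<close>, which serves as the
  shift by \<open>-1\<close>, and with \<open>Unit X : X \<cong> X(1)(-1)\<close> and \<open>Counit X : X(-1)(1) \<cong> X\<close>. The triangle
  identities make the identifications \<open>X(m)(n) = X(m+n)\<close> consistent; for any autoequivalence
  and any quasi-inverse the natural isomorphisms can be chosen in this way.\<close>

record ('o, 'a) shcat = "('o, 'a) lincat" +
  ShO :: "'o \<Rightarrow> 'o"
  ShA :: "'a \<Rightarrow> 'a"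
  UnO :: "'o \<Rightarrow> 'o"
  UnA :: "'a \<Rightarrow> 'a"
  Unit :: "'o \<Rightarrow> 'a"
  Counit :: "'o \<Rightarrow> 'a"

definition is_endofunctor :: "('o, 'a, 'm) lincat_scheme \<Rightarrow> ('o \<Rightarrow> 'o) \<Rightarrow> ('a \<Rightarrow> 'a) \<Rightarrow> bool" where
  "is_endofunctor C FO FA \<longleftrightarrow>
     (\<forall>X \<in> Ob C. FO X \<in> Ob C \<and> FA (Idn C X) = Idn C (FO X)) \<and>
     (\<forall>f \<in> Mor C. FA f \<in> Hom C (FO (Src C f)) (FO (Tgt C f))) \<and>
     (\<forall>f \<in> Mor C. \<forall>g \<in> Mor C. Src C g = Tgt C f \<longrightarrow> FA (g \<cdot>\<^bsub>C\<^esub> f) = FA g \<cdot>\<^bsub>C\<^esub> FA f)"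

definition is_additive :: "('o, 'a, 'm) lincat_scheme \<Rightarrow> ('a \<Rightarrow> 'a) \<Rightarrow> bool" where
  "is_additive C FA \<longleftrightarrow> (\<forall>f \<in> Mor C. \<forall>g \<in> Hom C (Src C f) (Tgt C f).
     FA (Add C f g) = Add C (FA f) (FA g))"

definition is_exact :: "('o, 'a, 'm) lincat_scheme \<Rightarrow> ('a \<Rightarrow> 'a) \<Rightarrow> bool" where
  "is_exact C FA \<longleftrightarrow> (\<forall>k c. is_ker C c k \<and> is_coker C k c \<longrightarrow>
     is_ker C (FA c) (FA k) \<and> is_coker C (FA k) (FA c))"

locale shifted_abelian = linear_abelian C for C :: "('o, 'a) shcat" (structure) +
  assumes Sh_functor: "is_endofunctor C (ShO C) (ShA C)"
    and Sh_additive: "is_additive C (ShA C)"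
    and Sh_exact: "is_exact C (ShA C)"
    and Un_functor: "is_endofunctor C (UnO C) (UnA C)"
    and Unit_iso: "X \<in> Ob C \<Longrightarrow> Unit C X \<in> Hom C X (UnO C (ShO C X)) \<and> is_iso C (Unit C X)"
    and Unit_natural: "f \<in> Hom C X Y \<Longrightarrow> Unit C Y \<cdot> f = UnA C (ShA C f) \<cdot> Unit C X"
    and Counit_iso: "X \<in> Ob C \<Longrightarrow> Counit C X \<in> Hom C (ShO C (UnO C X)) X \<and> is_iso C (Counit C X)"
    and Counit_natural: "f \<in> Hom C X Y \<Longrightarrow> f \<cdot> Counit C X = Counit C Y \<cdot> ShA C (UnA C f)"
    and triangle_Sh: "X \<in> Ob C \<Longrightarrow> Counit C (ShO C X) \<cdot> ShA C (Unit C X) = Idn C (ShO C X)"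
    and triangle_Un: "X \<in> Ob C \<Longrightarrow> UnA C (Counit C X) \<cdot> Unit C (UnO C X) = Idn C (UnO C X)"

abbreviation shO :: "('o, 'a) shcat \<Rightarrow> nat \<Rightarrow> 'o \<Rightarrow> 'o" where
  "shO C m X \<equiv> (ShO C ^^ m) X"

abbreviation shA :: "('o, 'a) shcat \<Rightarrow> nat \<Rightarrow> 'a \<Rightarrow> 'a" where
  "shA C m f \<equiv> (ShA C ^^ m) f"

text \<open>The canonical isomorphism \<open>Y(m)(-m) \<cong> Y\<close>.\<close>

primrec unsh :: "('o, 'a) shcat \<Rightarrow> nat \<Rightarrow> 'o \<Rightarrow> 'a" where
  "unsh C 0 Y = Idn C Y"
| "unsh C (Suc m) Y = unsh C m Y \<cdot>\<^bsub>C\<^esub> (UnA C ^^ m) (cinv C (Unit C (shO C m Y)))"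

text \<open>The arrow \<open>X(-m) \<rightarrow> Y\<close> which is the translate of \<open>f : X \<rightarrow> Y(m)\<close>.\<close>

definition transl :: "('o, 'a) shcat \<Rightarrow> nat \<Rightarrow> 'o \<Rightarrow> 'a \<Rightarrow> 'a" where
  "transl C m Y f = unsh C m Y \<cdot>\<^bsub>C\<^esub> (UnA C ^^ m) f"

text \<open>The opposite category, with shift \<open>X \<mapsto> X(-1)\<close>.\<close>

definition opcat :: "('o, 'a) shcat \<Rightarrow> ('o, 'a) shcat" where
  "opcat C = \<lparr>Ob = Ob C, Mor = Mor C, Src = Tgt C, Tgt = Src C, Idn = Idn C,
     Cmp = (\<lambda>g f. f \<cdot>\<^bsub>C\<^esub> g), Zero = (\<lambda>X Y. Zero C Y X), Add = Add C, Scal = Scal C,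
     ShO = UnO C, ShA = UnA C, UnO = ShO C, UnA = ShA C, Unit = Counit C, Counit = Unit C\<rparr>"


section \<open>Filtered objects\<close>

text \<open>A filtered object \<open>(V, F)\<close> consists of the inclusions \<open>Fil p : F\<^sub>p V \<rightarrow> V\<close>. It is recorded together
  with a choice of its graded pieces \<open>Quo p : F\<^sub>p V \<rightarrow> V\<^sub>p\<close> and of their direct sum \<open>V\<^sub>*\<close>, with
  injections \<open>Inj p : V\<^sub>p \<rightarrow> V\<^sub>*\<close> and projections \<open>Prj p : V\<^sub>* \<rightarrow> V\<^sub>p\<close>. Carrying these choices along
  makes identifications of graded pieces, such as \<open>(V\<^sup>o)\<^sub>i = (V\<^sub>-\<^sub>i)\<^sup>o\<close>, literal.\<close>

record 'a filt =
  Fil :: "int \<Rightarrow> 'a"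
  Quo :: "int \<Rightarrow> 'a"
  Inj :: "int \<Rightarrow> 'a"
  Prj :: "int \<Rightarrow> 'a"

definition Und :: "('o, 'a, 'm) lincat_scheme \<Rightarrow> 'a filt \<Rightarrow> 'o" where
  "Und C V = Tgt C (Fil V 0)"

definition Grd :: "('o, 'a, 'm) lincat_scheme \<Rightarrow> 'a filt \<Rightarrow> int \<Rightarrow> 'o" where
  "Grd C V p = Tgt C (Quo V p)"

definition Sum :: "('o, 'a, 'm) lincat_scheme \<Rightarrow> 'a filt \<Rightarrow> 'o" where
  "Sum C V = Src C (Prj V 0)"

definition is_filtration :: "('o, 'a, 'm) lincat_scheme \<Rightarrow> 'a filt \<Rightarrow> bool" where
  "is_filtration C V \<longleftrightarrow>
     (\<forall>p. is_mono C (Fil V p) \<and> Tgt C (Fil V p) = Und C V) \<and>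
     (\<forall>p. factors C (Fil V (p + 1)) (Fil V p)) \<and>
     (\<exists>a. \<forall>p\<le>a. is_zero_ob C (Src C (Fil V p))) \<and>
     (\<exists>b. \<forall>p\<ge>b. is_iso C (Fil V p))"

text \<open>Filtered objects of type \<open>[-r, r]\<close>. Outside this range the graded pieces are zero, so
  \<open>V\<^sub>*\<close> is the direct sum over the range.\<close>

definition is_filt :: "('o, 'a, 'm) lincat_scheme \<Rightarrow> nat \<Rightarrow> 'a filt \<Rightarrow> bool" where
  "is_filt C r V \<longleftrightarrow> is_filtration C V \<and>
     (\<forall>p. is_coker C (fac C (Fil V p) (Fil V (p - 1))) (Quo V p)) \<and>
     (\<forall>p. p \<notin> {- int r..int r} \<longrightarrow> is_zero_ob C (Grd C V p)) \<and>
     is_dsum C {- int r..int r} (Grd C V) (Sum C V) (Inj V) (Prj V) \<and>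
     (\<forall>p. Inj V p \<in> Hom C (Grd C V p) (Sum C V) \<and> Prj V p \<in> Hom C (Sum C V) (Grd C V p))"

text \<open>Arrows \<open>V \<rightarrow> W[n](m)\<close> of filtered objects, and the arrow \<open>V\<^sub>p \<rightarrow> W\<^sub>p\<^sub>+\<^sub>n(m)\<close> induced by such an arrow.\<close>

definition is_farr :: "('o, 'a) shcat \<Rightarrow> 'a filt \<Rightarrow> 'a filt \<Rightarrow> int \<Rightarrow> nat \<Rightarrow> 'a \<Rightarrow> bool" where
  "is_farr C V W n m f \<longleftrightarrow> f \<in> Hom C (Und C V) (shO C m (Und C W)) \<and>
     (\<forall>p. factors C (shA C m (Fil W (p + n))) (f \<cdot>\<^bsub>C\<^esub> Fil V p))"

definition gr :: "('o, 'a) shcat \<Rightarrow> 'a filt \<Rightarrow> 'a filt \<Rightarrow> int \<Rightarrow> nat \<Rightarrow> 'a \<Rightarrow> int \<Rightarrow> 'a" where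
  "gr C V W n m f p = (THE g. g \<in> Hom C (Grd C V p) (shO C m (Grd C W (p + n))) \<and>
     g \<cdot>\<^bsub>C\<^esub> Quo V p =
       shA C m (Quo W (p + n)) \<cdot>\<^bsub>C\<^esub> fac C (shA C m (Fil W (p + n))) (f \<cdot>\<^bsub>C\<^esub> Fil V p))"

text \<open>The arrow \<open>e\<^sup>k : V \<rightarrow> V(k)\<close>.\<close>

primrec epow :: "('o, 'a) shcat \<Rightarrow> 'a \<Rightarrow> nat \<Rightarrow> 'a" where
  "epow C e 0 = Idn C (Src C e)"
| "epow C e (Suc k) = ShA C (epow C e k) \<cdot>\<^bsub>C\<^esub> e"

definition gre :: "('o, 'a) shcat \<Rightarrow> 'a filt \<Rightarrow> 'a \<Rightarrow> nat \<Rightarrow> int \<Rightarrow> 'a" where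
  "gre C V e k p = gr C V V (2 * int k) k (epow C e k) p"

definition HL :: "('o, 'a) shcat \<Rightarrow> 'a filt \<Rightarrow> 'a \<Rightarrow> bool" where
  "HL C V e \<longleftrightarrow> (\<forall>k. is_iso C (gre C V e k (- int k)))"

text \<open>\<open>V\<^sub>*\<close> as a filtered object: \<open>F\<^sub>p\<close> is the direct sum of the \<open>V\<^sub>j\<close> with \<open>j \<le> p\<close>.\<close>

definition star :: "('o, 'a, 'm) lincat_scheme \<Rightarrow> nat \<Rightarrow> 'a filt \<Rightarrow> 'a filt" where
  "star C r V =
     (let I = \<lambda>p. {j \<in> {- int r..int r}. j \<le> p};
          inc = \<lambda>p. SOME m. m \<in> Mor C \<and> Tgt C m = Sum C V \<and>
            (\<exists>\<iota> \<pi>. is_dsum C (I p) (Grd C V) (Src C m) \<iota> \<pi> \<and> (\<forall>j \<in> I p. m \<cdot>\<^bsub>C\<^esub> \<iota> j = Inj V j))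
      in \<lparr>Fil = inc, Quo = \<lambda>p. Prj V p \<cdot>\<^bsub>C\<^esub> inc p, Inj = Inj V, Prj = Prj V\<rparr>)"

text \<open>The arrow \<open>V\<^sub>p \<rightarrow> V / F\<^sub>p\<^sub>-\<^sub>1 V\<close>.\<close>

definition gr_incl :: "('o, 'a, 'm) lincat_scheme \<Rightarrow> 'a filt \<Rightarrow> int \<Rightarrow> 'a" where
  "gr_incl C V p = (THE g. g \<in> Hom C (Grd C V p) (Tgt C (coker C (Fil V (p - 1)))) \<and>
     g \<cdot>\<^bsub>C\<^esub> Quo V p = coker C (Fil V (p - 1)) \<cdot>\<^bsub>C\<^esub> Fil V p)"

text \<open>The opposite filtered object. Here \<open>coker C (Fil V (- i - 1)) : V \<rightarrow> V / F\<^sub>-\<^sub>i\<^sub>-\<^sub>1 V\<close> is the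
  inclusion of \<open>F\<^sup>o\<^sub>i V\<^sup>o\<close> in the opposite category.\<close>

definition opfilt :: "('o, 'a, 'm) lincat_scheme \<Rightarrow> 'a filt \<Rightarrow> 'a filt" where
  "opfilt C V = \<lparr>Fil = \<lambda>i. coker C (Fil V (- i - 1)), Quo = \<lambda>i. gr_incl C V (- i),
     Inj = \<lambda>i. Prj V (- i), Prj = \<lambda>i. Inj V (- i)\<rparr>"

definition oparr :: "('o, 'a) shcat \<Rightarrow> 'a \<Rightarrow> 'a" where
  "oparr C e = transl C 1 (Src C e) e"


section \<open>Splittings\<close>

definition is_splitting :: "('o, 'a) shcat \<Rightarrow> nat \<Rightarrow> 'a filt \<Rightarrow> 'a \<Rightarrow> bool" where
  "is_splitting C r V \<phi> \<longleftrightarrow> is_iso C \<phi> \<and> is_farr C (star C r V) V 0 0 \<phi> \<and>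
     is_farr C V (star C r V) 0 0 (cinv C \<phi>)"

definition is_good :: "('o, 'a) shcat \<Rightarrow> nat \<Rightarrow> 'a filt \<Rightarrow> 'a \<Rightarrow> bool" where
  "is_good C r V \<phi> \<longleftrightarrow> is_splitting C r V \<phi> \<and>
     (\<forall>p. gr C (star C r V) V 0 0 \<phi> p = Idn C (Grd C V p))"

definition etilde :: "('o, 'a) shcat \<Rightarrow> 'a \<Rightarrow> 'a \<Rightarrow> 'a" where
  "etilde C e \<phi> = ShA C (cinv C \<phi>) \<cdot>\<^bsub>C\<^esub> e \<cdot>\<^bsub>C\<^esub> \<phi>"

text \<open>The sum of the components \<open>V\<^sub>p \<rightarrow> V\<^sub>p\<^sub>+\<^sub>d(1)\<close> of an arrow \<open>u : V\<^sub>* \<rightarrow> V\<^sub>*(1)\<close>.\<close>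

definition comp_deg :: "('o, 'a) shcat \<Rightarrow> nat \<Rightarrow> 'a filt \<Rightarrow> int \<Rightarrow> 'a \<Rightarrow> 'a" where
  "comp_deg C r V d u = hsum C (Sum C V) (ShO C (Sum C V))
     (\<lambda>p. ShA C (Inj V (p + d) \<cdot>\<^bsub>C\<^esub> Prj V (p + d)) \<cdot>\<^bsub>C\<^esub> u \<cdot>\<^bsub>C\<^esub> (Inj V p \<cdot>\<^bsub>C\<^esub> Prj V p)) {- int r..int r}"

definition is_e_good :: "('o, 'a) shcat \<Rightarrow> nat \<Rightarrow> 'a filt \<Rightarrow> 'a \<Rightarrow> 'a \<Rightarrow> bool" where
  "is_e_good C r V e \<phi> \<longleftrightarrow> is_good C r V \<phi> \<and> etilde C e \<phi> = comp_deg C r V 2 (etilde C e \<phi>)"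


section \<open>The third Deligne isomorphism\<close>

definition grmap :: "('o, 'a) shcat \<Rightarrow> nat \<Rightarrow> 'a filt \<Rightarrow> 'a \<Rightarrow> 'a" where
  "grmap C r V e = hsum C (Sum C V) (ShO C (Sum C V))
     (\<lambda>p. ShA C (Inj V (p + 2)) \<cdot>\<^bsub>C\<^esub> gr C V V 2 1 e p \<cdot>\<^bsub>C\<^esub> Prj V p) {- int r..int r}"

text \<open>The \<open>k\<close>-th iterate of \<open>ad\<close>, applied to \<open>u : X \<rightarrow> X(m)\<close>, where \<open>e' : X \<rightarrow> X(1)\<close>.\<close>

primrec adpow :: "('o, 'a) shcat \<Rightarrow> 'o \<Rightarrow> 'a \<Rightarrow> nat \<Rightarrow> nat \<Rightarrow> 'a \<Rightarrow> 'a" where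
  "adpow C X e' 0 m u = u"
| "adpow C X e' (Suc k) m u = adpow C X e' k (Suc m)
     (shA C m e' \<cdot>\<^bsub>C\<^esub> u \<ominus>\<^bsub>hmod C X (shO C (Suc m) X)\<^esub> ShA C u \<cdot>\<^bsub>C\<^esub> e')"

definition phi_III :: "('o, 'a) shcat \<Rightarrow> nat \<Rightarrow> 'a filt \<Rightarrow> 'a \<Rightarrow> 'a" where
  "phi_III C r V e = (THE \<phi>. is_good C r V \<phi> \<and>
     (\<forall>d\<le>1. adpow C (Sum C V) (grmap C r V e) (nat (1 - d)) 1 (comp_deg C r V d (etilde C e \<phi>)) =
        Zero C (Sum C V) (shO C (nat (1 - d) + 1) (Sum C V))))"


section \<open>The isomorphisms \<open>\<omega>\<close>\<close>

text \<open>The inclusion \<open>V\<^sub>-\<^sub>r = F\<^sub>-\<^sub>r V \<rightarrow> V\<close> and the quotient \<open>V = F\<^sub>r V \<rightarrow> V\<^sub>r\<close>.\<close>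

definition first_incl :: "('o, 'a, 'm) lincat_scheme \<Rightarrow> nat \<Rightarrow> 'a filt \<Rightarrow> 'a" where
  "first_incl C r V = Fil V (- int r) \<cdot>\<^bsub>C\<^esub> cinv C (Quo V (- int r))"

definition last_quot :: "('o, 'a, 'm) lincat_scheme \<Rightarrow> nat \<Rightarrow> 'a filt \<Rightarrow> 'a" where
  "last_quot C r V = Quo V (int r) \<cdot>\<^bsub>C\<^esub> cinv C (Fil V (int r))"

text \<open>\<open>n = (f, g) : X \<rightarrow> Y \<oplus> Z\<close>.\<close>

definition is_pairing :: "('o, 'a, 'm) lincat_scheme \<Rightarrow> 'a \<Rightarrow> 'a \<Rightarrow> 'a \<Rightarrow> bool" where
  "is_pairing C f g n \<longleftrightarrow> n \<in> Mor C \<and> Src C n = Src C f \<and>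
     (\<exists>\<iota> \<pi>. is_dsum C {0::nat, 1} (\<lambda>i. if i = 0 then Tgt C f else Tgt C g) (Tgt C n) \<iota> \<pi> \<and>
        \<pi> 0 \<cdot>\<^bsub>C\<^esub> n = f \<and> \<pi> 1 \<cdot>\<^bsub>C\<^esub> n = g)"

text \<open>\<open>K\<close> is the source of \<open>\<iota>\<close> with the filtration induced from \<open>V\<close>, of type \<open>[-s, s]\<close>, and its
  graded pieces in this range are those of \<open>V\<close>.\<close>

definition is_induced ::
  "('o, 'a, 'm) lincat_scheme \<Rightarrow> nat \<Rightarrow> 'a filt \<Rightarrow> 'a filt \<Rightarrow> 'a \<Rightarrow> bool" where
  "is_induced C s V K \<iota> \<longleftrightarrow> is_filt C s K \<and> \<iota> \<in> Hom C (Und C K) (Und C V) \<and>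
     (\<forall>p. is_pullback C \<iota> (Fil V p) (Fil K p) (fac C (Fil V p) (\<iota> \<cdot>\<^bsub>C\<^esub> Fil K p))) \<and>
     (\<forall>p \<in> {- int s..int s}. Quo K p = Quo V p \<cdot>\<^bsub>C\<^esub> fac C (Fil V p) (\<iota> \<cdot>\<^bsub>C\<^esub> Fil K p))"

text \<open>The arrow \<open>V\<^sub>r \<rightarrow> V\<close> whose shift by \<open>r\<close> is \<open>e\<^sup>r \<circ> i \<circ> e\<^sub>r\<^sup>-\<^sup>1 : V\<^sub>r(r) \<rightarrow> V(r)\<close>.\<close>

definition last_incl :: "('o, 'a) shcat \<Rightarrow> nat \<Rightarrow> 'a filt \<Rightarrow> 'a \<Rightarrow> 'a" where
  "last_incl C r V e =
     transl C r (Und C V) (epow C e r \<cdot>\<^bsub>C\<^esub> first_incl C r V \<cdot>\<^bsub>C\<^esub> cinv C (gre C V e r (- int r)))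
     \<cdot>\<^bsub>C\<^esub> cinv C (unsh C r (Grd C V (int r)))"

text \<open>The graph of \<open>\<omega>\<^sub>I\<close>, by recursion on the type. The sum \<open>V\<^sub>-\<^sub>r \<oplus> K \<oplus> V\<^sub>r\<close> is \<open>D\<close>, with indices
  0, 1, 2, and \<open>\<kappa> : V\<^sub>* \<rightarrow> K\<^sub>*\<close> is the projection given by \<open>V\<^sub>p = K\<^sub>p\<close>.\<close>

primrec is_omega_I :: "('o, 'a) shcat \<Rightarrow> nat \<Rightarrow> 'a filt \<Rightarrow> 'a \<Rightarrow> 'a \<Rightarrow> bool" where
  "is_omega_I C 0 V e \<omega> \<longleftrightarrow> \<omega> = first_incl C 0 V \<cdot>\<^bsub>C\<^esub> Prj V 0"
| "is_omega_I C (Suc s) V e \<omega> \<longleftrightarrow>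
     (let r = Suc s; i = first_incl C r V; p = last_quot C r V in
      \<exists>n \<iota> K D \<iota>D \<pi>D \<omega>'.
        is_pairing C (shA C r p \<cdot>\<^bsub>C\<^esub> epow C e r) p n \<and> is_ker C n \<iota> \<and> is_induced C s V K \<iota> \<and>
        is_dsum C {0::nat, 1, 2}
          (\<lambda>j. if j = 0 then Grd C V (- int r) else if j = 1 then Und C K else Grd C V (int r))
          D \<iota>D \<pi>D \<and>
        (let w = hsum C D (Und C V)
               (\<lambda>j. (if j = 0 then i else if j = 1 then \<iota> else last_incl C r V e) \<cdot>\<^bsub>C\<^esub> \<pi>D j) {0, 1, 2};
             e' = ShA C (\<pi>D 1) \<cdot>\<^bsub>C\<^esub> (ShA C (cinv C w) \<cdot>\<^bsub>C\<^esub> e \<cdot>\<^bsub>C\<^esub> w) \<cdot>\<^bsub>C\<^esub> \<iota>D 1;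
             \<kappa> = hsum C (Sum C V) (Sum C K) (\<lambda>j. Inj K j \<cdot>\<^bsub>C\<^esub> Prj V j) {- int s..int s}
         in is_omega_I C s K e' \<omega>' \<and>
            \<omega> = w \<cdot>\<^bsub>C\<^esub> hsum C (Sum C V) D
              (\<lambda>j. \<iota>D j \<cdot>\<^bsub>C\<^esub> (if j = 0 then Prj V (- int r) else if j = 1 then \<omega>' \<cdot>\<^bsub>C\<^esub> \<kappa>
                              else Prj V (int r))) {0, 1, 2}))"

definition omega_I :: "('o, 'a) shcat \<Rightarrow> nat \<Rightarrow> 'a filt \<Rightarrow> 'a \<Rightarrow> 'a" where
  "omega_I C r V e = (THE \<omega>. is_omega_I C r V e \<omega>)"

definition omega_II :: "('o, 'a) shcat \<Rightarrow> nat \<Rightarrow> 'a filt \<Rightarrow> 'a \<Rightarrow> 'a" where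
  "omega_II C r V e = cinv C (omega_I (opcat C) r (opfilt C V) (oparr C e))"


section \<open>The first and second Deligne isomorphisms\<close>

text \<open>\<open>f\<close> is the distinguished lift \<open>f\<^sub>i\<close>, where \<open>k : P\<^sub>-\<^sub>i \<rightarrow> V\<^sub>-\<^sub>i\<close>. As \<open>P\<^sub>-\<^sub>i\<close> is placed in degree
  \<open>-i\<close>, an arrow from it respects filtrations iff it factors through \<open>F\<^sub>-\<^sub>i V\<close>.\<close>

definition is_prim_lift :: "('o, 'a) shcat \<Rightarrow> 'a filt \<Rightarrow> 'a \<Rightarrow> nat \<Rightarrow> 'a \<Rightarrow> 'a \<Rightarrow> bool" where
  "is_prim_lift C V e i k f \<longleftrightarrow> f \<in> Hom C (Src C k) (Und C V) \<and>
     factors C (Fil V (- int i)) f \<and>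
     coker C (Fil V (- int i - 1)) \<cdot>\<^bsub>C\<^esub> f = gr_incl C V (- int i) \<cdot>\<^bsub>C\<^esub> k \<and>
     (\<forall>s>i. shA C s (coker C (Fil V (int s - 1))) \<cdot>\<^bsub>C\<^esub> (epow C e s \<cdot>\<^bsub>C\<^esub> f) =
        Zero C (Src C k) (shO C s (Tgt C (coker C (Fil V (int s - 1))))))"

text \<open>\<open>D\<close> is the direct sum of the \<open>P\<^sub>-\<^sub>i(-j)\<close>, for \<open>0 \<le> j \<le> i \<le> r\<close>; \<open>P\<^sub>-\<^sub>i = 0\<close> for \<open>i > r\<close>.\<close>

definition is_phi_I :: "('o, 'a) shcat \<Rightarrow> nat \<Rightarrow> 'a filt \<Rightarrow> 'a \<Rightarrow> 'a \<Rightarrow> bool" where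
  "is_phi_I C r V e \<phi> \<longleftrightarrow>
     (\<exists>k f D \<iota>D \<pi>D.
        (\<forall>i\<le>r. is_ker C (gre C V e (i + 1) (- int i)) (k i) \<and> is_prim_lift C V e i (k i) (f i)) \<and>
        (let J = {(i, j). j \<le> i \<and> i \<le> r};
             \<epsilon> = hsum C D (Sum C V) (\<lambda>(i, j). Inj V (- int i + 2 * int j) \<cdot>\<^bsub>C\<^esub>
               transl C j (Grd C V (- int i + 2 * int j)) (gre C V e j (- int i) \<cdot>\<^bsub>C\<^esub> k i)
               \<cdot>\<^bsub>C\<^esub> \<pi>D (i, j)) J;
             \<sigma> = hsum C D (Und C V) (\<lambda>(i, j).
               transl C j (Und C V) (epow C e j \<cdot>\<^bsub>C\<^esub> f i) \<cdot>\<^bsub>C\<^esub> \<pi>D (i, j)) J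
         in is_dsum C J (\<lambda>(i, j). (UnO C ^^ j) (Src C (k i))) D \<iota>D \<pi>D \<and>
            \<phi> = \<sigma> \<cdot>\<^bsub>C\<^esub> cinv C \<epsilon>))"

definition phi_I :: "('o, 'a) shcat \<Rightarrow> nat \<Rightarrow> 'a filt \<Rightarrow> 'a \<Rightarrow> 'a" where
  "phi_I C r V e = (THE \<phi>. is_phi_I C r V e \<phi>)"

definition phi_II :: "('o, 'a) shcat \<Rightarrow> nat \<Rightarrow> 'a filt \<Rightarrow> 'a \<Rightarrow> 'a" where
  "phi_II C r V e = cinv C (phi_I (opcat C) r (opfilt C V) (oparr C e))"

end

theory Submission
  imports Defs
begin

text \<open>Let \<open>\<phi>\<close> be an \<open>e\<close>-good splitting. With \<open>I\<^sub>p : V\<^sub>p \<rightarrow> V\<close> and \<open>P\<^sub>p : V \<rightarrow> V\<^sub>p\<close> its components, \<open>e\<close>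
  carries \<open>I\<^sub>p\<close> to \<open>I\<^sub>p\<^sub>+\<^sub>2\<close>, and each construction is evaluated in these terms: the kernel \<open>K\<close> in the
  recursion for \<open>\<omega>\<^sub>I\<close> is the sum of the inner \<open>V\<^sub>p\<close>, again with a graded arrow, and the lift
  \<open>f\<^sub>i\<close> is \<open>I\<^sub>-\<^sub>i\<close> restricted to the primitive part, so \<open>\<omega>\<^sub>I\<close> and \<open>\<phi>\<^sub>I\<close> both equal \<open>\<phi>\<close>. The components
  \<open>P\<^sub>-\<^sub>p, I\<^sub>-\<^sub>p\<close> form such data in the opposite category, which settles \<open>\<omega>\<^sub>I\<^sub>I\<close> and \<open>\<phi>\<^sub>I\<^sub>I\<close>.

  For the third isomorphism, let \<open>\<psi>\<close> satisfy its condition, and let \<open>u\<close> of degree \<open>-d < 0\<close> be the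
  first nonzero component of \<open>\<phi>\<^sup>-\<^sup>1\<psi> - 1\<close>. Then the component of degree \<open>2 - d\<close> of the conjugate of
  \<open>e\<close> by \<open>\<psi>\<close> is \<open>ad u\<close>, whence \<open>ad\<^sup>d u = 0\<close>. The Lefschetz decomposition yields an operator \<open>F\<close>
  with \<open>[e, F] = p\<close> on \<open>V\<^sub>p\<close>, so graded endomorphisms form an \<open>sl\<^sub>2\<close>-module of bounded weights, on
  which \<open>ad\<^sup>d\<close> is injective in weight \<open>-d\<close>. Hence \<open>u = 0\<close>.\<close>

section \<open>Rational linear categories\<close>

text \<open>Two features of the setting shape the proof. One is that \<open>e\<close> lands in V(1):
  its powers take values in different shifts, whereas sl2 operators must compose freely. So V_p is
  replaced by V_p(m) with m about (p + s)/2, which absorbs the shifts. A map of degree -d then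
  carries no shift exactly when source and target use values of s that differ by d. Hence it is the
  graded maps between two Lefschetz objects, and not the endomorphisms of one, that carry the
  sl2-action, and odd d are covered as well. The other is that \<open>is_omega_I\<close> and
  \<open>is_phi_I\<close> are relations which leave kernels, direct sums and \<open>K\<close> open.
  Each is shown to hold exactly for the given splitting: every choice leads to it and some choice
  exists, so the definite descriptions denote it. For \<open>phi_III\<close> no general existence
  result enters: an e-good splitting solves the defining condition, and only uniqueness against it
  has to be shown.\<close>

lemma Hom_iff: "f \<in> Hom C X Y \<longleftrightarrow> f \<in> Mor C \<and> Src C f = X \<and> Tgt C f = Y"
  by (auto simp: Hom_def)

context linear_category
begin

lemma Cmp_simps [simp]:
  assumes "f \<in> Mor C" "g \<in> Mor C" "Src C g = Tgt C f"
  shows "g \<cdot> f \<in> Mor C" "Src C (g \<cdot> f) = Src C f" "Tgt C (g \<cdot> f) = Tgt C g"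
  using Cmp_Hom[of f "Src C f" "Tgt C f" g "Tgt C g"] assms by (auto simp: Hom_iff)

lemma Idn_simps [simp]:
  assumes "X \<in> Ob C"
  shows "Idn C X \<in> Mor C" "Src C (Idn C X) = X" "Tgt C (Idn C X) = X"
  using Idn_Hom[OF assms] by (auto simp: Hom_iff)

lemma Ob_simps [simp]: "f \<in> Mor C \<Longrightarrow> Src C f \<in> Ob C" "f \<in> Mor C \<Longrightarrow> Tgt C f \<in> Ob C"
  by (fact Src_Ob Tgt_Ob)+

lemma Cmp_Idn [simp]:
  "\<lbrakk>f \<in> Mor C; X = Src C f\<rbrakk> \<Longrightarrow> f \<cdot> Idn C X = f" "\<lbrakk>f \<in> Mor C; X = Tgt C f\<rbrakk> \<Longrightarrow> Idn C X \<cdot> f = f"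
  using Cmp_Idn_right Cmp_Idn_left by (auto simp: Hom_iff)

lemma assoc [simp]:
  "\<lbrakk>f \<in> Mor C; g \<in> Mor C; h \<in> Mor C; Src C g = Tgt C f; Src C h = Tgt C g\<rbrakk> \<Longrightarrow>
    (h \<cdot> g) \<cdot> f = h \<cdot> (g \<cdot> f)"
  by (rule Cmp_assoc) (auto simp: Hom_iff)

lemma hmod_simps [simp]: "carrier (hmod C X Y) = Hom C X Y" "\<zero>\<^bsub>hmod C X Y\<^esub> = Zero C X Y"
  "add (hmod C X Y) = Add C" "smult (hmod C X Y) = Scal C"
  by (auto simp: hmod_def)

lemma rat_ring_simps [simp]: "carrier rat_ring = UNIV" "\<zero>\<^bsub>rat_ring\<^esub> = 0" "\<one>\<^bsub>rat_ring\<^esub> = 1"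
  "add rat_ring = (+)" "mult rat_ring = (*)"
  by (auto simp: rat_ring_def)

lemma Zero_simps [simp]:
  assumes "X \<in> Ob C" "Y \<in> Ob C"
  shows "Zero C X Y \<in> Mor C" "Src C (Zero C X Y) = X" "Tgt C (Zero C X Y) = Y"
proof -
  interpret module rat_ring "hmod C X Y" by (rule Hom_module[OF assms])
  show "Zero C X Y \<in> Mor C" "Src C (Zero C X Y) = X" "Tgt C (Zero C X Y) = Y"
    using M.zero_closed by (auto simp: Hom_iff)
qed

lemma Add_simps [simp]:
  assumes "f \<in> Mor C" "g \<in> Mor C" "Src C f = Src C g" "Tgt C f = Tgt C g"
  shows "Add C f g \<in> Mor C" "Src C (Add C f g) = Src C g" "Tgt C (Add C f g) = Tgt C g"
proof -
  interpret module rat_ring "hmod C (Src C f) (Tgt C f)" using assms by (intro Hom_module) auto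
  have "Add C f g \<in> Hom C (Src C f) (Tgt C f)"
    using M.add.m_closed[of f g] assms by (auto simp: Hom_iff)
  then show "Add C f g \<in> Mor C" "Src C (Add C f g) = Src C g" "Tgt C (Add C f g) = Tgt C g"
    using assms by (auto simp: Hom_iff)
qed

lemma Scal_simps [simp]:
  assumes "f \<in> Mor C"
  shows "Scal C a f \<in> Mor C" "Src C (Scal C a f) = Src C f" "Tgt C (Scal C a f) = Tgt C f"
proof -
  interpret module rat_ring "hmod C (Src C f) (Tgt C f)" using assms by (intro Hom_module) auto
  have "Scal C a f \<in> Hom C (Src C f) (Tgt C f)"
    using smult_closed[of a f] assms by (auto simp: Hom_iff)
  then show "Scal C a f \<in> Mor C" "Src C (Scal C a f) = Src C f" "Tgt C (Scal C a f) = Tgt C f"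
    using assms by (auto simp: Hom_iff)
qed

lemma Add_assoc:
  assumes "f \<in> Mor C" "g \<in> Mor C" "h \<in> Mor C" "Src C f = Src C g" "Tgt C f = Tgt C g" "Src C g = Src C h" "Tgt C g = Tgt C h"
  shows "Add C (Add C f g) h = Add C f (Add C g h)"
proof -
  interpret module rat_ring "hmod C (Src C f) (Tgt C f)" using assms by (intro Hom_module) auto
  show ?thesis using M.add.m_assoc[of f g h] assms by (auto simp: Hom_iff)
qed

lemma Add_commute:
  assumes "f \<in> Mor C" "g \<in> Mor C" "Src C f = Src C g" "Tgt C f = Tgt C g"
  shows "Add C f g = Add C g f"
proof -
  interpret module rat_ring "hmod C (Src C f) (Tgt C f)" using assms by (intro Hom_module) auto
  show ?thesis using M.add.m_comm[of f g] assms by (auto simp: Hom_iff)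
qed

lemma Add_left_commute:
  assumes "f \<in> Mor C" "g \<in> Mor C" "h \<in> Mor C" "Src C f = Src C g" "Tgt C f = Tgt C g" "Src C g = Src C h" "Tgt C g = Tgt C h"
  shows "Add C f (Add C g h) = Add C g (Add C f h)"
  using assms Add_assoc[of f g h] Add_assoc[of g f h] Add_commute[of f g] by simp

lemma Add_Zero [simp]:
  assumes "f \<in> Mor C" "Src C f = X" "Tgt C f = Y"
  shows "Add C f (Zero C X Y) = f" "Add C (Zero C X Y) f = f"
proof -
  interpret module rat_ring "hmod C (Src C f) (Tgt C f)" using assms by (intro Hom_module) auto
  show "Add C f (Zero C X Y) = f" "Add C (Zero C X Y) f = f"
    using M.add.r_one[of f] M.add.l_one[of f] assms by (auto simp: Hom_iff)
qed

lemma Scal_Add: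
  assumes "f \<in> Mor C" "g \<in> Mor C" "Src C f = Src C g" "Tgt C f = Tgt C g"
  shows "Scal C a (Add C f g) = Add C (Scal C a f) (Scal C a g)"
proof -
  interpret module rat_ring "hmod C (Src C f) (Tgt C f)" using assms by (intro Hom_module) auto
  show ?thesis using smult_r_distr[of a f g] assms by (auto simp: Hom_iff)
qed

lemma Add_Scal:
  assumes "f \<in> Mor C"
  shows "Add C (Scal C a f) (Scal C b f) = Scal C (a + b) f"
proof -
  interpret module rat_ring "hmod C (Src C f) (Tgt C f)" using assms by (intro Hom_module) auto
  show ?thesis using smult_l_distr[of a b f] assms by (auto simp: Hom_iff)
qed

lemma Scal_Scal [simp]:
  assumes "f \<in> Mor C"
  shows "Scal C a (Scal C b f) = Scal C (a * b) f"
proof -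
  interpret module rat_ring "hmod C (Src C f) (Tgt C f)" using assms by (intro Hom_module) auto
  show ?thesis using smult_assoc1[of a b f] assms by (auto simp: Hom_iff)
qed

lemma Scal_1 [simp]:
  assumes "f \<in> Mor C"
  shows "Scal C 1 f = f"
proof -
  interpret module rat_ring "hmod C (Src C f) (Tgt C f)" using assms by (intro Hom_module) auto
  show ?thesis using smult_one[of f] assms by (auto simp: Hom_iff)
qed

lemma Scal_0 [simp]:
  assumes "f \<in> Mor C"
  shows "Scal C 0 f = Zero C (Src C f) (Tgt C f)"
proof -
  interpret module rat_ring "hmod C (Src C f) (Tgt C f)" using assms by (intro Hom_module) auto
  show ?thesis using smult_l_null[of f] assms by (auto simp: Hom_iff)
qed

lemma Scal_Zero [simp]:
  assumes "X \<in> Ob C" "Y \<in> Ob C"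
  shows "Scal C a (Zero C X Y) = Zero C X Y"
proof -
  interpret module rat_ring "hmod C X Y" using assms by (intro Hom_module) auto
  show ?thesis using smult_r_null[of a] by simp
qed

text \<open>Scalars can be inverted over the rationals. Later this removes the integer factors that
  the sl2 relation produces.\<close>

lemma Scal_eq_Zero:
  assumes "f \<in> Mor C" "a \<noteq> 0" "Scal C a f = Zero C (Src C f) (Tgt C f)"
  shows "f = Zero C (Src C f) (Tgt C f)"
proof -
  have "f = Scal C (1 / a) (Scal C a f)" using assms(1,2) by (subst Scal_Scal) simp_all
  then show ?thesis using assms by simp
qed

lemma Cmp_Scal [simp]:
  assumes "f \<in> Mor C" "g \<in> Mor C" "Src C g = Tgt C f"
  shows "g \<cdot> Scal C a f = Scal C a (g \<cdot> f)" "Scal C a g \<cdot> f = Scal C a (g \<cdot> f)"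
  using Cmp_Scal_right Cmp_Scal_left assms by (auto simp: Hom_iff)

lemma Cmp_Add:
  assumes "f \<in> Mor C" "f' \<in> Mor C" "Src C f = Src C f'" "Tgt C f = Tgt C f'"
  shows "\<lbrakk>g \<in> Mor C; Src C g = Tgt C f'\<rbrakk> \<Longrightarrow> g \<cdot> Add C f f' = Add C (g \<cdot> f) (g \<cdot> f')"
    "\<lbrakk>g \<in> Mor C; Tgt C g = Src C f'\<rbrakk> \<Longrightarrow> Add C f f' \<cdot> g = Add C (f \<cdot> g) (f' \<cdot> g)"
  using Cmp_Add_right[of f "Src C f" "Tgt C f" f' g "Tgt C g"]
    Cmp_Add_left[of g "Src C g" "Src C f" f "Tgt C f" f'] assms by (auto simp: Hom_iff)

lemma Cmp_Zero [simp]: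
  assumes f: "f \<in> Mor C"
  shows "\<lbrakk>X \<in> Ob C; Y = Src C f\<rbrakk> \<Longrightarrow> f \<cdot> Zero C X Y = Zero C X (Tgt C f)"
    "\<lbrakk>Y \<in> Ob C; X = Tgt C f\<rbrakk> \<Longrightarrow> Zero C X Y \<cdot> f = Zero C (Src C f) Y"
proof -
  assume X: "X \<in> Ob C" "Y = Src C f"
  have "f \<cdot> Zero C X Y = f \<cdot> Scal C 0 (Zero C X Y)" using f X by simp
  also have "\<dots> = Scal C 0 (f \<cdot> Zero C X Y)" using f X by (intro Cmp_Scal) simp_all
  also have "\<dots> = Zero C X (Tgt C f)" using f X by (subst Scal_0) simp_all
  finally show "f \<cdot> Zero C X Y = Zero C X (Tgt C f)" .
next
  assume X: "Y \<in> Ob C" "X = Tgt C f"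
  have "Zero C X Y \<cdot> f = Scal C 0 (Zero C X Y) \<cdot> f" using f X by simp
  also have "\<dots> = Scal C 0 (Zero C X Y \<cdot> f)" using f X by (intro Cmp_Scal) simp_all
  also have "\<dots> = Zero C (Src C f) Y" using f X by (subst Scal_0) simp_all
  finally show "Zero C X Y \<cdot> f = Zero C (Src C f) Y" .
qed

lemma Add_cancel:
  assumes "f \<in> Mor C" "Src C f = X" "Tgt C f = Y"
  shows "Add C f (Scal C (-1) f) = Zero C X Y"
  using Add_Scal[OF assms(1), of 1 "-1"] assms by simp

lemma Sub_eq_Zero:
  assumes "f \<in> Mor C" "g \<in> Mor C" "Src C f = Src C g" "Tgt C f = Tgt C g"
    and "Add C f (Scal C (-1) g) = Zero C (Src C f) (Tgt C f)"
  shows "f = g"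
proof -
  have "f = Add C f (Add C (Scal C (-1) g) g)"
    using assms Add_commute[of "Scal C (-1) g" g] by (simp add: Add_cancel)
  also have "\<dots> = Add C (Add C f (Scal C (-1) g)) g" using assms by (subst Add_assoc) auto
  also have "\<dots> = g" using assms(1-4) by (subst assms(5)) simp
  finally show ?thesis .
qed

end

declare Hom_iff [simp]

context linear_category
begin

text \<open>With \<open>assoc\<close> as a simplification rule, composites are kept nested to the
  right, so an equation for a composite of two arrows no longer matches inside a longer one. This
  form applies it there.\<close>

lemma Cmp_reassoc:
  assumes "g \<cdot> f = k" "f \<in> Mor C" "g \<in> Mor C" "h \<in> Mor C" "Src C g = Tgt C f" "Src C f = Tgt C h"
  shows "g \<cdot> (f \<cdot> h) = k \<cdot> h"
  unfolding assms(1)[symmetric] using assms(2-) by (intro assoc[symmetric]) auto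

section \<open>Finite sums of arrows\<close>

lemma hsum_Hom:
  assumes "X \<in> Ob C" "Y \<in> Ob C" "\<And>i. i \<in> I \<Longrightarrow> f i \<in> Hom C X Y"
  shows "hsum C X Y f I \<in> Hom C X Y"
proof -
  interpret module rat_ring "hmod C X Y" by (rule Hom_module[OF assms(1,2)])
  show ?thesis using M.finsum_closed[of f I] assms(3) unfolding hsum_def by (auto simp: Pi_iff)
qed

lemmas hsum_simps [simp] = hsum_Hom[unfolded Hom_iff, THEN conjunct1]
  hsum_Hom[unfolded Hom_iff, THEN conjunct2, THEN conjunct1]
  hsum_Hom[unfolded Hom_iff, THEN conjunct2, THEN conjunct2]

lemma hsum_empty [simp]: "\<lbrakk>X \<in> Ob C; Y \<in> Ob C\<rbrakk> \<Longrightarrow> hsum C X Y f {} = Zero C X Y"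
proof -
  assume "X \<in> Ob C" "Y \<in> Ob C"
  then interpret module rat_ring "hmod C X Y" by (rule Hom_module)
  show ?thesis unfolding hsum_def by simp
qed

lemma hsum_insert:
  assumes "X \<in> Ob C" "Y \<in> Ob C" "\<And>i. i \<in> I \<Longrightarrow> f i \<in> Hom C X Y" "f j \<in> Hom C X Y" "finite I" "j \<notin> I"
  shows "hsum C X Y f (insert j I) = Add C (f j) (hsum C X Y f I)"
proof -
  interpret module rat_ring "hmod C X Y" by (rule Hom_module[OF assms(1,2)])
  show ?thesis using M.finsum_insert[of I j f] assms(3-) unfolding hsum_def by (auto simp: Pi_iff)
qed

lemma hsum_cong:
  assumes "X \<in> Ob C" "Y \<in> Ob C" "\<And>i. i \<in> I \<Longrightarrow> f i = g i" "\<And>i. i \<in> I \<Longrightarrow> g i \<in> Hom C X Y"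
  shows "hsum C X Y f I = hsum C X Y g I"
proof -
  interpret module rat_ring "hmod C X Y" by (rule Hom_module[OF assms(1,2)])
  show ?thesis using M.finsum_cong'[of I I g f] assms(3,4) unfolding hsum_def by (auto simp: Pi_iff)
qed

lemma hsum_Zero:
  assumes "X \<in> Ob C" "Y \<in> Ob C" "finite I" "\<And>i. i \<in> I \<Longrightarrow> f i = Zero C X Y"
  shows "hsum C X Y f I = Zero C X Y"
  using assms(3,4) by (induction I rule: finite_induct) (simp_all add: hsum_insert assms(1,2))

lemma hsum_single:
  assumes "X \<in> Ob C" "Y \<in> Ob C" "finite I" "j \<in> I" "f j \<in> Hom C X Y" "\<And>i. \<lbrakk>i \<in> I; i \<noteq> j\<rbrakk> \<Longrightarrow> f i = Zero C X Y"
  shows "hsum C X Y f I = f j"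
proof -
  have "hsum C X Y f (insert j (I - {j})) = Add C (f j) (hsum C X Y f (I - {j}))"
    using assms by (intro hsum_insert) auto
  moreover have "hsum C X Y f (I - {j}) = Zero C X Y" using assms by (intro hsum_Zero) auto
  moreover have "insert j (I - {j}) = I" using assms by auto
  ultimately show ?thesis using assms by simp
qed

lemma Cmp_hsum:
  assumes "X \<in> Ob C" "Y \<in> Ob C" "finite I" "\<And>i. i \<in> I \<Longrightarrow> f i \<in> Hom C X Y" "g \<in> Mor C"
  shows "Src C g = Y \<Longrightarrow> g \<cdot> hsum C X Y f I = hsum C X (Tgt C g) (\<lambda>i. g \<cdot> f i) I"
    "Tgt C g = X \<Longrightarrow> hsum C X Y f I \<cdot> g = hsum C (Src C g) Y (\<lambda>i. f i \<cdot> g) I"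
  using assms(3,4)
  by (induction I rule: finite_induct) (simp_all add: hsum_insert assms(1,2,5) Cmp_Add)

section \<open>Isomorphisms, monomorphisms, epimorphisms and factorizations\<close>

lemma isoI:
  assumes "g \<cdot> f = Idn C (Src C f)" "f \<cdot> g = Idn C (Tgt C f)" "f \<in> Mor C" "g \<in> Mor C"
    "Src C g = Tgt C f" "Tgt C g = Src C f"
  shows "is_iso C f"
  using assms unfolding is_iso_def by auto

lemma cinv_eqI:
  assumes "g \<cdot> f = Idn C (Src C f)" "f \<cdot> g = Idn C (Tgt C f)" "f \<in> Mor C" "g \<in> Mor C"
    "Src C g = Tgt C f" "Tgt C g = Src C f"
  shows "cinv C f = g"
  unfolding cinv_def
proof (rule the_equality)
  fix h assume h: "h \<in> Hom C (Tgt C f) (Src C f) \<and> h \<cdot> f = Idn C (Src C f) \<and> f \<cdot> h = Idn C (Tgt C f)"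
  then have "h = h \<cdot> (f \<cdot> g)" using assms by simp
  also have "\<dots> = (h \<cdot> f) \<cdot> g" using assms h by (subst assoc) auto
  also have "\<dots> = g" using assms h by simp
  finally show "h = g" .
qed (use assms in auto)

lemma iso_Mor: "is_iso C f \<Longrightarrow> f \<in> Mor C"
  by (simp add: is_iso_def)

lemma cinv_simps [simp]:
  assumes "is_iso C f"
  shows "cinv C f \<in> Mor C" "Src C (cinv C f) = Tgt C f" "Tgt C (cinv C f) = Src C f"
    "cinv C f \<cdot> f = Idn C (Src C f)" "f \<cdot> cinv C f = Idn C (Tgt C f)"
proof -
  obtain g where g: "g \<in> Hom C (Tgt C f) (Src C f)" "g \<cdot> f = Idn C (Src C f)" "f \<cdot> g = Idn C (Tgt C f)" "f \<in> Mor C"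
    using assms unfolding is_iso_def by auto
  then have "cinv C f = g" by (intro cinv_eqI) auto
  with g show "cinv C f \<in> Mor C" "Src C (cinv C f) = Tgt C f" "Tgt C (cinv C f) = Src C f"
    "cinv C f \<cdot> f = Idn C (Src C f)" "f \<cdot> cinv C f = Idn C (Tgt C f)" by auto
qed

lemma cinv_cancel [simp]:
  assumes "is_iso C f" "h \<in> Mor C"
  shows "Tgt C h = Src C f \<Longrightarrow> cinv C f \<cdot> (f \<cdot> h) = h"
    "Tgt C h = Tgt C f \<Longrightarrow> f \<cdot> (cinv C f \<cdot> h) = h"
  using assms iso_Mor[OF assms(1)] by (subst Cmp_reassoc[OF cinv_simps(4)] Cmp_reassoc[OF cinv_simps(5)]; simp)+

lemma iso_Idn [simp]: "X \<in> Ob C \<Longrightarrow> is_iso C (Idn C X)"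
  by (rule isoI[of "Idn C X"]) auto

lemma iso_Cmp:
  assumes "is_iso C f" "is_iso C g" "Src C g = Tgt C f"
  shows "is_iso C (g \<cdot> f)"
  using assms iso_Mor[OF assms(1)] iso_Mor[OF assms(2)] by (intro isoI[of "cinv C f \<cdot> cinv C g"]) auto

lemma iso_cinv: "is_iso C f \<Longrightarrow> is_iso C (cinv C f)"
  using iso_Mor[of f] by (intro isoI[of f]) auto

lemma cinv_cinv: "is_iso C f \<Longrightarrow> cinv C (cinv C f) = f"
  using iso_Mor[of f] by (intro cinv_eqI) auto

lemma iso_cancel_left:
  assumes "is_iso C f" "f \<cdot> g = f \<cdot> h" "g \<in> Mor C" "h \<in> Mor C" "Tgt C g = Src C f" "Tgt C h = Src C f"
  shows "g = h"
proof -
  have "g = cinv C f \<cdot> (f \<cdot> g)" using assms(1,3,5) by simp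
  also have "\<dots> = h" unfolding assms(2) using assms(1,4,6) by simp
  finally show ?thesis .
qed

lemma iso_cancel_right:
  assumes "is_iso C f" "g \<cdot> f = h \<cdot> f" "g \<in> Mor C" "h \<in> Mor C" "Src C g = Tgt C f" "Src C h = Tgt C f"
  shows "g = h"
proof -
  have "g = (g \<cdot> f) \<cdot> cinv C f" using assms(1,3-) iso_Mor[OF assms(1)] by simp
  also have "\<dots> = h" unfolding assms(2) using assms(1,3-) iso_Mor[OF assms(1)] by simp
  finally show ?thesis .
qed

lemma mono_Mor: "is_mono C m \<Longrightarrow> m \<in> Mor C"
  by (simp add: is_mono_def)

lemma mono_cancel:
  assumes "is_mono C m" "m \<cdot> f = m \<cdot> g" "f \<in> Mor C" "g \<in> Mor C" "Src C f = Src C g"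
    "Tgt C f = Src C m" "Tgt C g = Src C m"
  shows "f = g"
  using assms unfolding is_mono_def by (metis Hom_iff Ob_simps(1))

lemma monoI:
  assumes "m \<in> Mor C" "\<And>f g. \<lbrakk>f \<in> Mor C; g \<in> Mor C; Src C f = Src C g; Tgt C f = Src C m; Tgt C g = Src C m;
    m \<cdot> f = m \<cdot> g\<rbrakk> \<Longrightarrow> f = g"
  shows "is_mono C m"
  using assms unfolding is_mono_def by auto

lemma epi_cancel:
  assumes "is_epi C m" "f \<cdot> m = g \<cdot> m" "f \<in> Mor C" "g \<in> Mor C" "Tgt C f = Tgt C g"
    "Src C f = Tgt C m" "Src C g = Tgt C m"
  shows "f = g"
  using assms unfolding is_epi_def by (metis Hom_iff Ob_simps(2))

lemma retract_epi:
  assumes "q \<in> Mor C" "s \<in> Mor C" "q \<cdot> s = Idn C (Tgt C q)" "Tgt C s = Src C q" "Src C s = Tgt C q"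
  shows "is_epi C q"
  unfolding is_epi_def
proof (intro conjI ballI impI)
  fix Y f g assume H: "Y \<in> Ob C" "f \<in> Hom C (Tgt C q) Y" "g \<in> Hom C (Tgt C q) Y" "f \<cdot> q = g \<cdot> q"
  have "f = (f \<cdot> q) \<cdot> s" using assms H(2) by simp
  also have "\<dots> = g" unfolding H(4) using assms H(3) by simp
  finally show "f = g" .
qed fact

lemma fac_eqI:
  assumes "is_mono C m" "m \<cdot> h = f" "h \<in> Mor C" "Tgt C h = Src C m"
  shows "fac C m f = h"
  unfolding fac_def
proof (rule the_equality)
  show "h \<in> Hom C (Src C f) (Src C m) \<and> m \<cdot> h = f" using assms mono_Mor[of m] by auto
  fix h' assume "h' \<in> Hom C (Src C f) (Src C m) \<and> m \<cdot> h' = f"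
  then have h': "h' \<in> Mor C" "Src C h' = Src C f" "Tgt C h' = Src C m" "m \<cdot> h' = f" by auto
  have "Src C f = Src C h" using assms mono_Mor[of m] by auto
  then show "h' = h" using assms h' by (auto intro: mono_cancel[OF assms(1) _ h'(1) assms(3)])
qed

lemma fac_simps [simp]:
  assumes "is_mono C m" "factors C m f"
  shows "fac C m f \<in> Mor C" "Src C (fac C m f) = Src C f" "Tgt C (fac C m f) = Src C m" "m \<cdot> fac C m f = f"
proof -
  obtain h where h: "h \<in> Hom C (Src C f) (Src C m)" "m \<cdot> h = f" using assms(2) unfolding factors_def by auto
  then have "fac C m f = h" using assms by (intro fac_eqI) auto
  with h show "fac C m f \<in> Mor C" "Src C (fac C m f) = Src C f" "Tgt C (fac C m f) = Src C m" "m \<cdot> fac C m f = f"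
    by auto
qed

lemma factorsI:
  assumes "m \<in> Mor C" "h \<in> Mor C" "Tgt C h = Src C m" "m \<cdot> h = f"
  shows "factors C m f"
  unfolding factors_def using assms by auto

section \<open>Kernels and zero objects\<close>

lemma ker_mono: "is_ker C f k \<Longrightarrow> is_mono C k"
proof (rule monoI)
  assume K: "is_ker C f k"
  then show "k \<in> Mor C" by (simp add: is_ker_def)
  fix u v assume H: "u \<in> Mor C" "v \<in> Mor C" "Src C u = Src C v" "Tgt C u = Src C k" "Tgt C v = Src C k"
    "k \<cdot> u = k \<cdot> v"
  have T: "f \<in> Mor C" "k \<in> Mor C" "Tgt C k = Src C f" "f \<cdot> k = Zero C (Src C k) (Tgt C f)"
    using K by (auto simp: is_ker_def)
  have "f \<cdot> (k \<cdot> u) = (f \<cdot> k) \<cdot> u" using H T by (subst assoc) auto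
  then have "f \<cdot> (k \<cdot> u) = Zero C (Src C u) (Tgt C f)" using H T by simp
  then have "\<exists>!w. w \<in> Hom C (Src C (k \<cdot> u)) (Src C k) \<and> k \<cdot> w = k \<cdot> u"
    using K H(1,2,4) T unfolding is_ker_def by (metis Cmp_simps)
  then show "u = v" using H T by auto
qed

lemma ker_simps:
  assumes "is_ker C f k"
  shows "f \<in> Mor C" "k \<in> Mor C" "Tgt C k = Src C f" "f \<cdot> k = Zero C (Src C k) (Tgt C f)"
  using assms by (auto simp: is_ker_def)

lemma ker_factors:
  assumes "is_ker C f k" "h \<in> Mor C" "Tgt C h = Src C f" "f \<cdot> h = Zero C (Src C h) (Tgt C f)"
  shows "factors C k h"
  using assms unfolding is_ker_def factors_def by (metis (no_types, lifting))

lemma kerI: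
  assumes "is_mono C k" "f \<in> Mor C" "Tgt C k = Src C f" "f \<cdot> k = Zero C (Src C k) (Tgt C f)"
    "\<And>h. \<lbrakk>h \<in> Mor C; Tgt C h = Src C f; f \<cdot> h = Zero C (Src C h) (Tgt C f)\<rbrakk> \<Longrightarrow> factors C k h"
  shows "is_ker C f k"
  unfolding is_ker_def
proof (intro conjI ballI impI)
  show "k \<in> Mor C" using assms(1) by (rule mono_Mor)
  fix h assume h: "h \<in> Mor C" "Tgt C h = Src C f \<and> f \<cdot> h = Zero C (Src C h) (Tgt C f)"
  with assms(5) have F: "factors C k h" by auto
  show "\<exists>!u. u \<in> Hom C (Src C h) (Src C k) \<and> k \<cdot> u = h"
    using F assms(1) h by (intro ex1I[of _ "fac C k h"]) (auto simp: fac_eqI)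
qed fact+

lemma zero_ob_Zero:
  assumes "is_zero_ob C Z" "f \<in> Mor C"
  shows "Src C f = Z \<Longrightarrow> f = Zero C Z (Tgt C f)" "Tgt C f = Z \<Longrightarrow> f = Zero C (Src C f) Z"
proof -
  have Z: "Z \<in> Ob C" using assms(1) by (simp add: is_zero_ob_def)
  { assume "Src C f = Z"
    moreover have "\<exists>!g. g \<in> Hom C Z (Tgt C f)" using assms by (simp add: is_zero_ob_def)
    moreover have "Zero C Z (Tgt C f) \<in> Hom C Z (Tgt C f)" using Z assms(2) by simp
    ultimately show "f = Zero C Z (Tgt C f)" using assms(2) by auto }
  { assume "Tgt C f = Z"
    moreover have "\<exists>!g. g \<in> Hom C (Src C f) Z" using assms by (simp add: is_zero_ob_def)
    moreover have "Zero C (Src C f) Z \<in> Hom C (Src C f) Z" using Z assms(2) by simp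
    ultimately show "f = Zero C (Src C f) Z" using assms(2) by auto }
qed

lemma zero_ob_Ob: "is_zero_ob C Z \<Longrightarrow> Z \<in> Ob C"
  by (simp add: is_zero_ob_def)

lemma zero_ob_Idn: "is_zero_ob C Z \<Longrightarrow> Idn C Z = Zero C Z Z"
  using zero_ob_Zero(1)[of Z "Idn C Z"] zero_ob_Ob by simp

lemma zero_obI:
  assumes "Z \<in> Ob C" "Idn C Z = Zero C Z Z"
  shows "is_zero_ob C Z"
proof -
  have 1: "f = Zero C X Z" if "f \<in> Hom C X Z" for f X
  proof -
    have "f = Idn C Z \<cdot> f" using that assms(1) by simp
    also have "\<dots> = Zero C X Z" unfolding assms(2) using that assms(1) by simp
    finally show ?thesis .
  qed
  have 2: "f = Zero C Z X" if "f \<in> Hom C Z X" for f X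
  proof -
    have "f = f \<cdot> Idn C Z" using that assms(1) by simp
    also have "\<dots> = Zero C Z X" unfolding assms(2) using that assms(1) by simp
    finally show ?thesis .
  qed
  have "\<exists>!f. f \<in> Hom C X Z" "\<exists>!f. f \<in> Hom C Z X" if "X \<in> Ob C" for X
    using that assms(1) 1[of _ X] 2[of _ X]
    by (intro ex1I[of _ "Zero C X Z"] ex1I[of _ "Zero C Z X"]; simp)+
  then show ?thesis unfolding is_zero_ob_def using assms(1) by blast
qed

lemma zero_ob_iso:
  assumes "is_zero_ob C (Src C f)" "is_zero_ob C (Tgt C f)" "f \<in> Mor C"
  shows "is_iso C f"
  using assms zero_ob_Idn zero_ob_Ob by (intro isoI[of "Zero C (Tgt C f) (Src C f)"]) auto

section \<open>Finite direct sums\<close>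

lemma dsum_simps:
  assumes "is_dsum C I X D \<iota> \<pi>"
  shows "finite I" "D \<in> Ob C" "\<And>i. i \<in> I \<Longrightarrow> X i \<in> Ob C"
    "\<And>i. i \<in> I \<Longrightarrow> \<iota> i \<in> Mor C" "\<And>i. i \<in> I \<Longrightarrow> Src C (\<iota> i) = X i" "\<And>i. i \<in> I \<Longrightarrow> Tgt C (\<iota> i) = D"
    "\<And>i. i \<in> I \<Longrightarrow> \<pi> i \<in> Mor C" "\<And>i. i \<in> I \<Longrightarrow> Src C (\<pi> i) = D" "\<And>i. i \<in> I \<Longrightarrow> Tgt C (\<pi> i) = X i"
    "\<And>i. i \<in> I \<Longrightarrow> \<pi> i \<cdot> \<iota> i = Idn C (X i)"
    "\<And>i j. \<lbrakk>i \<in> I; j \<in> I; i \<noteq> j\<rbrakk> \<Longrightarrow> \<pi> j \<cdot> \<iota> i = Zero C (X i) (X j)"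
    "hsum C D D (\<lambda>i. \<iota> i \<cdot> \<pi> i) I = Idn C D"
  using assms unfolding is_dsum_def by auto

text \<open>The identity is the sum of the \<iota> \<pi>, so an arrow is rebuilt from its
  components. With its dual below, this replaces the comparison of elements throughout.\<close>

lemma dsum_cancel:
  assumes D: "is_dsum C I X D \<iota> \<pi>" "\<And>i. i \<in> I \<Longrightarrow> \<pi> i \<cdot> f = \<pi> i \<cdot> g"
    "f \<in> Mor C" "g \<in> Mor C" "Src C f = Src C g" "Tgt C f = D" "Tgt C g = D"
  shows "f = g"
proof -
  note [simp] = dsum_simps[OF D(1)]
  have 1: "h = hsum C (Src C h) D (\<lambda>i. \<iota> i \<cdot> (\<pi> i \<cdot> h)) I" if "h \<in> Mor C" "Tgt C h = D" for h
  proof -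
    have "h = hsum C D D (\<lambda>i. \<iota> i \<cdot> \<pi> i) I \<cdot> h" using that by simp
    also have "\<dots> = hsum C (Src C h) D (\<lambda>i. (\<iota> i \<cdot> \<pi> i) \<cdot> h) I" using that by (subst Cmp_hsum(2)) auto
    also have "\<dots> = hsum C (Src C h) D (\<lambda>i. \<iota> i \<cdot> (\<pi> i \<cdot> h)) I" using that by (intro hsum_cong) auto
    finally show ?thesis .
  qed
  have "f = hsum C (Src C f) D (\<lambda>i. \<iota> i \<cdot> (\<pi> i \<cdot> f)) I" using assms by (intro 1)
  also have "\<dots> = hsum C (Src C g) D (\<lambda>i. \<iota> i \<cdot> (\<pi> i \<cdot> g)) I" using assms by (simp, intro hsum_cong) auto
  also have "\<dots> = g" using assms by (intro 1[symmetric])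
  finally show ?thesis .
qed

lemma dsum_cancel_op:
  assumes D: "is_dsum C I X D \<iota> \<pi>" "\<And>i. i \<in> I \<Longrightarrow> f \<cdot> \<iota> i = g \<cdot> \<iota> i"
    "f \<in> Mor C" "g \<in> Mor C" "Tgt C f = Tgt C g" "Src C f = D" "Src C g = D"
  shows "f = g"
proof -
  note [simp] = dsum_simps[OF D(1)]
  have 1: "h = hsum C D (Tgt C h) (\<lambda>i. (h \<cdot> \<iota> i) \<cdot> \<pi> i) I" if "h \<in> Mor C" "Src C h = D" for h
  proof -
    have "h = h \<cdot> hsum C D D (\<lambda>i. \<iota> i \<cdot> \<pi> i) I" using that by simp
    also have "\<dots> = hsum C D (Tgt C h) (\<lambda>i. h \<cdot> (\<iota> i \<cdot> \<pi> i)) I" using that by (subst Cmp_hsum(1)) auto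
    also have "\<dots> = hsum C D (Tgt C h) (\<lambda>i. (h \<cdot> \<iota> i) \<cdot> \<pi> i) I" using that by (intro hsum_cong) auto
    finally show ?thesis .
  qed
  have "f = hsum C D (Tgt C f) (\<lambda>i. (f \<cdot> \<iota> i) \<cdot> \<pi> i) I" using assms by (intro 1)
  also have "\<dots> = hsum C D (Tgt C g) (\<lambda>i. (g \<cdot> \<iota> i) \<cdot> \<pi> i) I" unfolding D(5) using assms by (intro hsum_cong) (auto simp del: assoc)
  also have "\<dots> = g" using assms by (intro 1[symmetric])
  finally show ?thesis .
qed

lemma dsum_copair:
  assumes D: "is_dsum C I X D \<iota> \<pi>" "Z \<in> Ob C" "\<And>i. i \<in> I \<Longrightarrow> f i \<in> Hom C (X i) Z"
  shows "hsum C D Z (\<lambda>i. f i \<cdot> \<pi> i) I \<in> Hom C D Z"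
    "\<And>j. j \<in> I \<Longrightarrow> hsum C D Z (\<lambda>i. f i \<cdot> \<pi> i) I \<cdot> \<iota> j = f j"
proof -
  note [simp] = dsum_simps[OF D(1)]
  show "hsum C D Z (\<lambda>i. f i \<cdot> \<pi> i) I \<in> Hom C D Z" using D(2,3) by simp
  fix j assume j: "j \<in> I"
  have "hsum C D Z (\<lambda>i. f i \<cdot> \<pi> i) I \<cdot> \<iota> j = hsum C (X j) Z (\<lambda>i. (f i \<cdot> \<pi> i) \<cdot> \<iota> j) I"
    using D(2,3) j by (subst Cmp_hsum(2)) auto
  also have "\<dots> = hsum C (X j) Z (\<lambda>i. f i \<cdot> (\<pi> i \<cdot> \<iota> j)) I" using D(2,3) j by (intro hsum_cong) auto
  also have "\<dots> = f j \<cdot> (\<pi> j \<cdot> \<iota> j)" using D(2,3) j by (intro hsum_single) auto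
  also have "\<dots> = f j" using D(2,3) j by simp
  finally show "hsum C D Z (\<lambda>i. f i \<cdot> \<pi> i) I \<cdot> \<iota> j = f j" .
qed

lemma dsum_pair:
  assumes D: "is_dsum C I X D \<iota> \<pi>" "Z \<in> Ob C" "\<And>i. i \<in> I \<Longrightarrow> f i \<in> Hom C Z (X i)"
  shows "hsum C Z D (\<lambda>i. \<iota> i \<cdot> f i) I \<in> Hom C Z D"
    "\<And>j. j \<in> I \<Longrightarrow> \<pi> j \<cdot> hsum C Z D (\<lambda>i. \<iota> i \<cdot> f i) I = f j"
proof -
  note [simp] = dsum_simps[OF D(1)]
  show "hsum C Z D (\<lambda>i. \<iota> i \<cdot> f i) I \<in> Hom C Z D" using D(2,3) by simp
  fix j assume j: "j \<in> I"
  have "\<pi> j \<cdot> hsum C Z D (\<lambda>i. \<iota> i \<cdot> f i) I = hsum C Z (X j) (\<lambda>i. \<pi> j \<cdot> (\<iota> i \<cdot> f i)) I"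
    using D(2,3) j by (subst Cmp_hsum(1)) auto
  also have "\<dots> = hsum C Z (X j) (\<lambda>i. (\<pi> j \<cdot> \<iota> i) \<cdot> f i) I" using D(2,3) j by (intro hsum_cong) auto
  also have "\<dots> = (\<pi> j \<cdot> \<iota> j) \<cdot> f j" using D(2,3) j by (intro hsum_single) auto
  also have "\<dots> = f j" using D(2,3) j by simp
  finally show "\<pi> j \<cdot> hsum C Z D (\<lambda>i. \<iota> i \<cdot> f i) I = f j" .
qed

text \<open>The condition on the sum of the \<iota> \<pi> is replaced by joint monicity of the
  projections: the identity minus that sum is killed by every projection, hence is zero. In the
  applications \<open>inj\<close> comes from cancellation, whereas the sum would have to be
  computed.\<close>

lemma dsumI:
  assumes "finite I" "D \<in> Ob C" "\<And>i. i \<in> I \<Longrightarrow> \<iota> i \<in> Hom C (X i) D" "\<And>i. i \<in> I \<Longrightarrow> \<pi> i \<in> Hom C D (X i)"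
    "\<And>i. i \<in> I \<Longrightarrow> \<pi> i \<cdot> \<iota> i = Idn C (X i)"
    "\<And>i j. \<lbrakk>i \<in> I; j \<in> I; i \<noteq> j\<rbrakk> \<Longrightarrow> \<pi> j \<cdot> \<iota> i = Zero C (X i) (X j)"
    and inj: "\<And>t. \<lbrakk>t \<in> Mor C; Tgt C t = D; \<And>i. i \<in> I \<Longrightarrow> \<pi> i \<cdot> t = Zero C (Src C t) (X i)\<rbrakk> \<Longrightarrow> t = Zero C (Src C t) D"
  shows "is_dsum C I X D \<iota> \<pi>"
proof -
  have X: "X i \<in> Ob C" if "i \<in> I" for i using assms(3)[OF that] Ob_simps(1)[of "\<iota> i"] by auto
  define s where "s = hsum C D D (\<lambda>i. \<iota> i \<cdot> \<pi> i) I"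
  have s: "s \<in> Hom C D D" unfolding s_def using assms(2-4) by (intro hsum_Hom) auto
  have ps: "\<pi> j \<cdot> s = \<pi> j" if j: "j \<in> I" for j
  proof -
    have "\<pi> j \<cdot> s = hsum C D (X j) (\<lambda>i. \<pi> j \<cdot> (\<iota> i \<cdot> \<pi> i)) I"
      unfolding s_def using assms(1-4) X j by (subst Cmp_hsum(1)) auto
    also have "\<dots> = hsum C D (X j) (\<lambda>i. (\<pi> j \<cdot> \<iota> i) \<cdot> \<pi> i) I" using assms(2-4) X j by (intro hsum_cong) auto
    also have "\<dots> = (\<pi> j \<cdot> \<iota> j) \<cdot> \<pi> j" using assms(1-4,6) X j by (intro hsum_single) auto
    also have "\<dots> = \<pi> j" using assms(2-5) j by simp
    finally show ?thesis .
  qed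
  define t where "t = Add C (Idn C D) (Scal C (-1) s)"
  have t: "t \<in> Hom C D D" unfolding t_def using s assms(2) by simp
  have "t = Zero C (Src C t) D"
  proof (rule inj)
    fix i assume i: "i \<in> I"
    have "\<pi> i \<cdot> t = Zero C D (X i)"
      unfolding t_def using i s assms(2,4) ps[OF i] by (simp add: Cmp_Add Add_cancel)
    then show "\<pi> i \<cdot> t = Zero C (Src C t) (X i)" using t by simp
  qed (use t in auto)
  then have "Idn C D = s" unfolding t_def using s assms(2) by (intro Sub_eq_Zero[of "Idn C D" s]) auto
  then show ?thesis unfolding is_dsum_def s_def using assms(1-6) X by auto
qed

end

context linear_abelian
begin

text \<open>The axioms supply a zero object and binary sums only; the finite case is reached by
  adding one summand at a time.\<close>

lemma finite_dsum_exists: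
  assumes "finite I" "\<And>i. i \<in> I \<Longrightarrow> X i \<in> Ob C"
  shows "\<exists>D \<iota> \<pi>. is_dsum C I X D \<iota> \<pi>"
  using assms
proof (induction I rule: finite_induct)
  case empty
  obtain Z where Z: "is_zero_ob C Z" using ex_zero_ob by blast
  \<comment> \<open>Over the empty index set nothing constrains injections and projections, so any
    functions serve.\<close>
  then have "is_dsum C {} X Z undefined undefined"
    unfolding is_dsum_def using zero_ob_Ob zero_ob_Idn by simp
  then show ?case by blast
next
  case (insert k I)
  then obtain D' \<iota>' \<pi>' where D': "is_dsum C I X D' \<iota>' \<pi>'" by auto
  obtain D \<iota> \<pi> where D: "is_dsum C {0::nat, 1} (\<lambda>i. if i = 0 then X k else D') D \<iota> \<pi>"
    using ex_dsum[of "X k" D'] insert.prems dsum_simps(2)[OF D'] by auto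
  note [simp] = dsum_simps[OF D'] dsum_simps(2)[OF D]
    dsum_simps(3-10)[OF D, of 0, simplified] dsum_simps(3-10)[OF D, of 1, simplified]
    dsum_simps(11)[OF D, of 0 1, simplified] dsum_simps(11)[OF D, of 1 0, simplified]
  have [simp]: "\<pi> 0 \<cdot> (\<iota> (Suc 0) \<cdot> f) = Zero C (Src C f) (X k)" if "f \<in> Mor C" "Tgt C f = D'" for f
    using that by (simp flip: assoc)
  have [simp]: "\<pi> (Suc 0) \<cdot> (\<iota> (Suc 0) \<cdot> f) = f" if "f \<in> Mor C" "Tgt C f = D'" for f
    using that by (simp flip: assoc)
  have "is_dsum C (insert k I) X D (\<lambda>i. if i = k then \<iota> 0 else \<iota> 1 \<cdot> \<iota>' i) (\<lambda>i. if i = k then \<pi> 0 else \<pi>' i \<cdot> \<pi> 1)"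
  proof (rule dsumI)
    fix t assume t: "t \<in> Mor C" "Tgt C t = D"
      "\<And>i. i \<in> insert k I \<Longrightarrow> (if i = k then \<pi> 0 else \<pi>' i \<cdot> \<pi> 1) \<cdot> t = Zero C (Src C t) (X i)"
    have "\<pi> 1 \<cdot> t = Zero C (Src C t) D'"
    proof (rule dsum_cancel[OF D'])
      fix i assume "i \<in> I"
      then show "\<pi>' i \<cdot> (\<pi> 1 \<cdot> t) = \<pi>' i \<cdot> Zero C (Src C t) D'"
        using t(3)[of i] insert.hyps t(1,2) by (auto split: if_splits)
    qed (use t(1,2) in auto)
    moreover have "\<pi> 0 \<cdot> t = Zero C (Src C t) (X k)" using t(3)[of k] by simp
    ultimately show "t = Zero C (Src C t) D" using t(1,2)
      by (auto intro!: dsum_cancel[OF D _ t(1)])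
  qed (use insert.hyps insert.prems in auto)
  then show ?case by blast
qed

text \<open>The monomorphism is a kernel of some \<open>f\<close>, and \<open>f\<close> factors
  through the cokernel \<open>c\<close>. Whatever \<open>c\<close> kills is therefore killed by
  \<open>f\<close> and factors through \<open>m\<close>.\<close>

lemma mono_ker_coker:
  assumes "is_mono C m" "is_coker C m c"
  shows "is_ker C c m"
proof -
  obtain f where f: "is_ker C f m" using mono_ker[OF assms(1)] by blast
  note [simp] = ker_simps[OF f]
  have c: "c \<in> Mor C" "Src C c = Tgt C m" "c \<cdot> m = Zero C (Src C m) (Tgt C c)"
    using assms(2) by (auto simp: is_coker_def)
  obtain u where u: "u \<in> Hom C (Tgt C c) (Tgt C f)" "u \<cdot> c = f"
    using assms(2) ker_simps[OF f] unfolding is_coker_def by metis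
  show ?thesis
  proof (rule kerI)
    fix h assume h: "h \<in> Mor C" "Tgt C h = Src C c" "c \<cdot> h = Zero C (Src C h) (Tgt C c)"
    have "f \<cdot> h = u \<cdot> (c \<cdot> h)" unfolding u(2)[symmetric] using u(1) h c by simp
    then have "f \<cdot> h = Zero C (Src C h) (Tgt C f)" using h u c by simp
    then show "factors C m h" using h c by (intro ker_factors[OF f]) auto
  qed (use c assms(1) in auto)
qed

lemma coker_is_coker: "f \<in> Mor C \<Longrightarrow> is_coker C f (coker C f)"
  unfolding coker_def by (rule someI_ex) (rule ex_coker)

end

section \<open>The Lefschetz decomposition and the \<open>sl\<^sub>2\<close> argument\<close>

text \<open>\<open>E\<close> raises and \<open>F\<close> lowers weights; in place of finite
  dimension the weights are bounded below by \<open>- B\<close>. One \<open>z\<close> is the zero of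
  all weights, which suits the intended elements: matrices indexed by all pairs of degrees, among
  which there is a single zero matrix.\<close>

locale sl2_module =
  fixes M :: "int \<Rightarrow> 'b set" and add :: "'b \<Rightarrow> 'b \<Rightarrow> 'b" and scal :: "rat \<Rightarrow> 'b \<Rightarrow> 'b" and z :: 'b
    and E F :: "'b \<Rightarrow> 'b" and B :: int
  assumes z_M: "z \<in> M w"
    and scal_M: "u \<in> M w \<Longrightarrow> scal a u \<in> M w"
    and E_M: "u \<in> M w \<Longrightarrow> E u \<in> M (w + 2)"
    and F_M: "u \<in> M w \<Longrightarrow> F u \<in> M (w - 2)"
    and M_bounded: "\<lbrakk>u \<in> M w; w < - B\<rbrakk> \<Longrightarrow> u = z"
    and add_assoc: "\<lbrakk>u \<in> M w; v \<in> M w; x \<in> M w\<rbrakk> \<Longrightarrow> add (add u v) x = add u (add v x)"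
    and add_z: "u \<in> M w \<Longrightarrow> add z u = u"
    and scal_add: "u \<in> M w \<Longrightarrow> add (scal a u) (scal b u) = scal (a + b) u"
    and scal_eq_z: "\<lbrakk>u \<in> M w; scal a u = z; a \<noteq> 0\<rbrakk> \<Longrightarrow> u = z"
    and scal_z: "scal a z = z"
    and E_z: "E z = z" and F_z: "F z = z"
    and E_add: "\<lbrakk>u \<in> M w; v \<in> M w\<rbrakk> \<Longrightarrow> E (add u v) = add (E u) (E v)"
    and E_scal: "u \<in> M w \<Longrightarrow> E (scal a u) = scal a (E u)"
    and E_F: "u \<in> M w \<Longrightarrow> E (F u) = add (F (E u)) (scal (of_int w) u)"
begin

lemma E_pow_M: "u \<in> M w \<Longrightarrow> (E ^^ n) u \<in> M (w + 2 * int n)"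
proof (induction n)
  case (Suc n)
  then show ?case using E_M[of "(E ^^ n) u" "w + 2 * int n"] by (simp add: algebra_simps)
qed simp

lemma E_pow_z: "(E ^^ n) z = z"
  by (induction n) (simp_all add: E_z)

text \<open>Moving \<open>F\<close> past n + 1 factors \<open>E\<close> collects the weights w, w +
  2, ..., w + 2n of the successive E^i u, whose sum is (n + 1)(w + n).\<close>

lemma E_pow_F:
  assumes u: "u \<in> M w"
  shows "(E ^^ Suc n) (F u) = add (F ((E ^^ Suc n) u)) (scal (of_nat (Suc n) * (of_int w + of_nat n)) ((E ^^ n) u))"
proof (induction n)
  case 0
  then show ?case using E_F[OF u] by simp
next
  case (Suc n)
  let ?v = "(E ^^ Suc n) u" and ?w = "w + 2 * int (Suc n)" and ?c = "of_nat (Suc n) * (of_int w + of_nat n) :: rat"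
  have v: "?v \<in> M ?w" by (rule E_pow_M[OF u])
  have v': "(E ^^ n) u \<in> M (w + 2 * int n)" by (rule E_pow_M[OF u])
  have FE: "F (E ?v) \<in> M ?w" using F_M[OF E_M[OF v]] by (simp add: algebra_simps)
  have "(E ^^ Suc (Suc n)) (F u) = E (add (F ?v) (scal ?c ((E ^^ n) u)))"
    using Suc.IH by simp
  also have "\<dots> = add (E (F ?v)) (scal ?c ?v)"
    using E_add[of "F ?v" "w + 2 * int n"] F_M[OF v] scal_M[OF v'] E_scal[OF v'] by simp
  also have "\<dots> = add (add (F (E ?v)) (scal (of_int ?w) ?v)) (scal ?c ?v)"
    using E_F[OF v] by simp
  also have "\<dots> = add (F (E ?v)) (scal (of_int ?w + ?c) ?v)"
    using add_assoc[OF FE scal_M[OF v] scal_M[OF v]] scal_add[OF v] by simp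
  also have "of_int ?w + ?c = of_nat (Suc (Suc n)) * (of_int w + of_nat (Suc n))"
    by (simp add: algebra_simps)
  finally show ?case by simp
qed

text \<open>If E^(n+1) u = 0, the commutation formula makes E^(n+1) F u a multiple of E^n u, so
  E^(n+2) kills F u, whose weight is lower by 2. Repeated descent leaves the range of weights, so F
  u = 0; then E^n u = 0, because the factor (n + 1)(w + n) is nonzero for w < -n. Hence the outer
  induction on the distance to the lower bound and the inner one on n.\<close>

lemma E_pow_inj:
  assumes "u \<in> M w" "w \<le> - int n" "(E ^^ n) u = z"
  shows "u = z"
proof -
  have "\<lbrakk>u \<in> M w; w \<le> - int n; (E ^^ n) u = z; w < - B + int m\<rbrakk> \<Longrightarrow> u = z" for m
  proof (induction m arbitrary: u w n)
    case 0
    then show ?case using M_bounded[of u w] by simp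
  next
    case (Suc m)
    note outer = Suc.IH
    show ?case using Suc.prems
    proof (induction n)
      case (Suc n)
      let ?c = "of_nat (Suc n) * (of_int w + of_nat n) :: rat"
      note u = Suc.prems(1)
      have *: "(E ^^ Suc n) (F u) = scal ?c ((E ^^ n) u)"
        using E_pow_F[OF u, of n] Suc.prems(3) F_z add_z[OF scal_M[OF E_pow_M[OF u, of n], of ?c]] by simp
      have "(E ^^ Suc (Suc n)) (F u) = E (scal ?c ((E ^^ n) u))" using * by simp
      also have "\<dots> = z" using E_scal[OF E_pow_M[OF u]] Suc.prems(3) scal_z by simp
      finally have "F u = z" using Suc.prems by (intro outer[OF F_M[OF u], of "Suc (Suc n)"]) auto
      then have "scal ?c ((E ^^ n) u) = z"
        using * E_pow_z[of "Suc n"] by simp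
      moreover have "?c \<noteq> 0"
      proof -
        have "w + int n \<noteq> 0" using Suc.prems(2) by auto
        then have "of_int (w + int n) \<noteq> (0 :: rat)" by (simp only: of_int_eq_0_iff not_False_eq_True)
        moreover have "of_int (w + int n) = (of_int w + of_nat n :: rat)" by simp
        ultimately have "of_int w + of_nat n \<noteq> (0 :: rat)" by metis
        then show ?thesis by (simp only: mult_eq_0_iff of_nat_eq_0_iff) simp
      qed
      ultimately have "(E ^^ n) u = z" using scal_eq_z[OF E_pow_M[OF u]] by blast
      then show ?case using Suc.IH Suc.prems by auto
    qed simp
  qed
  from this[OF assms, of "nat (w + B + 1)"] show ?thesis by simp
qed

end

text \<open>\<open>R p q\<close> models the power E^((q - p)/2), and \<open>k i\<close> the
  inclusion of the primitive part P_{-i}. \<open>R\<close> is total, but composition is governed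
  only for increasing degrees of equal parity; for q < p or odd q - p its values are arbitrary
  arrows.\<close>

locale lefschetz = linear_category C for C :: "('o, 'a, 'm) lincat_scheme" (structure) +
  fixes X :: "int \<Rightarrow> 'o" and R :: "int \<Rightarrow> int \<Rightarrow> 'a" and r :: nat and k :: "nat \<Rightarrow> 'a"
  assumes X_Ob [simp]: "X p \<in> Ob C"
    and R_Hom: "R p q \<in> Hom C (X p) (X q)"
    and R_refl [simp]: "R p p = Idn C (X p)"
    and R_comp: "\<lbrakk>p \<le> q; q \<le> s; even (q - p); even (s - q)\<rbrakk> \<Longrightarrow> R q s \<cdot> R p q = R p s"
    and X_zero: "\<bar>p\<bar> > int r \<Longrightarrow> is_zero_ob C (X p)"
    and R_iso [simp]: "is_iso C (R (- int i) (int i))"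
    and k_ker: "is_ker C (R (- int i) (int i + 2)) (k i)"
begin

lemma R_simps [simp]: "R p q \<in> Mor C" "Src C (R p q) = X p" "Tgt C (R p q) = X q"
  using R_Hom[of p q] by auto

lemma R_comp' [simp]:
  assumes "f \<in> Mor C" "Tgt C f = X p" "p \<le> q" "q \<le> s" "even (q - p)" "even (s - q)"
  shows "R q s \<cdot> (R p q \<cdot> f) = R p s \<cdot> f"
  using assms by (subst Cmp_reassoc[OF R_comp]) auto

lemma k_simps [simp]: "k i \<in> Mor C" "Tgt C (k i) = X (- int i)"
    "R (- int i) (int i + 2) \<cdot> k i = Zero C (Src C (k i)) (X (int i + 2))"
  using ker_simps[OF k_ker[of i]] by auto

definition a :: "nat \<Rightarrow> int \<Rightarrow> 'a" where "a i q = R (- int i) q \<cdot> k i"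

text \<open>A retraction of E from X_{-i-2} to X_{-i}: it goes up to degree i + 2 and returns along
  the Lefschetz isomorphism that starts in degree -i-2.\<close>

definition sect :: "nat \<Rightarrow> 'a" where
  "sect i = cinv C (R (- int (i + 2)) (int (i + 2))) \<cdot> R (- int i) (int i + 2)"

text \<open>The projection onto the primitive part along the image of E: the arrow 1 - E
  \<open>sect\<close> lands in the kernel of E^(i+1), hence factors through
  \<open>k i\<close>.\<close>

definition rho :: "nat \<Rightarrow> 'a" where
  "rho i = fac C (k i) (Add C (Idn C (X (- int i))) (Scal C (-1) (R (- int (i + 2)) (- int i) \<cdot> sect i)))"

text \<open>The projection of X_q onto its copy of P_{-i}, for q between -i and i and of the parity
  of i: powers of E lead to degree i, the inverse Lefschetz isomorphism to degree -i, and
  \<open>rho\<close> extracts the primitive part.\<close>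

definition b :: "nat \<Rightarrow> int \<Rightarrow> 'a" where
  "b i q = rho i \<cdot> (cinv C (R (- int i) (int i)) \<cdot> R q (int i))"

lemma sect_simps [simp]: "sect i \<in> Mor C" "Src C (sect i) = X (- int i)" "Tgt C (sect i) = X (- int (i + 2))"
  using R_iso[of "i + 2"] by (simp_all add: sect_def add.commute)

lemma R_sect: "R (- int (i + 2)) (int i + 2) \<cdot> sect i = R (- int i) (int i + 2)"
  unfolding sect_def using R_iso[of "i + 2"] by (simp add: add.commute)

lemma sect_R: "sect i \<cdot> R (- int (i + 2)) (- int i) = Idn C (X (- int (i + 2)))"
proof -
  have "R (- int i) (int i + 2) \<cdot> R (- int (i + 2)) (- int i) = R (- int (i + 2)) (int (i + 2))"
    using R_comp[of "- int (i + 2)" "- int i" "int i + 2"] by (simp add: add.commute)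
  then show ?thesis unfolding sect_def using R_iso[of "i + 2"] by (simp add: add.commute)
qed

lemma sect_k: "sect i \<cdot> k i = Zero C (Src C (k i)) (X (- int (i + 2)))"
  unfolding sect_def using R_iso[of "i + 2"] by (simp add: add.commute)

lemma k_mono: "is_mono C (k i)"
  by (rule ker_mono[OF k_ker])

lemma rho_factors:
  "factors C (k i) (Add C (Idn C (X (- int i))) (Scal C (-1) (R (- int (i + 2)) (- int i) \<cdot> sect i)))"
proof (rule ker_factors[OF k_ker])
  have "R (- int i) (int i + 2) \<cdot> (R (- int (i + 2)) (- int i) \<cdot> sect i) = R (- int i) (int i + 2)"
    using R_sect[of i] by (subst R_comp') auto
  then show "R (- int i) (int i + 2) \<cdot> Add C (Idn C (X (- int i))) (Scal C (-1) (R (- int (i + 2)) (- int i) \<cdot> sect i))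
    = Zero C (Src C (Add C (Idn C (X (- int i))) (Scal C (-1) (R (- int (i + 2)) (- int i) \<cdot> sect i)))) (Tgt C (R (- int i) (int i + 2)))"
    by (simp add: Cmp_Add Add_cancel)
qed auto

lemma rho_simps [simp]: "rho i \<in> Mor C" "Src C (rho i) = X (- int i)" "Tgt C (rho i) = Src C (k i)"
    "k i \<cdot> rho i = Add C (Idn C (X (- int i))) (Scal C (-1) (R (- int (i + 2)) (- int i) \<cdot> sect i))"
  using fac_simps[OF k_mono rho_factors, of i] by (simp_all add: rho_def)

lemma k_rho_Cmp:
  assumes "t \<in> Mor C" "Tgt C t = X (- int i)"
  shows "k i \<cdot> (rho i \<cdot> t) = Add C t (Scal C (-1) (R (- int (i + 2)) (- int i) \<cdot> (sect i \<cdot> t)))"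
  using assms by (subst Cmp_reassoc[OF rho_simps(4)]) (simp_all add: Cmp_Add)

lemma rho_k: "rho i \<cdot> k i = Idn C (Src C (k i))"
  by (rule mono_cancel[OF k_mono]) (simp_all add: k_rho_Cmp sect_k)

lemma rho_R: "rho i \<cdot> R (- int (i + 2)) (- int i) = Zero C (X (- int (i + 2))) (Src C (k i))"
  by (rule mono_cancel[OF k_mono]) (use sect_R[of i] in \<open>simp_all add: k_rho_Cmp Add_cancel\<close>)

lemma ab_simps [simp]: "a i q \<in> Mor C" "Src C (a i q) = Src C (k i)" "Tgt C (a i q) = X q"
    "b i q \<in> Mor C" "Src C (b i q) = X q" "Tgt C (b i q) = Src C (k i)"
  by (simp_all add: a_def b_def)

lemma R_a: "\<lbrakk>- int i \<le> p; p \<le> q; even (p + int i); even (q - p)\<rbrakk> \<Longrightarrow> R p q \<cdot> a i p = a i q"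
  by (simp add: a_def)

lemma b_R: "\<lbrakk>p \<le> q; q \<le> int i; even (int i - q); even (q - p)\<rbrakk> \<Longrightarrow> b i q \<cdot> R p q = b i p"
  using R_comp[of p q "int i"] by (simp add: b_def)

lemma a_zero: "\<lbrakk>int i < q; even (q - int i)\<rbrakk> \<Longrightarrow> a i q = Zero C (Src C (k i)) (X q)"
proof -
  assume H: "int i < q" "even (q - int i)"
  then have q: "int i + 2 \<le> q" by presburger
  have "R (- int i) q \<cdot> k i = R (int i + 2) q \<cdot> (R (- int i) (int i + 2) \<cdot> k i)"
    using H q by (subst R_comp') auto
  then show ?thesis by (simp add: a_def)
qed

lemma b_neg: "b i (- int i) = rho i"
  unfolding b_def by simp

lemma rho_R_lower:
  assumes "p < - int i" "even (p + int i)"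
  shows "rho i \<cdot> R p (- int i) = Zero C (X p) (Src C (k i))"
proof -
  have p: "p \<le> - int (i + 2)" using assms by presburger
  have "rho i \<cdot> R p (- int i) = rho i \<cdot> (R (- int (i + 2)) (- int i) \<cdot> R p (- int (i + 2)))"
    using assms p R_comp[of p "- int (i + 2)" "- int i"] by simp
  also have "\<dots> = Zero C (X p) (Src C (k i))"
    by (subst Cmp_reassoc[OF rho_R]) simp_all
  finally show ?thesis .
qed

lemma b_a_same:
  assumes "\<bar>q\<bar> \<le> int i" "even (q - int i)"
  shows "b i q \<cdot> a i q = Idn C (Src C (k i))"
proof -
  have "R q (int i) \<cdot> (R (- int i) q \<cdot> k i) = R (- int i) (int i) \<cdot> k i"
    using assms by (subst R_comp') auto
  then show ?thesis using R_iso[of i] by (simp add: a_def b_def rho_k)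
qed

text \<open>There are two different reasons. For i < j the way up to degree j passes beyond degree
  i, where P_{-i} is killed. For i > j the copy of P_{-i} in degree -j lies in the image of E, which
  \<open>rho j\<close> annihilates.\<close>

lemma b_a_other:
  assumes "\<bar>q\<bar> \<le> int i" "even (q - int i)" "\<bar>q\<bar> \<le> int j" "even (q - int j)" "i \<noteq> j"
  shows "b j q \<cdot> a i q = Zero C (Src C (k i)) (Src C (k j))"
proof -
  have 1: "R q (int j) \<cdot> (R (- int i) q \<cdot> k i) = R (- int i) (int j) \<cdot> k i"
    using assms by (subst R_comp') auto
  show ?thesis
  proof (cases "i < j")
    case True
    have "a i (int j) = Zero C (Src C (k i)) (X (int j))" using True assms by (intro a_zero) auto
    then show ?thesis unfolding a_def[of i q] b_def using R_iso[of j] 1 by (simp add: a_def)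
  next
    case False
    then have "- int i < - int j" using assms by auto
    then have "R (- int i) (int j) = R (- int j) (int j) \<cdot> R (- int i) (- int j)"
      using assms by (intro R_comp[symmetric]) auto
    then have "b j q \<cdot> a i q = rho j \<cdot> (R (- int i) (- int j) \<cdot> k i)"
      unfolding a_def b_def using 1 R_iso[of j] by simp
    also have "\<dots> = Zero C (Src C (k i)) (Src C (k j))"
      using rho_R_lower[of "- int i" j] \<open>- int i < - int j\<close> assms
      by (subst Cmp_reassoc[OF rho_R_lower]) auto
    finally show ?thesis .
  qed
qed

text \<open>Vanishing under \<open>rho i\<close> means t = E (\<open>sect\<close> t), and
  \<open>sect\<close> t satisfies the same hypotheses two degrees lower. The descent ends below
  degree -r, where the objects are zero.\<close>

lemma b_joint_mono_neg:
  assumes "t \<in> Mor C" "Tgt C t = X (- int i)"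
    and "\<And>j. \<lbrakk>i \<le> j; even (j - i)\<rbrakk> \<Longrightarrow> b j (- int i) \<cdot> t = Zero C (Src C t) (Src C (k j))"
  shows "t = Zero C (Src C t) (X (- int i))"
  using assms
proof (induction "Suc r - i" arbitrary: i t rule: less_induct)
  case less
  show ?case
  proof (cases "i > r")
    case True
    then show ?thesis using less.prems by (intro zero_ob_Zero(2) X_zero) auto
  next
    case False
    have "rho i \<cdot> t = Zero C (Src C t) (Src C (k i))" using less.prems(3)[of i] by (simp add: b_neg)
    then have "Add C t (Scal C (-1) (R (- int (i + 2)) (- int i) \<cdot> (sect i \<cdot> t))) = Zero C (Src C t) (Tgt C t)"
      using k_rho_Cmp[OF less.prems(1,2)] less.prems(1,2) by simp
    then have t: "t = R (- int (i + 2)) (- int i) \<cdot> (sect i \<cdot> t)"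
      using less.prems(1,2) by (intro Sub_eq_Zero[of t]) auto
    have "sect i \<cdot> t = Zero C (Src C (sect i \<cdot> t)) (X (- int (i + 2)))"
    proof (rule less.hyps)
      fix j assume j: "i + 2 \<le> j" "even (j - (i + 2))"
      have "b j (- int (i + 2)) \<cdot> (sect i \<cdot> t) = (b j (- int i) \<cdot> R (- int (i + 2)) (- int i)) \<cdot> (sect i \<cdot> t)"
        using j by (subst b_R) auto
      also have "\<dots> = b j (- int i) \<cdot> t"
        using less.prems(1,2) t by (subst assoc) auto
      also have "\<dots> = Zero C (Src C t) (Src C (k j))" using j by (intro less.prems(3)) auto
      finally show "b j (- int (i + 2)) \<cdot> (sect i \<cdot> t) = Zero C (Src C (sect i \<cdot> t)) (Src C (k j))"
        using less.prems(1,2) by simp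
    qed (use False less.prems in auto)
    then show ?thesis using less.prems(1,2) by (subst t) simp
  qed
qed

lemma b_joint_mono:
  assumes "t \<in> Mor C" "Tgt C t = X q"
    and "\<And>i. \<lbrakk>\<bar>q\<bar> \<le> int i; even (q - int i)\<rbrakk> \<Longrightarrow> b i q \<cdot> t = Zero C (Src C t) (Src C (k i))"
  shows "t = Zero C (Src C t) (X q)"
proof (cases "q \<le> 0")
  case True
  then obtain i where i: "q = - int i" by (metis nonpos_int_cases)
  show ?thesis unfolding i
  proof (rule b_joint_mono_neg)
    fix j assume "i \<le> j" "even (j - i)"
    then show "b j (- int i) \<cdot> t = Zero C (Src C t) (Src C (k j))"
      using assms(3)[of j] by (auto simp: i)
  qed (use assms i in auto)
next
  case False
  then obtain i where i: "q = int i" by (metis linorder_not_le zero_le_imp_eq_int order_less_imp_le)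
  \<comment> \<open>Positive degrees are moved to negative ones along the Lefschetz isomorphism,
    which is compatible with the projections by \<open>b_R\<close>.\<close>
  let ?u = "cinv C (R (- int i) (int i)) \<cdot> t"
  have u: "?u \<in> Mor C" "Src C ?u = Src C t" "Tgt C ?u = X (- int i)" "R (- int i) (int i) \<cdot> ?u = t"
    using assms i R_iso[of i] by auto
  have "?u = Zero C (Src C ?u) (X (- int i))"
  proof (rule b_joint_mono_neg)
    fix j assume j: "i \<le> j" "even (j - i)"
    have "b j (- int i) \<cdot> ?u = (b j (int i) \<cdot> R (- int i) (int i)) \<cdot> ?u"
      using j by (subst b_R) auto
    also have "\<dots> = b j (int i) \<cdot> t" using u by (subst assoc) auto
    also have "\<dots> = Zero C (Src C t) (Src C (k j))" using assms(3)[of j] j by (auto simp: i)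
    finally show "b j (- int i) \<cdot> ?u = Zero C (Src C ?u) (Src C (k j))" using u by simp
  qed (use u in auto)
  then have "R (- int i) (int i) \<cdot> ?u = R (- int i) (int i) \<cdot> Zero C (Src C t) (X (- int i))" using u by simp
  then show ?thesis using u assms i by simp
qed

definition idx :: "int \<Rightarrow> nat set" where "idx q = {i. i \<le> r \<and> \<bar>q\<bar> \<le> int i \<and> even (q - int i)}"

lemma prim_zero: "r < i \<Longrightarrow> is_zero_ob C (Src C (k i))"
proof -
  assume i: "r < i"
  have "k i = Zero C (Src C (k i)) (X (- int i))"
    using zero_ob_Zero(2)[OF X_zero, of "- int i" "k i"] i by simp
  then have "k i \<cdot> Idn C (Src C (k i)) = k i \<cdot> Zero C (Src C (k i)) (Src C (k i))"
    by (metis Cmp_Idn(1) Cmp_Zero(1) Ob_simps(1) k_simps(1,2))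
  then have "Idn C (Src C (k i)) = Zero C (Src C (k i)) (Src C (k i))"
    by (rule mono_cancel[OF k_mono]) auto
  then show ?thesis by (intro zero_obI) auto
qed

lemma lefschetz_dsum: "is_dsum C (idx q) (\<lambda>i. Src C (k i)) (X q) (\<lambda>i. a i q) (\<lambda>i. b i q)"
proof (rule dsumI)
  show "finite (idx q)" by (rule finite_subset[of _ "{..r}"]) (auto simp: idx_def)
  fix t assume t: "t \<in> Mor C" "Tgt C t = X q" "\<And>i. i \<in> idx q \<Longrightarrow> b i q \<cdot> t = Zero C (Src C t) (Src C (k i))"
  show "t = Zero C (Src C t) (X q)"
  proof (rule b_joint_mono)
    fix i assume "\<bar>q\<bar> \<le> int i" "even (q - int i)"
    then show "b i q \<cdot> t = Zero C (Src C t) (Src C (k i))"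
      using t(3)[of i] t(1,2) zero_ob_Zero(2)[OF prim_zero[of i], of "b i q \<cdot> t"] by (cases "i \<le> r") (auto simp: idx_def)
  qed (use t in auto)
qed (auto simp: idx_def b_a_same b_a_other)

text \<open>On the copy of P_{-i} in degree q = -i + 2j the coefficient is j (i - j + 1), as in the
  irreducible sl2-module of dimension i + 1. It is chosen so that the coefficient for q minus the
  one for q + 2 equals q.\<close>

definition F :: "int \<Rightarrow> 'a" where
  "F q = hsum C (X q) (X (q - 2))
    (\<lambda>i. Scal C (of_int ((int i + q) * (int i - q + 2)) / 4) (a i (q - 2)) \<cdot> b i q) (idx q)"

lemma F_simps [simp]: "F q \<in> Mor C" "Src C (F q) = X q" "Tgt C (F q) = X (q - 2)"
  using dsum_copair(1)[OF lefschetz_dsum[of q], of "X (q - 2)"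
    "\<lambda>i. Scal C (of_int ((int i + q) * (int i - q + 2)) / 4) (a i (q - 2))"] by (auto simp: F_def)

lemma F_a:
  "i \<in> idx q \<Longrightarrow> F q \<cdot> a i q = Scal C (of_int ((int i + q) * (int i - q + 2)) / 4) (a i (q - 2))"
  unfolding F_def by (rule dsum_copair(2)[OF lefschetz_dsum[of q]]) auto

lemma E_F_commutator:
  "R (q - 2) q \<cdot> F q = Add C (F (q + 2) \<cdot> R q (q + 2)) (Scal C (of_int q) (Idn C (X q)))"
proof (rule dsum_cancel_op[OF lefschetz_dsum[of q]])
  fix i assume i: "i \<in> idx q"
  let ?c = "\<lambda>q. of_int ((int i + q) * (int i - q + 2)) / 4 :: rat"
  have bounds: "\<bar>q\<bar> \<le> int i" "even (q - int i)" "i \<le> r" using i by (auto simp: idx_def)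
  have 1: "R (q - 2) q \<cdot> (F q \<cdot> a i q) = Scal C (?c q) (a i q)"
  \<comment> \<open>At the bottom of the string there is no copy in degree q - 2 through which to
    return; there the coefficient is 0.\<close>
  proof (cases "q = - int i")
    case True
    then show ?thesis using F_a[OF i] by simp
  next
    case False
    then have "R (q - 2) q \<cdot> a i (q - 2) = a i q" using bounds by (intro R_a) presburger+
    then show ?thesis using F_a[OF i] by simp
  qed
  have 2: "F (q + 2) \<cdot> (R q (q + 2) \<cdot> a i q) = Scal C (?c (q + 2)) (a i q)"
  \<comment> \<open>At the top both sides vanish: E kills the copy, and the coefficient for q + 2
    contains the factor i - q.\<close>
  proof (cases "q = int i")
    case True
    then show ?thesis using bounds R_a[of i q "q + 2"] a_zero[of i "q + 2"] by simp
  next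
    case False
    then have "i \<in> idx (q + 2)" using bounds unfolding idx_def by (auto, presburger+)
    then show ?thesis using bounds R_a[of i q "q + 2"] F_a[of i "q + 2"] by simp
  qed
  have "(R (q - 2) q \<cdot> F q) \<cdot> a i q = Scal C (?c q) (a i q)" using 1 by simp
  also have "?c q = ?c (q + 2) + of_int q" by (simp add: field_simps)
  also have "Scal C (?c (q + 2) + of_int q) (a i q) = Add C (Scal C (?c (q + 2)) (a i q)) (Scal C (of_int q) (a i q))"
    by (simp add: Add_Scal)
  also have "\<dots> = Add C (F (q + 2) \<cdot> R q (q + 2)) (Scal C (of_int q) (Idn C (X q))) \<cdot> a i q"
    using 2 by (simp add: Cmp_Add)
  finally show "(R (q - 2) q \<cdot> F q) \<cdot> a i q =
    Add C (F (q + 2) \<cdot> R q (q + 2)) (Scal C (of_int q) (Idn C (X q))) \<cdot> a i q" .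
qed auto

end

section \<open>The sl2-action on graded maps between two Lefschetz objects\<close>

context linear_category
begin

text \<open>The additive core of the Jacobi identity. The mixed terms \<open>A\<close> and
  \<open>B\<close> occur on both sides, and the weight p + w of the target against the weight p of
  the source leaves w.\<close>

lemma commutator_regroup:
  assumes "S \<in> Hom C X Y" "T \<in> Hom C X Y" "A \<in> Hom C X Y" "B \<in> Hom C X Y" "U \<in> Hom C X Y"
  shows "Add C (Add C (Add C S (Scal C (p + w) U)) (Scal C (-1) A)) (Scal C (-1) (Add C B (Scal C (-1) T))) =
    Add C (Add C (Add C S (Scal C (-1) B)) (Scal C (-1) (Add C A (Scal C (-1) (Add C T (Scal C p U)))))) (Scal C w U)"
proof -
  have U: "Scal C (p + w) U = Add C (Scal C p U) (Scal C w U)" using assms by (simp add: Add_Scal)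
  show ?thesis unfolding U using assms by (simp add: Scal_Add Add_assoc Add_commute Add_left_commute)
qed

end

locale two_lefschetz = X: lefschetz C X RX r kX + Y: lefschetz C Y RY r kY
  for C :: "('o, 'a, 'm) lincat_scheme" (structure) and X RX r kX Y RY kY
begin

text \<open>A map of degree w is stored as a full matrix that vanishes off the line q = p + w, so
  that maps of all degrees have one type and share the zero \<open>zmat\<close>.\<close>

definition M :: "int \<Rightarrow> (int \<Rightarrow> int \<Rightarrow> 'a) set" where
  "M w = {u. (\<forall>p q. u p q \<in> Hom C (X p) (Y q)) \<and> (\<forall>p q. q \<noteq> p + w \<longrightarrow> u p q = Zero C (X p) (Y q))}"

definition zmat :: "int \<Rightarrow> int \<Rightarrow> 'a" where "zmat p q = Zero C (X p) (Y q)"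

definition ad :: "(int \<Rightarrow> int \<Rightarrow> 'a) \<Rightarrow> int \<Rightarrow> int \<Rightarrow> 'a" where
  "ad u p q = Add C (RY (q - 2) q \<cdot> u p (q - 2)) (Scal C (-1) (u (p + 2) q \<cdot> RX p (p + 2)))"

definition adF :: "(int \<Rightarrow> int \<Rightarrow> 'a) \<Rightarrow> int \<Rightarrow> int \<Rightarrow> 'a" where
  "adF u p q = Add C (Y.F (q + 2) \<cdot> u p (q + 2)) (Scal C (-1) (u (p - 2) q \<cdot> X.F p))"

lemma M_D:
  assumes "u \<in> M w"
  shows "u p q \<in> Mor C" "Src C (u p q) = X p" "Tgt C (u p q) = Y q"
    "q \<noteq> p + w \<Longrightarrow> u p q = Zero C (X p) (Y q)"
  using assms by (auto simp: M_def)

lemma zmat_Add: "u \<in> M w \<Longrightarrow> (\<lambda>p q. Add C (zmat p q) (u p q)) = u"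
  by (intro ext) (simp add: zmat_def M_D)

lemma M_bounded:
  assumes "u \<in> M w" "w < - (2 * int r)"
  shows "u = zmat"
proof (intro ext)
  fix p q
  \<comment> \<open>On the line q = p + w with w < -2r the degrees p and q cannot both lie in
    [-r, r].\<close>
  consider "q \<noteq> p + w" | "\<bar>p\<bar> > int r" | "\<bar>q\<bar> > int r" using assms(2) by linarith
  then show "u p q = zmat p q"
    using M_D(1-3)[OF assms(1), of p q] M_D(4)[OF assms(1), of q p] X.zero_ob_Zero(1)[OF X.X_zero, of p "u p q"]
      X.zero_ob_Zero(2)[OF Y.X_zero, of q "u p q"] by cases (auto simp: zmat_def)
qed

lemma ad_adF:
  assumes u: "u \<in> M w"
  shows "ad (adF u) p q = Add C (adF (ad u) p q) (Scal C (of_int w) (u p q))"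
proof (cases "q = p + w")
  case True
  note [simp] = M_D(1-3)[OF u]
  define S where "S = Y.F (q + 2) \<cdot> (RY q (q + 2) \<cdot> u p q)"
  define T where "T = u p q \<cdot> (X.F (p + 2) \<cdot> RX p (p + 2))"
  define A where "A = RY (q - 2) q \<cdot> (u (p - 2) (q - 2) \<cdot> X.F p)"
  define B where "B = Y.F (q + 2) \<cdot> (u (p + 2) (q + 2) \<cdot> RX p (p + 2))"
  \<comment> \<open>The commutator on the target contributes the weight q = p + w, the one on the
    source contributes p.\<close>
  have S': "RY (q - 2) q \<cdot> (Y.F q \<cdot> u p q) = Add C S (Scal C (of_int p + of_int w) (u p q))"
    unfolding S_def by (subst X.Cmp_reassoc[OF Y.E_F_commutator]) (simp_all add: X.Cmp_Add True)
  have T': "u p q \<cdot> (RX (p - 2) p \<cdot> X.F p) = Add C T (Scal C (of_int p) (u p q))"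
    unfolding T_def by (subst X.E_F_commutator) (simp add: X.Cmp_Add)
  have "ad (adF u) p q = Add C (Add C (RY (q - 2) q \<cdot> (Y.F q \<cdot> u p q)) (Scal C (-1) A)) (Scal C (-1) (Add C B (Scal C (-1) T)))"
    unfolding ad_def adF_def S_def T_def A_def B_def by (simp add: X.Cmp_Add)
  moreover have "adF (ad u) p q = Add C (Add C S (Scal C (-1) B)) (Scal C (-1) (Add C A (Scal C (-1) (u p q \<cdot> (RX (p - 2) p \<cdot> X.F p)))))"
    unfolding ad_def adF_def S_def T_def A_def B_def by (simp add: X.Cmp_Add)
  moreover have "S \<in> Hom C (X p) (Y q)" "T \<in> Hom C (X p) (Y q)" "A \<in> Hom C (X p) (Y q)" "B \<in> Hom C (X p) (Y q)" "u p q \<in> Hom C (X p) (Y q)"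
    unfolding S_def T_def A_def B_def by simp_all
  ultimately show ?thesis unfolding S' T' by (simp only: X.commutator_regroup)
next
  case False
  then show ?thesis by (simp add: ad_def adF_def M_D[OF u])
qed

sublocale sl2_module M "\<lambda>u v p q. Add C (u p q) (v p q)" "\<lambda>a u p q. Scal C a (u p q)" zmat ad adF "2 * int r"
proof
  show "zmat \<in> M w" for w by (simp add: M_def zmat_def)
  fix u w assume u: "u \<in> M w"
  note [simp] = M_D[OF u]
  show "(\<lambda>p q. Scal C a (u p q)) \<in> M w" for a by (simp add: M_def)
  show "ad u \<in> M (w + 2)" by (auto simp add: M_def ad_def)
  show "adF u \<in> M (w - 2)" by (auto simp add: M_def adF_def)
  show "u = zmat" if "w < - (2 * int r)" using M_bounded[OF u that] .
  show "(\<lambda>p q. Add C (zmat p q) (u p q)) = u" by (rule zmat_Add[OF u])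
  show "(\<lambda>p q. Add C (Scal C a (u p q)) (Scal C b (u p q))) = (\<lambda>p q. Scal C (a + b) (u p q))" for a b
    by (simp add: X.Add_Scal)
  show "u = zmat" if "(\<lambda>p q. Scal C a (u p q)) = zmat" "a \<noteq> 0" for a
  proof (intro ext)
    fix p q show "u p q = zmat p q"
      using X.Scal_eq_Zero[of "u p q" a] fun_cong[OF fun_cong[OF that(1)], of p q] that(2) by (simp add: zmat_def)
  qed
  show "ad (\<lambda>p q. Scal C a (u p q)) = (\<lambda>p q. Scal C a (ad u p q))" for a
    by (intro ext) (simp add: ad_def X.Scal_Add)
  show "ad (adF u) = (\<lambda>p q. Add C (adF (ad u) p q) (Scal C (of_int w) (u p q)))"
    by (intro ext) (rule ad_adF[OF u])
  fix v assume v: "v \<in> M w"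
  note [simp] = M_D[OF v]
  show "ad (\<lambda>p q. Add C (u p q) (v p q)) = (\<lambda>p q. Add C (ad u p q) (ad v p q))"
    by (intro ext) (simp add: ad_def X.Scal_Add X.Cmp_Add X.Add_assoc X.Add_commute X.Add_left_commute)
  fix x assume x: "x \<in> M w"
  note [simp] = M_D[OF x]
  show "(\<lambda>p q. Add C (Add C (u p q) (v p q)) (x p q)) = (\<lambda>p q. Add C (u p q) (Add C (v p q) (x p q)))"
    by (simp add: X.Add_assoc)
qed (intro ext, simp add: zmat_def ad_def adF_def)+

lemmas ad_pow_inj = E_pow_inj

end

section \<open>Shifts and the opposite category\<close>

locale additive_functor = linear_category C for C :: "('o, 'a, 'm) lincat_scheme" (structure) +
  fixes FO :: "'o \<Rightarrow> 'o" and FA :: "'a \<Rightarrow> 'a"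
  assumes endo: "is_endofunctor C FO FA" and additive: "is_additive C FA"
begin

lemma map_simps [simp]: "f \<in> Mor C \<Longrightarrow> FA f \<in> Mor C" "f \<in> Mor C \<Longrightarrow> Src C (FA f) = FO (Src C f)"
    "f \<in> Mor C \<Longrightarrow> Tgt C (FA f) = FO (Tgt C f)" "X \<in> Ob C \<Longrightarrow> FO X \<in> Ob C" "X \<in> Ob C \<Longrightarrow> FA (Idn C X) = Idn C (FO X)"
    "\<lbrakk>f \<in> Mor C; g \<in> Mor C; Src C g = Tgt C f\<rbrakk> \<Longrightarrow> FA (g \<cdot> f) = FA g \<cdot> FA f"
  using endo unfolding is_endofunctor_def by auto

lemma map_Add [simp]:
  "\<lbrakk>f \<in> Mor C; g \<in> Mor C; Src C f = Src C g; Tgt C f = Tgt C g\<rbrakk> \<Longrightarrow> FA (Add C f g) = Add C (FA f) (FA g)"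
  using additive unfolding is_additive_def by auto

text \<open>Additivity is given for binary sums only; the image z of zero satisfies z = z + z, which
  forces z = 0.\<close>

lemma map_Zero [simp]:
  assumes "X \<in> Ob C" "Y \<in> Ob C"
  shows "FA (Zero C X Y) = Zero C (FO X) (FO Y)"
proof -
  let ?z = "FA (Zero C X Y)"
  have z: "?z \<in> Mor C" "Src C ?z = FO X" "Tgt C ?z = FO Y" using assms by auto
  have "?z = FA (Add C (Zero C X Y) (Zero C X Y))" using assms by simp
  then have "?z = Add C ?z ?z" using assms by (metis map_Add Zero_simps)
  then have "Add C ?z (Scal C (-1) ?z) = Add C (Add C ?z ?z) (Scal C (-1) ?z)" by simp
  then show ?thesis using z by (simp add: Add_assoc Add_cancel)
qed

lemma map_neg [simp]:
  assumes "f \<in> Mor C"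
  shows "FA (Scal C (-1) f) = Scal C (-1) (FA f)"
proof -
  have "Add C (FA (Scal C (-1) f)) (FA f) = FA (Add C (Scal C (-1) f) f)" using assms by simp
  also have "\<dots> = Zero C (FO (Src C f)) (FO (Tgt C f))"
    using assms Add_commute[of "Scal C (-1) f" f] by (simp add: Add_cancel)
  finally have "Add C (FA (Scal C (-1) f)) (Scal C (-1) (Scal C (-1) (FA f))) = Zero C (FO (Src C f)) (FO (Tgt C f))"
    using assms by simp
  then show ?thesis using assms by (intro Sub_eq_Zero[of "FA (Scal C (-1) f)"]) auto
qed

lemma map_hsum:
  assumes "X \<in> Ob C" "Y \<in> Ob C" "finite I" "\<And>i. i \<in> I \<Longrightarrow> f i \<in> Hom C X Y"
  shows "FA (hsum C X Y f I) = hsum C (FO X) (FO Y) (\<lambda>i. FA (f i)) I"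
  using assms(3,4) by (induction I rule: finite_induct) (simp_all add: hsum_insert assms(1,2))

lemma map_iso [simp]:
  assumes "is_iso C f"
  shows "is_iso C (FA f)" and map_cinv: "FA (cinv C f) = cinv C (FA f)"
proof -
  note [simp] = iso_Mor[OF assms]
  have 1: "FA (cinv C f) \<cdot> FA f = Idn C (Src C (FA f))" "FA f \<cdot> FA (cinv C f) = Idn C (Tgt C (FA f))"
    using assms by (simp_all flip: map_simps(6))
  then show "is_iso C (FA f)" using assms by (intro isoI[of "FA (cinv C f)"]) auto
  show "FA (cinv C f) = cinv C (FA f)" using assms 1 by (intro cinv_eqI[symmetric]) auto
qed

lemma map_zero_ob: "is_zero_ob C X \<Longrightarrow> is_zero_ob C (FO X)"
  using zero_ob_Idn[of X] zero_ob_Ob[of X] map_simps(5)[of X] map_Zero[of X X] by (intro zero_obI) auto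

lemma funpow_endofunctor: "is_endofunctor C (FO ^^ n) (FA ^^ n) \<and> is_additive C (FA ^^ n)"
proof (induction n)
  case 0
  then show ?case by (auto simp: is_endofunctor_def is_additive_def)
next
  case (Suc n)
  then interpret n: additive_functor C "FO ^^ n" "FA ^^ n" by unfold_locales auto
  show ?case by (auto simp: is_endofunctor_def is_additive_def)
qed

end

locale linear_equivalence = additive_functor C FO FA
  for C :: "('o, 'a, 'm) lincat_scheme" (structure) and FO FA +
  assumes faithful: "\<lbrakk>FA f = FA g; f \<in> Mor C; g \<in> Mor C; Src C f = Src C g; Tgt C f = Tgt C g\<rbrakk> \<Longrightarrow> f = g"
    and full: "\<lbrakk>h \<in> Hom C (FO X) (FO Y); X \<in> Ob C; Y \<in> Ob C\<rbrakk> \<Longrightarrow> \<exists>f \<in> Hom C X Y. FA f = h"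
    and dense: "Y \<in> Ob C \<Longrightarrow> \<exists>X f. X \<in> Ob C \<and> f \<in> Hom C (FO X) Y \<and> is_iso C f"
begin

text \<open>Test arrows have arbitrary sources. Density replaces the source by some
  \<open>FO X\<close> up to an isomorphism \<open>u\<close>; fullness lifts the arrow, and
  faithfulness reflects the equation. Kernels are treated in the same way below.\<close>

lemma map_mono:
  assumes "is_mono C m"
  shows "is_mono C (FA m)"
proof (rule monoI)
  note [simp] = mono_Mor[OF assms]
  show "FA m \<in> Mor C" by simp
  fix f g assume H: "f \<in> Mor C" "g \<in> Mor C" "Src C f = Src C g" "Tgt C f = Src C (FA m)"
    "Tgt C g = Src C (FA m)" "FA m \<cdot> f = FA m \<cdot> g"
  obtain X u where u: "X \<in> Ob C" "u \<in> Hom C (FO X) (Src C f)" "is_iso C u"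
    using dense[of "Src C f"] H(1) by auto
  obtain f' where f': "f' \<in> Hom C X (Src C m)" "FA f' = f \<cdot> u"
    using full[of "f \<cdot> u" X "Src C m"] u H by auto
  obtain g' where g': "g' \<in> Hom C X (Src C m)" "FA g' = g \<cdot> u"
    using full[of "g \<cdot> u" X "Src C m"] u H by auto
  have "FA (m \<cdot> f') = (FA m \<cdot> f) \<cdot> u" using f' u(2) H(1-5) by simp
  also have "\<dots> = FA (m \<cdot> g')" unfolding H(6) using g' u(2) H(1-5) by simp
  finally have "m \<cdot> f' = m \<cdot> g'" by (rule faithful) (use f'(1) g'(1) in auto)
  then have "f' = g'" by (rule mono_cancel[OF assms]) (use f'(1) g'(1) in auto)
  then have "f \<cdot> u = g \<cdot> u" using f'(2) g'(2) by simp
  then show "f = g" by (rule iso_cancel_right[OF u(3)]) (use u H(1-5) in auto)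
qed

lemma map_ker:
  assumes "is_ker C f k"
  shows "is_ker C (FA f) (FA k)"
proof (rule kerI)
  note [simp] = ker_simps(1-3)[OF assms]
  show "is_mono C (FA k)" by (intro map_mono ker_mono[OF assms])
  have "FA f \<cdot> FA k = FA (f \<cdot> k)" by simp
  also have "\<dots> = Zero C (Src C (FA k)) (Tgt C (FA f))" unfolding ker_simps(4)[OF assms] by simp
  finally show "FA f \<cdot> FA k = Zero C (Src C (FA k)) (Tgt C (FA f))" .
  fix h assume h: "h \<in> Mor C" "Tgt C h = Src C (FA f)" "FA f \<cdot> h = Zero C (Src C h) (Tgt C (FA f))"
  obtain X u where u: "X \<in> Ob C" "u \<in> Hom C (FO X) (Src C h)" "is_iso C u"
    using dense[of "Src C h"] h(1) by auto
  obtain h' where h': "h' \<in> Hom C X (Src C f)" "FA h' = h \<cdot> u"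
    using full[of "h \<cdot> u" X "Src C f"] u h by auto
  have "FA (f \<cdot> h') = (FA f \<cdot> h) \<cdot> u" using u(2) h(1,2) h' by simp
  also have "\<dots> = FA (Zero C X (Tgt C f))" unfolding h(3) using u h(1) by simp
  finally have "f \<cdot> h' = Zero C X (Tgt C f)" by (rule faithful) (use h' u(1) in auto)
  then have F: "factors C k h'" using h' by (intro ker_factors[OF assms]) auto
  have eq: "FA k \<cdot> (FA (fac C k h') \<cdot> cinv C u) = h"
  proof -
    have "FA k \<cdot> FA (fac C k h') = h \<cdot> u"
      using fac_simps[OF ker_mono[OF assms] F] h' by (metis map_simps(6) ker_simps(2) assms)
    then have "(FA k \<cdot> FA (fac C k h')) \<cdot> cinv C u = (h \<cdot> u) \<cdot> cinv C u" by simp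
    then show ?thesis using u h(1,2) fac_simps[OF ker_mono[OF assms] F] h' by simp
  qed
  show "factors C (FA k) h"
    by (rule factorsI[OF _ _ _ eq]) (use fac_simps[OF ker_mono[OF assms] F] h' u in simp_all)
qed (use ker_simps(1-3)[OF assms] in auto)

lemma funpow_equivalence: "linear_equivalence C (FO ^^ n) (FA ^^ n)"
proof (induction n)
  case 0
  have "\<exists>X f. X \<in> Ob C \<and> f \<in> Mor C \<and> Src C f = X \<and> Tgt C f = Y \<and> is_iso C f" if "Y \<in> Ob C" for Y
    using that by (intro exI[of _ Y] exI[of _ "Idn C Y"]) simp
  then show ?case using funpow_endofunctor[of 0] by unfold_locales (auto simp: id_def)
next
  case (Suc n)
  then interpret n: linear_equivalence C "FO ^^ n" "FA ^^ n" .
  show ?case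
  proof
    fix f g assume "(FA ^^ Suc n) f = (FA ^^ Suc n) g" and H: "f \<in> Mor C" "g \<in> Mor C" "Src C f = Src C g" "Tgt C f = Tgt C g"
    then have "FA ((FA ^^ n) f) = FA ((FA ^^ n) g)" by simp
    then have "(FA ^^ n) f = (FA ^^ n) g" by (rule faithful) (use H in auto)
    then show "f = g" using H by (rule n.faithful)
  next
    fix h X Y assume H: "h \<in> Hom C ((FO ^^ Suc n) X) ((FO ^^ Suc n) Y)" "X \<in> Ob C" "Y \<in> Ob C"
    then obtain g where g: "g \<in> Hom C ((FO ^^ n) X) ((FO ^^ n) Y)" "FA g = h"
      using full[of h "(FO ^^ n) X" "(FO ^^ n) Y"] by auto
    then show "\<exists>f\<in>Hom C X Y. (FA ^^ Suc n) f = h" using n.full[of g X Y] H by auto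
  next
    fix Y assume Y: "Y \<in> Ob C"
    obtain Z f where Z: "Z \<in> Ob C" "f \<in> Hom C (FO Z) Y" "is_iso C f" using dense[OF Y] by auto
    obtain X g where X: "X \<in> Ob C" "g \<in> Hom C ((FO ^^ n) X) Z" "is_iso C g" using n.dense[OF Z(1)] by auto
    have "f \<cdot> FA g \<in> Hom C ((FO ^^ Suc n) X) Y" "is_iso C (f \<cdot> FA g)" using Z X by (auto intro!: iso_Cmp)
    then show "\<exists>X f. X \<in> Ob C \<and> f \<in> Hom C ((FO ^^ Suc n) X) Y \<and> is_iso C f" using X(1) by blast
  qed (use funpow_endofunctor[of "Suc n"] in \<open>auto simp: o_def\<close>)
qed

end

section \<open>The opposite category\<close>

lemma opcat_simps [simp]:
  "Ob (opcat C) = Ob C" "Mor (opcat C) = Mor C" "Src (opcat C) = Tgt C" "Tgt (opcat C) = Src C"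
  "Idn (opcat C) = Idn C" "g \<cdot>\<^bsub>opcat C\<^esub> f = f \<cdot>\<^bsub>C\<^esub> g" "Zero (opcat C) X Y = Zero C Y X"
  "Add (opcat C) = Add C" "Scal (opcat C) = Scal C" "ShO (opcat C) = UnO C" "ShA (opcat C) = UnA C"
  "UnO (opcat C) = ShO C" "UnA (opcat C) = ShA C" "Unit (opcat C) = Counit C" "Counit (opcat C) = Unit C"
  by (simp_all add: opcat_def)

lemma opcat_Hom: "Hom (opcat C) X Y = Hom C Y X"
  by (auto simp: Hom_def)

lemma opcat_hmod: "hmod (opcat C) X Y = hmod C Y X"
  by (auto simp: hmod_def Hom_def)

lemma opcat_hsum [simp]: "hsum (opcat C) X Y f I = hsum C Y X f I"
  by (simp add: hsum_def opcat_hmod)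

lemma opcat_preds [simp]:
  "is_iso (opcat C) f = is_iso C f" "cinv (opcat C) f = cinv C f"
  "is_mono (opcat C) f = is_epi C f" "is_epi (opcat C) f = is_mono C f"
  "is_ker (opcat C) f k = is_coker C f k" "is_coker (opcat C) f k = is_ker C f k"
  "is_zero_ob (opcat C) Z = is_zero_ob C Z"
  "is_dsum (opcat C) I X D \<iota> \<pi> = is_dsum C I X D \<pi> \<iota>"
proof -
  \<comment> \<open>The matrix of the products of projections and injections gets transposed, so the
    two indices in its case distinction must be swapped.\<close>
  show "is_dsum (opcat C) I X D \<iota> \<pi> = is_dsum C I X D \<pi> \<iota>" unfolding is_dsum_def opcat_simps opcat_hsum opcat_Hom
    by (intro arg_cong2[of _ _ _ _ "(\<and>)"]) (auto simp: eq_commute[of "_ :: 'i"])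
  show "is_iso (opcat C) f = is_iso C f" unfolding is_iso_def opcat_simps opcat_Hom by auto
  show "cinv (opcat C) f = cinv C f" unfolding cinv_def opcat_simps opcat_Hom
    by (simp only: conj_commute conj_left_commute)
  show "is_mono (opcat C) f = is_epi C f" "is_epi (opcat C) f = is_mono C f"
    unfolding is_mono_def is_epi_def opcat_simps opcat_Hom by simp_all
  show "is_ker (opcat C) f k = is_coker C f k" "is_coker (opcat C) f k = is_ker C f k"
    unfolding is_ker_def is_coker_def opcat_simps opcat_Hom by simp_all
  show "is_zero_ob (opcat C) Z = is_zero_ob C Z"
    unfolding is_zero_ob_def opcat_simps opcat_Hom by (simp only: conj_commute)
qed

lemma linear_category_opcat:
  assumes "linear_category C"
  shows "linear_category (opcat C)"
proof -
  interpret linear_category C by fact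
  show ?thesis
    by (rule linear_category.intro) (auto simp: opcat_hmod Hom_module Cmp_Add)
qed

lemma linear_abelian_opcat:
  assumes "linear_abelian C"
  shows "linear_abelian (opcat C)"
proof -
  interpret linear_abelian C by fact
  interpret op: linear_category "opcat C" by (rule linear_category_opcat) unfold_locales
  show ?thesis
  proof
    show "\<exists>D \<iota> \<pi>. is_dsum (opcat C) {0 :: nat, 1} (\<lambda>i. if i = 0 then X else Y) D \<iota> \<pi>"
      if "X \<in> Ob (opcat C)" "Y \<in> Ob (opcat C)" for X Y
      using ex_dsum[of X Y] that unfolding opcat_preds opcat_simps by blast
  qed (simp_all add: ex_zero_ob ex_ker ex_coker mono_ker epi_coker)
qed

lemma additive_functor_opcat:
  assumes "additive_functor C FO FA"
  shows "additive_functor (opcat C) FO FA"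
proof -
  interpret additive_functor C FO FA by fact
  interpret op: linear_category "opcat C" by (rule linear_category_opcat) unfold_locales
  show ?thesis by unfold_locales (auto simp: is_endofunctor_def is_additive_def)
qed

lemma linear_equivalence_opcat:
  assumes "linear_equivalence C FO FA"
  shows "linear_equivalence (opcat C) FO FA"
proof -
  interpret linear_equivalence C FO FA by fact
  interpret op: additive_functor "opcat C" FO FA by (rule additive_functor_opcat) unfold_locales
  show ?thesis
  proof
    show "f = g" if "FA f = FA g" "f \<in> Mor (opcat C)" "g \<in> Mor (opcat C)" "Src (opcat C) f = Src (opcat C) g"
      "Tgt (opcat C) f = Tgt (opcat C) g" for f g using that by (auto intro: faithful)
    show "\<exists>f\<in>Hom (opcat C) X Y. FA f = h" if "h \<in> Hom (opcat C) (FO X) (FO Y)" "X \<in> Ob (opcat C)" "Y \<in> Ob (opcat C)" for h X Y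
      using that full[of h Y X] by auto
    fix Y assume "Y \<in> Ob (opcat C)"
    then obtain X f where X: "X \<in> Ob C" "f \<in> Hom C (FO X) Y" "is_iso C f" using dense[of Y] by auto
    then have "X \<in> Ob (opcat C) \<and> cinv C f \<in> Hom (opcat C) (FO X) Y \<and> is_iso (opcat C) (cinv C f)"
      by (auto intro: iso_cinv)
    then show "\<exists>X f. X \<in> Ob (opcat C) \<and> f \<in> Hom (opcat C) (FO X) Y \<and> is_iso (opcat C) f" by blast
  qed
qed

section \<open>The shift and its quasi-inverse as equivalences\<close>

context shifted_abelian
begin

text \<open>The quasi-inverse is assumed to be an endofunctor; these rules serve until its
  additivity has been derived.\<close>

lemma Un_endo_simps:
  "f \<in> Mor C \<Longrightarrow> UnA C f \<in> Mor C" "f \<in> Mor C \<Longrightarrow> Src C (UnA C f) = UnO C (Src C f)"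
  "f \<in> Mor C \<Longrightarrow> Tgt C (UnA C f) = UnO C (Tgt C f)" "X \<in> Ob C \<Longrightarrow> UnO C X \<in> Ob C" "X \<in> Ob C \<Longrightarrow> UnA C (Idn C X) = Idn C (UnO C X)"
  "\<lbrakk>f \<in> Mor C; g \<in> Mor C; Src C g = Tgt C f\<rbrakk> \<Longrightarrow> UnA C (g \<cdot> f) = UnA C g \<cdot> UnA C f"
  using Un_functor unfolding is_endofunctor_def by auto

sublocale Sh: additive_functor C "ShO C" "ShA C"
  by unfold_locales (fact Sh_functor Sh_additive)+

lemma Unit_simps [simp]:
  assumes "X \<in> Ob C"
  shows "Unit C X \<in> Mor C" "Src C (Unit C X) = X" "Tgt C (Unit C X) = UnO C (ShO C X)" "is_iso C (Unit C X)"
  using Unit_iso[OF assms] by auto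

lemma Counit_simps [simp]:
  assumes "X \<in> Ob C"
  shows "Counit C X \<in> Mor C" "Src C (Counit C X) = ShO C (UnO C X)" "Tgt C (Counit C X) = X" "is_iso C (Counit C X)"
  using Counit_iso[OF assms] by auto

lemma Unit_conj:
  assumes "f \<in> Mor C"
  shows "f = cinv C (Unit C (Tgt C f)) \<cdot> (UnA C (ShA C f) \<cdot> Unit C (Src C f))"
proof -
  have "UnA C (ShA C f) \<cdot> Unit C (Src C f) = Unit C (Tgt C f) \<cdot> f"
    using Unit_natural[of f "Src C f" "Tgt C f"] assms by simp
  then show ?thesis using assms by simp
qed

lemma Counit_conj:
  assumes "f \<in> Mor C"
  shows "f = (Counit C (Tgt C f) \<cdot> ShA C (UnA C f)) \<cdot> cinv C (Counit C (Src C f))"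
proof -
  have "Counit C (Tgt C f) \<cdot> ShA C (UnA C f) = f \<cdot> Counit C (Src C f)"
    using Counit_natural[of f "Src C f" "Tgt C f"] assms by simp
  then show ?thesis using assms by simp
qed

lemma Sh_faithful: "\<lbrakk>ShA C f = ShA C g; f \<in> Mor C; g \<in> Mor C; Src C f = Src C g; Tgt C f = Tgt C g\<rbrakk> \<Longrightarrow> f = g"
  using Unit_conj[of f] Unit_conj[of g] by simp

lemma Un_faithful: "\<lbrakk>UnA C f = UnA C g; f \<in> Mor C; g \<in> Mor C; Src C f = Src C g; Tgt C f = Tgt C g\<rbrakk> \<Longrightarrow> f = g"
  using Counit_conj[of f] Counit_conj[of g] by simp

text \<open>Additivity of the quasi-inverse is a consequence: after \<open>ShA\<close> and
  composition with the counit, naturality turns both sides into the same sum, and the counit and the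
  faithful \<open>ShA\<close> can be cancelled.\<close>

sublocale Un: additive_functor C "UnO C" "UnA C"
proof
  show "is_endofunctor C (UnO C) (UnA C)" by (rule Un_functor)
  show "is_additive C (UnA C)" unfolding is_additive_def
  proof (intro ballI)
    fix f g assume f: "f \<in> Mor C" and g: "g \<in> Hom C (Src C f) (Tgt C f)"
    note [simp] = Un_endo_simps
    let ?c = "Counit C (Tgt C f)" and ?d = "Counit C (Src C f)"
    have nat: "?c \<cdot> ShA C (UnA C h) = h \<cdot> ?d" if "h \<in> Hom C (Src C f) (Tgt C f)" for h
      using Counit_natural[OF that] by simp
    have "?c \<cdot> ShA C (UnA C (Add C f g)) = ?c \<cdot> ShA C (Add C (UnA C f) (UnA C g))"
      using f g nat[of "Add C f g"] nat[of f] nat[of g] by (simp add: Cmp_Add)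
    then have "ShA C (UnA C (Add C f g)) = ShA C (Add C (UnA C f) (UnA C g))"
      by (rule iso_cancel_left[rotated]) (use f g in simp_all)
    then show "UnA C (Add C f g) = Add C (UnA C f) (UnA C g)"
      by (rule Sh_faithful) (use f g in simp_all)
  qed
qed

sublocale Sh: linear_equivalence C "ShO C" "ShA C"
proof
  fix h X Y assume H: "h \<in> Hom C (ShO C X) (ShO C Y)" "X \<in> Ob C" "Y \<in> Ob C"
  \<comment> \<open>The candidate for a preimage of \<open>h\<close> is \<open>UnA C h\<close>
    transported along the units. Naturality of the unit and faithfulness of \<open>UnA\<close> show
    that it works.\<close>
  define f where "f = cinv C (Unit C Y) \<cdot> (UnA C h \<cdot> Unit C X)"
  have f: "f \<in> Hom C X Y" unfolding f_def using H by simp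
  have "UnA C (ShA C f) \<cdot> Unit C X = UnA C h \<cdot> Unit C X"
    unfolding Unit_natural[OF f, symmetric] unfolding f_def using H by simp
  then have "UnA C (ShA C f) = UnA C h" by (rule iso_cancel_right[rotated]) (use H f in auto)
  then have "ShA C f = h" by (rule Un_faithful) (use H f in auto)
  with f show "\<exists>f\<in>Hom C X Y. ShA C f = h" by blast
next
  fix Y assume "Y \<in> Ob C"
  then show "\<exists>X f. X \<in> Ob C \<and> f \<in> Hom C (ShO C X) Y \<and> is_iso C f"
    by (intro exI[of _ "UnO C Y"] exI[of _ "Counit C Y"]) simp
qed (rule Sh_faithful)

sublocale Un: linear_equivalence C "UnO C" "UnA C"
proof
  fix h X Y assume H: "h \<in> Hom C (UnO C X) (UnO C Y)" "X \<in> Ob C" "Y \<in> Ob C"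
  define f where "f = (Counit C Y \<cdot> ShA C h) \<cdot> cinv C (Counit C X)"
  have f: "f \<in> Hom C X Y" unfolding f_def using H by simp
  have "Counit C Y \<cdot> ShA C (UnA C f) = Counit C Y \<cdot> ShA C h"
    unfolding Counit_natural[OF f, symmetric] unfolding f_def using H by simp
  then have "ShA C (UnA C f) = ShA C h" by (rule iso_cancel_left[rotated]) (use H f in auto)
  then have "UnA C f = h" by (rule Sh_faithful) (use H f in auto)
  with f show "\<exists>f\<in>Hom C X Y. UnA C f = h" by blast
next
  fix Y assume "Y \<in> Ob C"
  then show "\<exists>X f. X \<in> Ob C \<and> f \<in> Hom C (UnO C X) Y \<and> is_iso C f"
    by (intro exI[of _ "ShO C Y"] exI[of _ "cinv C (Unit C Y)"]) (simp add: iso_cinv)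
qed (rule Un_faithful)

sublocale Shm: linear_equivalence C "ShO C ^^ m" "ShA C ^^ m" for m
  by (rule Sh.funpow_equivalence)

sublocale Unm: linear_equivalence C "UnO C ^^ m" "UnA C ^^ m" for m
  by (rule Un.funpow_equivalence)

end

section \<open>Translates of arrows and powers of e\<close>

context shifted_abelian
begin

lemma unsh_simps [simp]:
  assumes "Y \<in> Ob C"
  shows "unsh C m Y \<in> Mor C" "Src C (unsh C m Y) = (UnO C ^^ m) ((ShO C ^^ m) Y)" "Tgt C (unsh C m Y) = Y"
    "is_iso C (unsh C m Y)"
proof -
  have "unsh C m Y \<in> Hom C ((UnO C ^^ m) ((ShO C ^^ m) Y)) Y \<and> is_iso C (unsh C m Y)"
  proof (induction m)
    case (Suc m)
    then show ?case using assms by (auto simp: funpow_swap1 intro!: iso_Cmp Unm.map_iso iso_cinv)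
  qed (use assms in simp)
  then show "unsh C m Y \<in> Mor C" "Src C (unsh C m Y) = (UnO C ^^ m) ((ShO C ^^ m) Y)" "Tgt C (unsh C m Y) = Y"
    "is_iso C (unsh C m Y)" by auto
qed

lemma Unit_cinv_natural:
  assumes "f \<in> Mor C"
  shows "cinv C (Unit C (Tgt C f)) \<cdot> UnA C (ShA C f) = f \<cdot> cinv C (Unit C (Src C f))"
proof (rule iso_cancel_right[of "Unit C (Src C f)"])
  have "(cinv C (Unit C (Tgt C f)) \<cdot> UnA C (ShA C f)) \<cdot> Unit C (Src C f) =
    cinv C (Unit C (Tgt C f)) \<cdot> (UnA C (ShA C f) \<cdot> Unit C (Src C f))"
    using assms by simp
  also have "\<dots> = f"
    using Unit_natural[of f "Src C f" "Tgt C f", symmetric] assms by simp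
  finally show "(cinv C (Unit C (Tgt C f)) \<cdot> UnA C (ShA C f)) \<cdot> Unit C (Src C f) =
    (f \<cdot> cinv C (Unit C (Src C f))) \<cdot> Unit C (Src C f)" using assms by simp
qed (use assms in simp_all)

lemma Unit_cinv_natural':
  assumes "f \<in> Mor C" "h \<in> Mor C" "Y = Tgt C f" "Tgt C h = UnO C (ShO C (Src C f))"
  shows "cinv C (Unit C Y) \<cdot> (UnA C (ShA C f) \<cdot> h) = f \<cdot> (cinv C (Unit C (Src C f)) \<cdot> h)"
  unfolding assms(3) using assms by (subst Cmp_reassoc[OF Unit_cinv_natural]) simp_all

lemma transl_simps [simp]:
  assumes "f \<in> Mor C" "Tgt C f = (ShO C ^^ m) Y" "Y \<in> Ob C"
  shows "transl C m Y f \<in> Mor C" "Src C (transl C m Y f) = (UnO C ^^ m) (Src C f)" "Tgt C (transl C m Y f) = Y"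
  using assms by (simp_all add: transl_def)

lemma transl_Cmp:
  assumes "f \<in> Mor C" "Tgt C f = (ShO C ^^ m) Y" "Y \<in> Ob C" "g \<in> Mor C" "Tgt C g = Src C f"
  shows "transl C m Y (f \<cdot> g) = transl C m Y f \<cdot> (UnA C ^^ m) g"
  using assms by (simp add: transl_def)

lemma transl_Suc:
  assumes "f \<in> Mor C" "Tgt C f = (ShO C ^^ Suc m) Y" "Y \<in> Ob C"
  shows "transl C (Suc m) Y f = transl C m Y (transl C 1 ((ShO C ^^ m) Y) f)"
  using assms by (simp add: transl_def funpow_swap1)

text \<open>The definition splits off the cancellation of the innermost pair of shifts; here that of
  the outermost pair is split off. This allows \<open>transl\<close> to be unfolded from either
  end.\<close>

lemma unsh_Suc:
  assumes "Y \<in> Ob C"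
  shows "unsh C (Suc m) Y = cinv C (Unit C Y) \<cdot> UnA C (unsh C m (ShO C Y))"
proof (induction m)
  case (Suc m)
  have "unsh C (Suc (Suc m)) Y = unsh C (Suc m) Y \<cdot> UnA C ((UnA C ^^ m) (cinv C (Unit C ((ShO C ^^ Suc m) Y))))"
    by simp
  also have "\<dots> = (cinv C (Unit C Y) \<cdot> UnA C (unsh C m (ShO C Y))) \<cdot> UnA C ((UnA C ^^ m) (cinv C (Unit C ((ShO C ^^ Suc m) Y))))"
    by (simp only: Suc.IH)
  also have "\<dots> = cinv C (Unit C Y) \<cdot> UnA C (unsh C (Suc m) (ShO C Y))"
    using assms by (simp add: funpow_swap1)
  finally show ?case .
qed (use assms in simp)

lemma transl_Suc':
  assumes "f \<in> Mor C" "Tgt C f = (ShO C ^^ Suc m) Y" "Y \<in> Ob C"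
  shows "transl C (Suc m) Y f = transl C 1 Y (transl C m (ShO C Y) f)"
  using assms unsh_Suc[OF assms(3), of m] by (simp add: transl_def funpow_swap1 del: unsh.simps(2)) simp

lemma transl_natural:
  assumes "g \<in> Mor C" "f \<in> Mor C" "Tgt C f = (ShO C ^^ m) (Src C g)"
  shows "transl C m (Tgt C g) ((ShA C ^^ m) g \<cdot> f) = g \<cdot> transl C m (Src C g) f"
  using assms
proof (induction m arbitrary: f)
  case (Suc m)
  let ?h = "(ShA C ^^ m) g"
  have "transl C (Suc m) (Tgt C g) ((ShA C ^^ Suc m) g \<cdot> f) = transl C m (Tgt C g) (transl C 1 (Tgt C ?h) (ShA C ?h \<cdot> f))"
    using Suc.prems by (subst transl_Suc) auto
  also have "transl C 1 (Tgt C ?h) (ShA C ?h \<cdot> f) = ?h \<cdot> transl C 1 (Src C ?h) f"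
    using Suc.prems Unit_cinv_natural'[of ?h "UnA C f" "Tgt C ?h"] by (simp add: transl_def)
  also have "transl C m (Tgt C g) (?h \<cdot> transl C 1 (Src C ?h) f) = g \<cdot> transl C (Suc m) (Src C g) f"
    using Suc.prems by (subst Suc.IH) (auto simp: transl_Suc[of f m "Src C g"])
  finally show ?case .
qed (simp add: transl_def)

lemma transl_map:
  assumes "g \<in> Mor C"
  shows "transl C m (Tgt C g) ((ShA C ^^ m) g) = g \<cdot> unsh C m (Src C g)"
  using transl_natural[of g "Idn C ((ShO C ^^ m) (Src C g))" m] assms by (simp add: transl_def)

text \<open>The canonical isomorphism \<open>X(-m)(m) \<cong> X\<close>.\<close>

primrec counit :: "nat \<Rightarrow> 'o \<Rightarrow> 'a" where
  "counit 0 X = Idn C X"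
| "counit (Suc m) X = Counit C X \<cdot> ShA C (counit m (UnO C X))"

lemma counit_simps [simp]:
  assumes "X \<in> Ob C"
  shows "counit m X \<in> Mor C" "Src C (counit m X) = (ShO C ^^ m) ((UnO C ^^ m) X)" "Tgt C (counit m X) = X"
    "is_iso C (counit m X)"
proof -
  have "counit m X \<in> Hom C ((ShO C ^^ m) ((UnO C ^^ m) X)) X \<and> is_iso C (counit m X)"
    using assms
  proof (induction m arbitrary: X)
    case (Suc m)
    then show ?case by (auto simp: funpow_swap1 intro!: iso_Cmp Sh.map_iso)
  qed simp
  then show "counit m X \<in> Mor C" "Src C (counit m X) = (ShO C ^^ m) ((UnO C ^^ m) X)" "Tgt C (counit m X) = X"
    "is_iso C (counit m X)" by auto
qed

text \<open>The triangle identity turns the shifted inverse unit into a counit, and naturality moves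
  that counit past \<open>f\<close>. Shifting a translate back thus returns the arrow up to a
  canonical isomorphism.\<close>

lemma Sh_transl_1:
  assumes "f \<in> Mor C" "Tgt C f = ShO C Y" "Y \<in> Ob C"
  shows "ShA C (transl C 1 Y f) = f \<cdot> Counit C (Src C f)"
proof -
  have "Counit C (ShO C Y) \<cdot> ShA C (Unit C Y) = Idn C (ShO C Y)" using assms(3) by (rule triangle_Sh)
  then have "cinv C (ShA C (Unit C Y)) = Counit C (ShO C Y)"
    using assms(3) iso_cancel_right[of "ShA C (Unit C Y)" "Counit C (ShO C Y)" "cinv C (ShA C (Unit C Y))"] by simp
  moreover have "Counit C (ShO C Y) \<cdot> ShA C (UnA C f) = f \<cdot> Counit C (Src C f)"
    using Counit_natural[of f "Src C f" "ShO C Y"] assms by simp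
  ultimately show ?thesis using assms by (simp add: transl_def Sh.map_cinv)
qed

lemma Sh_transl:
  assumes "f \<in> Mor C" "Tgt C f = (ShO C ^^ m) Y" "Y \<in> Ob C"
  shows "(ShA C ^^ m) (transl C m Y f) = f \<cdot> counit m (Src C f)"
  using assms
proof (induction m arbitrary: f)
  case (Suc m)
  let ?t = "transl C 1 ((ShO C ^^ m) Y) f"
  have t: "?t \<in> Mor C" "Src C ?t = UnO C (Src C f)" "Tgt C ?t = (ShO C ^^ m) Y" using Suc.prems by simp_all
  have "(ShA C ^^ Suc m) (transl C (Suc m) Y f) = ShA C ((ShA C ^^ m) (transl C m Y ?t))"
    by (subst transl_Suc) (use Suc.prems in auto)
  also have "\<dots> = ShA C (?t \<cdot> counit m (UnO C (Src C f)))" using Suc.IH[of ?t] t Suc.prems(3) by simp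
  also have "\<dots> = f \<cdot> counit (Suc m) (Src C f)"
    using t Sh_transl_1[of f "(ShO C ^^ m) Y"] Suc.prems by simp
  finally show ?case .
qed (simp add: transl_def)

lemma epow_Hom:
  assumes "e \<in> Hom C V (ShO C V)"
  shows "epow C e n \<in> Hom C V ((ShO C ^^ n) V)"
  using assms by (induction n) (auto simp: funpow_swap1)

lemma epow_add:
  assumes "e \<in> Hom C V (ShO C V)"
  shows "epow C e (m + n) = (ShA C ^^ n) (epow C e m) \<cdot> epow C e n"
proof (induction n)
  case 0
  then show ?case using epow_Hom[OF assms, of m] assms by auto
next
  case (Suc n)
  then show ?case using epow_Hom[OF assms, of m] epow_Hom[OF assms, of n] assms by (auto simp: funpow_swap1)
qed

lemma epow_Suc':
  assumes "e \<in> Hom C V (ShO C V)"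
  shows "epow C e (Suc n) = (ShA C ^^ n) e \<cdot> epow C e n"
  using epow_add[OF assms, of 1 n] assms by auto

text \<open>Read in \<open>C\<close>, the recursion in the opposite category attaches the new factor
  at the target end, so e^(n+1) is unfolded there by \<open>epow_Suc'\<close>. Through this lemma
  the powers of the opposite arrow become accessible.\<close>

lemma epow_oparr:
  assumes e: "e \<in> Hom C V (ShO C V)"
  shows "epow (opcat C) (oparr C e) n = transl C n V (epow C e n)"
proof (induction n)
  case 0
  have V: "V \<in> Ob C" "Src C e = V" "e \<in> Mor C" "Tgt C e = ShO C V" using e by auto
  then show ?case by (auto simp: oparr_def transl_def)
next
  case (Suc n)
  have V: "V \<in> Ob C" "Src C e = V" "e \<in> Mor C" "Tgt C e = ShO C V" using e by auto
  have en: "epow C e n \<in> Mor C" "Src C (epow C e n) = V" "Tgt C (epow C e n) = (ShO C ^^ n) V"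
    using epow_Hom[OF e, of n] by auto
  have "transl C (Suc n) V (epow C e (Suc n)) = transl C (Suc n) V ((ShA C ^^ n) e) \<cdot> (UnA C ^^ Suc n) (epow C e n)"
    unfolding epow_Suc'[OF e] using V en by (intro transl_Cmp) (auto simp: funpow_swap1)
  also have "transl C (Suc n) V ((ShA C ^^ n) e) = transl C 1 V (e \<cdot> unsh C n V)"
    using V transl_map[of e n] by (subst transl_Suc') (auto simp: funpow_swap1)
  also have "\<dots> \<cdot> (UnA C ^^ Suc n) (epow C e n) = transl C 1 V e \<cdot> UnA C (transl C n V (epow C e n))"
    using V en by (simp add: transl_def)
  also have "\<dots> = epow (opcat C) (oparr C e) (Suc n)" using Suc.IH V by (simp add: oparr_def)
  finally show ?case by simp
qed

end

text \<open>Unit and counit change places, and with them the two triangle identities. The new shift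
  \<open>UnA\<close> is exact because it is an equivalence both in \<open>C\<close> and in its
  opposite, and equivalences preserve kernels.\<close>

lemma shifted_abelian_opcat:
  assumes "shifted_abelian C"
  shows "shifted_abelian (opcat C)"
proof -
  interpret shifted_abelian C by fact
  interpret op: linear_abelian "opcat C" by (rule linear_abelian_opcat) unfold_locales
  interpret Unop: linear_equivalence "opcat C" "UnO C" "UnA C" by (rule linear_equivalence_opcat) unfold_locales
  interpret Shop: linear_equivalence "opcat C" "ShO C" "ShA C" by (rule linear_equivalence_opcat) unfold_locales
  show ?thesis
  proof
    show "is_exact (opcat C) (ShA (opcat C))"
      using Un.map_ker Unop.map_ker by (auto simp: is_exact_def)
  qed (use Unop.endo Unop.additive Shop.endo triangle_Sh triangle_Un in \<open>auto simp: Counit_natural Unit_natural\<close>)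
qed

section \<open>Split filtrations\<close>

context linear_category
begin

lemma dsum_iso:
  assumes D: "is_dsum C I X D \<iota> \<pi>" and D': "is_dsum C I X D' \<iota>' \<pi>'"
  shows "is_iso C (hsum C D D' (\<lambda>i. \<iota>' i \<cdot> \<pi> i) I)"
proof -
  note [simp] = dsum_simps[OF D] dsum_simps[OF D']
  have 1: "hsum C D D' (\<lambda>i. \<iota>' i \<cdot> \<pi> i) I \<in> Hom C D D'" "\<And>i. i \<in> I \<Longrightarrow> hsum C D D' (\<lambda>i. \<iota>' i \<cdot> \<pi> i) I \<cdot> \<iota> i = \<iota>' i"
    using dsum_copair[OF D, of D' \<iota>'] by auto
  have 2: "hsum C D' D (\<lambda>i. \<iota> i \<cdot> \<pi>' i) I \<in> Hom C D' D" "\<And>i. i \<in> I \<Longrightarrow> hsum C D' D (\<lambda>i. \<iota> i \<cdot> \<pi>' i) I \<cdot> \<iota>' i = \<iota> i"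
    using dsum_copair[OF D', of D \<iota>] by auto
  let ?f = "hsum C D D' (\<lambda>i. \<iota>' i \<cdot> \<pi> i) I" and ?g = "hsum C D' D (\<lambda>i. \<iota> i \<cdot> \<pi>' i) I"
  have "?g \<cdot> ?f = Idn C D"
    by (rule dsum_cancel_op[OF D]) (use 1 2 in simp_all)
  moreover have "?f \<cdot> ?g = Idn C D'"
    by (rule dsum_cancel_op[OF D']) (use 1 2 in simp_all)
  ultimately show ?thesis using 1(1) 2(1) by (intro isoI[of ?g]) auto
qed

end

context additive_functor
begin

lemma map_dsum:
  assumes D: "is_dsum C I X D \<iota> \<pi>"
  shows "is_dsum C I (\<lambda>i. FO (X i)) (FO D) (\<lambda>i. FA (\<iota> i)) (\<lambda>i. FA (\<pi> i))"
proof -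
  note [simp] = dsum_simps(1-9)[OF D]
  have 1: "FA (\<pi> j) \<cdot> FA (\<iota> i) = FA (\<pi> j \<cdot> \<iota> i)" if "i \<in> I" "j \<in> I" for i j using that by simp
  have "hsum C (FO D) (FO D) (\<lambda>i. FA (\<iota> i) \<cdot> FA (\<pi> i)) I = hsum C (FO D) (FO D) (\<lambda>i. FA (\<iota> i \<cdot> \<pi> i)) I"
    by (intro hsum_cong) auto
  also have "\<dots> = FA (hsum C D D (\<lambda>i. \<iota> i \<cdot> \<pi> i) I)" by (intro map_hsum[symmetric]) auto
  also have "\<dots> = Idn C (FO D)" using dsum_simps(12)[OF D] by simp
  finally show ?thesis using dsum_simps(10,11)[OF D] unfolding is_dsum_def by (auto simp: 1 simp del: map_simps(6))
qed

end

context linear_equivalence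
begin

text \<open>A fully faithful functor reflects direct sums, also when the images of the given
  injections agree with known ones only up to isomorphisms \<open>c i\<close>. It brings the
  Lefschetz decomposition, obtained in shifted objects, back to V_q.\<close>

lemma reflect_dsum:
  assumes S: "is_dsum C I Y (FO D) \<alpha> \<beta>" and D: "D \<in> Ob C"
    and x: "\<And>i. i \<in> I \<Longrightarrow> x i \<in> Hom C (X i) D"
    and c: "\<And>i. i \<in> I \<Longrightarrow> is_iso C (c i) \<and> c i \<in> Hom C (FO (X i)) (Y i) \<and> FA (x i) = \<alpha> i \<cdot> c i"
  shows "\<exists>\<pi>. is_dsum C I X D x \<pi>"
proof -
  note [simp] = dsum_simps[OF S]
  have [simp]: "x i \<in> Mor C" "Src C (x i) = X i" "Tgt C (x i) = D" if "i \<in> I" for i using x[OF that] by auto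
  have X [simp]: "X i \<in> Ob C" if "i \<in> I" for i using Ob_simps(1)[of "x i"] that by simp
  have [simp]: "is_iso C (c i)" "c i \<in> Mor C" "Src C (c i) = FO (X i)" "Tgt C (c i) = Y i" "FA (x i) = \<alpha> i \<cdot> c i" if "i \<in> I" for i
    using c[OF that] by auto
  have "\<exists>p. p \<in> Hom C D (X i) \<and> FA p = cinv C (c i) \<cdot> \<beta> i" if "i \<in> I" for i
    using full[of "cinv C (c i) \<cdot> \<beta> i" D "X i"] that D by auto
  then obtain \<pi> where \<pi>: "\<And>i. i \<in> I \<Longrightarrow> \<pi> i \<in> Hom C D (X i) \<and> FA (\<pi> i) = cinv C (c i) \<cdot> \<beta> i"
    by metis
  have [simp]: "\<pi> i \<in> Mor C" "Src C (\<pi> i) = D" "Tgt C (\<pi> i) = X i" "FA (\<pi> i) = cinv C (c i) \<cdot> \<beta> i" if "i \<in> I" for i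
    using \<pi>[OF that] by auto
  have 1: "\<beta> j \<cdot> (\<alpha> i \<cdot> c i) = (if i = j then c i else Zero C (FO (X i)) (Y j))" if "i \<in> I" "j \<in> I" for i j
    using that by (cases "i = j") (simp_all add: Cmp_reassoc[OF dsum_simps(10)[OF S]] Cmp_reassoc[OF dsum_simps(11)[OF S]])
  have "is_dsum C I X D x \<pi>"
  proof (rule dsumI)
    fix i assume i: "i \<in> I"
    have "FA (\<pi> i \<cdot> x i) = FA (Idn C (X i))" using i 1[of i i] by simp
    then show "\<pi> i \<cdot> x i = Idn C (X i)" by (rule faithful) (use i in auto)
    fix j assume j: "j \<in> I" "i \<noteq> j"
    have "FA (\<pi> j \<cdot> x i) = FA (Zero C (X i) (X j))" using i j 1[of i j] by simp
    then show "\<pi> j \<cdot> x i = Zero C (X i) (X j)" by (rule faithful) (use i j in auto)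
  next
    fix t assume t: "t \<in> Mor C" "Tgt C t = D" "\<And>i. i \<in> I \<Longrightarrow> \<pi> i \<cdot> t = Zero C (Src C t) (X i)"
    have "FA t = Zero C (FO (Src C t)) (FO D)"
    proof (rule dsum_cancel[OF S])
      fix i assume i: "i \<in> I"
      have "FA (\<pi> i \<cdot> t) = Zero C (FO (Src C t)) (FO (X i))" using t i by simp
      then have "cinv C (c i) \<cdot> (\<beta> i \<cdot> FA t) = cinv C (c i) \<cdot> Zero C (FO (Src C t)) (Y i)" using t(1,2) i by simp
      then have "\<beta> i \<cdot> FA t = Zero C (FO (Src C t)) (Y i)"
        by (rule iso_cancel_left[rotated]) (use i t(1,2) in \<open>auto intro: iso_cinv\<close>)
      then show "\<beta> i \<cdot> FA t = \<beta> i \<cdot> Zero C (FO (Src C t)) (FO D)" using i t(1) D by simp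
    qed (use t D in auto)
    then have "FA t = FA (Zero C (Src C t) D)" using t(1) D by simp
    then show "t = Zero C (Src C t) D" by (rule faithful) (use t D in auto)
  qed (use D in auto)
  then show ?thesis by blast
qed

end

text \<open>The components of a good splitting: \<open>Quo_eq\<close> expresses goodness, while
  \<open>I_factors\<close> and \<open>P_Fil\<close> express compatibility with the filtration and
  are exchanged by duality. The filtration axioms are recovered in \<open>V_filt\<close>, so the
  same locale serves for \<open>V\<close>, for \<open>K\<close> and in the opposite
  category.\<close>

locale split_filt = shifted_abelian C for C :: "('o, 'a) shcat" (structure) +
  fixes r :: nat and V :: "'a filt" and I P :: "int \<Rightarrow> 'a"
  assumes Fil_mono [simp]: "is_mono C (Fil V p)"
    and Fil_Tgt [simp]: "Tgt C (Fil V p) = Und C V"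
    and I_Hom: "I p \<in> Hom C (Grd C V p) (Und C V)"
    and P_Hom: "P p \<in> Hom C (Und C V) (Grd C V p)"
    and P_I: "P q \<cdot> I p = (if p = q then Idn C (Grd C V p) else Zero C (Grd C V p) (Grd C V q))"
    and I_P_sum: "hsum C (Und C V) (Und C V) (\<lambda>p. I p \<cdot> P p) {- int r..int r} = Idn C (Und C V)"
    and Grd_zero: "p \<notin> {- int r..int r} \<Longrightarrow> is_zero_ob C (Grd C V p)"
    and I_factors: "j \<le> p \<Longrightarrow> factors C (Fil V p) (I j)"
    and P_Fil: "p < j \<Longrightarrow> P j \<cdot> Fil V p = Zero C (Src C (Fil V p)) (Grd C V j)"
    and Quo_eq: "Quo V p = P p \<cdot> Fil V p"
    and Inj_Hom: "Inj V p \<in> Hom C (Grd C V p) (Sum C V)"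
    and Prj_Hom: "Prj V p \<in> Hom C (Sum C V) (Grd C V p)"
    and star_dsum: "is_dsum C {- int r..int r} (Grd C V) (Sum C V) (Inj V) (Prj V)"
begin

definition \<Phi> :: 'a where
  "\<Phi> = hsum C (Sum C V) (Und C V) (\<lambda>p. I p \<cdot> Prj V p) {- int r..int r}"

lemma IP_simps [simp]: "I p \<in> Mor C" "Src C (I p) = Grd C V p" "Tgt C (I p) = Und C V"
    "P p \<in> Mor C" "Tgt C (P p) = Grd C V p" "Src C (P p) = Und C V"
    "Inj V p \<in> Mor C" "Src C (Inj V p) = Grd C V p" "Tgt C (Inj V p) = Sum C V"
    "Prj V p \<in> Mor C" "Src C (Prj V p) = Sum C V" "Tgt C (Prj V p) = Grd C V p"
    "Fil V p \<in> Mor C"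
  using I_Hom P_Hom Inj_Hom Prj_Hom mono_Mor[of "Fil V p"] by auto

lemma Ob_V [simp]: "Grd C V p \<in> Ob C" "Und C V \<in> Ob C" "Sum C V \<in> Ob C"
  using Ob_simps(1)[of "I p"] Ob_simps(2)[of "I p"] Ob_simps(1)[of "Prj V p"] by simp_all

lemma Quo_simps [simp]: "Quo V p \<in> Mor C" "Src C (Quo V p) = Src C (Fil V p)" "Tgt C (Quo V p) = Grd C V p"
  by (simp_all add: Quo_eq)

lemma P_I_Cmp: "\<lbrakk>f \<in> Mor C; Tgt C f = Grd C V p\<rbrakk> \<Longrightarrow>
    P q \<cdot> (I p \<cdot> f) = (if p = q then f else Zero C (Src C f) (Grd C V q))"
  by (subst Cmp_reassoc[OF P_I]) auto

lemma dsum_V: "is_dsum C {- int r..int r} (Grd C V) (Und C V) I P"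
  unfolding is_dsum_def using P_I I_P_sum by auto

lemma dsum_shV: "is_dsum C {- int r..int r} (\<lambda>p. shO C m (Grd C V p)) (shO C m (Und C V))
    (\<lambda>p. shA C m (I p)) (\<lambda>p. shA C m (P p))"
  by (rule Shm.map_dsum[OF dsum_V])

lemma Grd_zero_arrow:
  assumes "f \<in> Mor C" "p \<notin> {- int r..int r}"
  shows "Src C f = shO C m (Grd C V p) \<Longrightarrow> f = Zero C (shO C m (Grd C V p)) (Tgt C f)"
    "Tgt C f = shO C m (Grd C V p) \<Longrightarrow> f = Zero C (Src C f) (shO C m (Grd C V p))"
  using zero_ob_Zero[OF Shm.map_zero_ob[OF Grd_zero[OF assms(2)]] assms(1)] by auto

lemma shV_cancel:
  assumes "\<And>p. shA C m (P p) \<cdot> f = shA C m (P p) \<cdot> g" "f \<in> Mor C" "g \<in> Mor C" "Src C f = Src C g"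
    "Tgt C f = shO C m (Und C V)" "Tgt C g = shO C m (Und C V)"
  shows "f = g"
  by (rule dsum_cancel[OF dsum_shV]) (use assms in auto)

lemma V_cancel_op:
  assumes "\<And>p. f \<cdot> I p = g \<cdot> I p" "f \<in> Mor C" "g \<in> Mor C" "Tgt C f = Tgt C g"
    "Src C f = Und C V" "Src C g = Und C V"
  shows "f = g"
  by (rule dsum_cancel_op[OF dsum_V]) (use assms in auto)

lemma sh_mono [simp]: "is_mono C (shA C m (Fil V p))"
  by (rule Shm.map_mono) simp

lemma sh_I_factors: "j \<le> p \<Longrightarrow> factors C (shA C m (Fil V p)) (shA C m (I j))"
proof -
  assume j: "j \<le> p"
  note [simp] = fac_simps[OF Fil_mono I_factors[OF j]]
  have "shA C m (Fil V p) \<cdot> shA C m (fac C (Fil V p) (I j)) = shA C m (Fil V p \<cdot> fac C (Fil V p) (I j))"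
    by (subst Shm.map_simps(6)) simp_all
  then show ?thesis by (intro factorsI[of _ "shA C m (fac C (Fil V p) (I j))"]) simp_all
qed

text \<open>The part I_j P_j u factors through F_p for j <= p and vanishes for j > p, so the sum u
  of these parts factors. The zero arrow in \<open>?x\<close> is a default for the vanishing
  parts.\<close>

lemma factors_shFil:
  assumes u: "u \<in> Mor C" "Tgt C u = shO C m (Und C V)"
    and z: "\<And>j. p < j \<Longrightarrow> shA C m (P j) \<cdot> u = Zero C (Src C u) (shO C m (Grd C V j))"
  shows "factors C (shA C m (Fil V p)) u"
proof -
  let ?F = "shA C m (Fil V p)"
  let ?x = "\<lambda>j. if j \<le> p then fac C ?F (shA C m (I j)) else Zero C (shO C m (Grd C V j)) (Src C ?F)"
  have x: "?x j \<in> Hom C (shO C m (Grd C V j)) (Src C ?F)" for j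
    using fac_simps[OF sh_mono sh_I_factors[of j p m]] by auto
  define w where "w = hsum C (Src C u) (Src C ?F) (\<lambda>j. ?x j \<cdot> (shA C m (P j) \<cdot> u)) {- int r..int r}"
  have w: "w \<in> Hom C (Src C u) (Src C ?F)" unfolding w_def using x u by (intro hsum_Hom) auto
  have Fx: "?F \<cdot> (?x j \<cdot> (shA C m (P j) \<cdot> u)) = shA C m (I j) \<cdot> (shA C m (P j) \<cdot> u)" for j
  proof (cases "j \<le> p")
    case True
    then show ?thesis using u sh_I_factors[of j p m] by (simp add: Cmp_reassoc[OF fac_simps(4)[OF sh_mono]])
  next
    case False
    then show ?thesis using u z[of j] by simp
  qed
  have "?F \<cdot> w = hsum C (Src C u) (shO C m (Und C V)) (\<lambda>j. ?F \<cdot> (?x j \<cdot> (shA C m (P j) \<cdot> u))) {- int r..int r}"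
    unfolding w_def using x u by (subst Cmp_hsum(1)) auto
  also have "\<dots> = hsum C (Src C u) (shO C m (Und C V)) (\<lambda>j. (shA C m (I j) \<cdot> shA C m (P j)) \<cdot> u) {- int r..int r}"
    using u by (intro hsum_cong) (simp_all only: Fx, simp_all)
  also have "\<dots> = hsum C (shO C m (Und C V)) (shO C m (Und C V)) (\<lambda>j. shA C m (I j) \<cdot> shA C m (P j)) {- int r..int r} \<cdot> u"
    using u by (subst Cmp_hsum(2)) auto
  also have "\<dots> = u" using dsum_simps(12)[OF dsum_shV[of m]] u by simp
  finally have "?F \<cdot> w = u" .
  then show ?thesis using w by (intro factorsI[of _ w]) auto
qed

lemma factors_Fil:
  assumes "u \<in> Mor C" "Tgt C u = Und C V" "\<And>j. p < j \<Longrightarrow> P j \<cdot> u = Zero C (Src C u) (Grd C V j)"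
  shows "factors C (Fil V p) u"
  using factors_shFil[of u 0 p] assms by simp

lemma P_factors_Fil:
  assumes "factors C (Fil V p) u" "p < j"
  shows "P j \<cdot> u = Zero C (Src C u) (Grd C V j)"
proof -
  note [simp] = fac_simps[OF Fil_mono assms(1)]
  have "P j \<cdot> u = P j \<cdot> (Fil V p \<cdot> fac C (Fil V p) u)" by simp
  also have "\<dots> = (P j \<cdot> Fil V p) \<cdot> fac C (Fil V p) u" by (simp del: fac_simps(4))
  also have "\<dots> = Zero C (Src C u) (Grd C V j)" unfolding P_Fil[OF assms(2)] by simp
  finally show ?thesis .
qed

lemma Quo_section:
  "fac C (Fil V p) (I p) \<in> Hom C (Grd C V p) (Src C (Fil V p))" "Quo V p \<cdot> fac C (Fil V p) (I p) = Idn C (Grd C V p)"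
  using fac_simps[OF Fil_mono I_factors[of p p]] P_I[of p p] by (simp_all add: Quo_eq)

lemma Quo_epi: "is_epi C (Quo V p)"
  using Quo_section[of p] by (intro retract_epi[of _ "fac C (Fil V p) (I p)"]) auto

lemma Fil_factors: "p \<le> q \<Longrightarrow> factors C (Fil V q) (Fil V p)"
  using P_Fil[of p] by (intro factors_Fil) auto

text \<open>Let j be the section of \<open>Quo V p\<close> given by I_p. The complement 1 - j
  \<open>Quo V p\<close> has no component in degree p or above, so it factors through F_{p-1} and is
  killed by \<open>h\<close>.\<close>

lemma Quo_factor_through:
  assumes "h \<in> Mor C" "Src C h = Src C (Fil V p)"
    "h \<cdot> fac C (Fil V p) (Fil V (p - 1)) = Zero C (Src C (Fil V (p - 1))) (Tgt C h)"
  shows "h = (h \<cdot> fac C (Fil V p) (I p)) \<cdot> Quo V p"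
proof -
  let ?j = "fac C (Fil V p) (I p)" and ?i = "fac C (Fil V p) (Fil V (p - 1))"
  note [simp] = fac_simps[OF Fil_mono I_factors[of p p, simplified]] fac_simps[OF Fil_mono Fil_factors[of "p - 1" p, simplified]]
  define d where "d = Add C (Idn C (Src C (Fil V p))) (Scal C (-1) (?j \<cdot> Quo V p))"
  have d: "d \<in> Hom C (Src C (Fil V p)) (Src C (Fil V p))" unfolding d_def by simp
  have Fd: "Fil V p \<cdot> d = Add C (Fil V p) (Scal C (-1) (I p \<cdot> (P p \<cdot> Fil V p)))"
    unfolding d_def by (simp add: Cmp_Add Quo_eq Cmp_reassoc[OF fac_simps(4)[OF Fil_mono I_factors]])
  have fd: "factors C (Fil V (p - 1)) (Fil V p \<cdot> d)"
  proof (rule factors_Fil)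
    fix j assume "p - 1 < j"
    then show "P j \<cdot> (Fil V p \<cdot> d) = Zero C (Src C (Fil V p \<cdot> d)) (Grd C V j)"
      unfolding Fd by (cases "j = p") (simp_all add: Cmp_Add P_I_Cmp P_Fil Add_cancel)
  qed (use d in auto)
  note [simp] = fac_simps[OF Fil_mono fd]
  have "d = ?i \<cdot> fac C (Fil V (p - 1)) (Fil V p \<cdot> d)"
    by (rule mono_cancel[OF Fil_mono[of p]]) (use d in \<open>simp_all add: Cmp_reassoc[OF fac_simps(4)[OF Fil_mono Fil_factors]]\<close>)
  then have "h \<cdot> d = (h \<cdot> ?i) \<cdot> fac C (Fil V (p - 1)) (Fil V p \<cdot> d)" using assms(1,2) d by simp
  also have "\<dots> = Zero C (Src C (Fil V p)) (Tgt C h)" unfolding assms(3) using assms(1) d by simp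
  finally have "Add C h (Scal C (-1) (h \<cdot> (?j \<cdot> Quo V p))) = Zero C (Src C h) (Tgt C h)"
    unfolding d_def using assms(1,2) by (simp add: Cmp_Add)
  then have "h = h \<cdot> (?j \<cdot> Quo V p)" by (rule Sub_eq_Zero[rotated 4]) (use assms(1,2) in auto)
  then show ?thesis using assms(1,2) by simp
qed

lemma Quo_Fil: "Quo V p \<cdot> fac C (Fil V p) (Fil V (p - 1)) = Zero C (Src C (Fil V (p - 1))) (Grd C V p)"
  using P_Fil[of "p - 1" p] fac_simps[OF Fil_mono Fil_factors[of "p - 1" p, simplified]] by (simp add: Quo_eq)

lemma Quo_coker: "is_coker C (fac C (Fil V p) (Fil V (p - 1))) (Quo V p)"
  unfolding is_coker_def
proof (intro conjI ballI impI)
  let ?j = "fac C (Fil V p) (I p)" and ?i = "fac C (Fil V p) (Fil V (p - 1))"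
  note i = fac_simps[OF Fil_mono Fil_factors[of "p - 1" p, simplified]]
  show "?i \<in> Mor C" "Quo V p \<in> Mor C" "Src C (Quo V p) = Tgt C ?i" using i by auto
  show "Quo V p \<cdot> ?i = Zero C (Src C ?i) (Tgt C (Quo V p))" using Quo_Fil i by simp
  fix h assume h: "h \<in> Mor C" "Src C h = Tgt C ?i \<and> h \<cdot> ?i = Zero C (Src C ?i) (Tgt C h)"
  then have eq: "(h \<cdot> ?j) \<cdot> Quo V p = h" using i by (intro Quo_factor_through[symmetric]) auto
  show "\<exists>!u. u \<in> Hom C (Tgt C (Quo V p)) (Tgt C h) \<and> u \<cdot> Quo V p = h"
  proof (rule ex1I[of _ "h \<cdot> ?j"])
    show "h \<cdot> ?j \<in> Hom C (Tgt C (Quo V p)) (Tgt C h) \<and> (h \<cdot> ?j) \<cdot> Quo V p = h"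
      using eq h i Quo_section[of p] by (auto simp del: assoc)
    fix u assume u: "u \<in> Hom C (Tgt C (Quo V p)) (Tgt C h) \<and> u \<cdot> Quo V p = h"
    then have "u \<cdot> Quo V p = (h \<cdot> ?j) \<cdot> Quo V p" using eq by simp
    then show "u = h \<cdot> ?j" by (rule epi_cancel[OF Quo_epi]) (use u h i Quo_section[of p] in auto)
  qed
qed

lemma Fil_zero: "p < - int r \<Longrightarrow> is_zero_ob C (Src C (Fil V p))"
proof -
  assume p: "p < - int r"
  have "Fil V p = Zero C (Src C (Fil V p)) (Und C V)"
    by (rule dsum_cancel[OF dsum_V]) (use p in \<open>auto simp: P_Fil\<close>)
  then have "Fil V p \<cdot> Idn C (Src C (Fil V p)) = Fil V p \<cdot> Zero C (Src C (Fil V p)) (Src C (Fil V p))"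
    by (metis Cmp_Idn(1) Cmp_Zero(1) Ob_simps(1) IP_simps(13) Fil_Tgt)
  then have "Idn C (Src C (Fil V p)) = Zero C (Src C (Fil V p)) (Src C (Fil V p))"
    by (rule mono_cancel[OF Fil_mono]) auto
  then show ?thesis by (intro zero_obI) auto
qed

lemma Fil_iso: "int r \<le> p \<Longrightarrow> is_iso C (Fil V p)"
proof -
  assume p: "int r \<le> p"
  have f: "factors C (Fil V p) (Idn C (Und C V))"
  proof (rule factors_Fil)
    fix j assume "p < j"
    then show "P j \<cdot> Idn C (Und C V) = Zero C (Src C (Idn C (Und C V))) (Grd C V j)"
      using Grd_zero_arrow(2)[of "P j" j 0] p by simp
  qed auto
  let ?h = "fac C (Fil V p) (Idn C (Und C V))"
  note [simp] = fac_simps[OF Fil_mono f]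
  have "?h \<cdot> Fil V p = Idn C (Src C (Fil V p))"
    by (rule mono_cancel[OF Fil_mono[of p]]) (simp_all add: Cmp_reassoc[OF fac_simps(4)[OF Fil_mono f]])
  then show ?thesis by (intro isoI[of ?h]) auto
qed

lemma V_filt: "is_filt C r V"
  unfolding is_filt_def is_filtration_def
proof (intro conjI allI)
  show "\<exists>a. \<forall>p\<le>a. is_zero_ob C (Src C (Fil V p))"
    using Fil_zero by (intro exI[of _ "- int r - 1"]) auto
  show "\<exists>b. \<forall>p\<ge>b. is_iso C (Fil V p)" using Fil_iso by blast
qed (use Fil_factors Quo_coker Grd_zero star_dsum in auto)

lemma \<Phi>_simps [simp]: "\<Phi> \<in> Mor C" "Src C \<Phi> = Sum C V" "Tgt C \<Phi> = Und C V"
  using dsum_copair(1)[OF star_dsum, of "Und C V" I] by (auto simp: \<Phi>_def)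

lemma \<Phi>_Inj: "\<Phi> \<cdot> Inj V p = I p"
proof (cases "p \<in> {- int r..int r}")
  case True
  then show ?thesis unfolding \<Phi>_def by (intro dsum_copair(2)[OF star_dsum]) auto
next
  case False
  then show ?thesis using Grd_zero_arrow(1)[of "I p" p 0] Grd_zero_arrow(1)[of "Inj V p" p 0] by simp
qed

lemma \<Phi>_iso: "is_iso C \<Phi>"
  unfolding \<Phi>_def by (rule dsum_iso[OF star_dsum dsum_V])

lemma \<Phi>_eqI:
  assumes "\<phi> \<in> Hom C (Sum C V) (Und C V)" "\<And>p. p \<in> {- int r..int r} \<Longrightarrow> \<phi> \<cdot> Inj V p = I p"
  shows "\<phi> = \<Phi>"
  by (rule dsum_cancel_op[OF star_dsum]) (use assms \<Phi>_Inj in auto)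

end

section \<open>Splittings for which the arrow is graded\<close>

locale graded_split = split_filt C r V I P for C :: "('o, 'a) shcat" (structure) and r V I P +
  fixes e :: 'a
  assumes e_Hom: "e \<in> Hom C (Und C V) (ShO C (Und C V))"
    and e_graded: "q \<noteq> p + 2 \<Longrightarrow> ShA C (P q) \<cdot> (e \<cdot> I p) = Zero C (Grd C V p) (ShO C (Grd C V q))"
begin

definition e_comp :: "nat \<Rightarrow> int \<Rightarrow> int \<Rightarrow> 'a" where
  "e_comp k p q = shA C k (P q) \<cdot> (epow C e k \<cdot> I p)"

lemma e_simps [simp]: "e \<in> Mor C" "Src C e = Und C V" "Tgt C e = ShO C (Und C V)"
    "epow C e k \<in> Mor C" "Src C (epow C e k) = Und C V" "Tgt C (epow C e k) = shO C k (Und C V)"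
  using e_Hom epow_Hom[OF e_Hom, of k] by auto

lemma e_comp_simps [simp]: "e_comp k p q \<in> Mor C" "Src C (e_comp k p q) = Grd C V p" "Tgt C (e_comp k p q) = shO C k (Grd C V q)"
  by (simp_all add: e_comp_def)

lemma sh_P_I: "\<lbrakk>f \<in> Mor C; Tgt C f = shO C m (Grd C V p)\<rbrakk> \<Longrightarrow>
    shA C m (P q) \<cdot> (shA C m (I p) \<cdot> f) = (if p = q then f else Zero C (Src C f) (shO C m (Grd C V q)))"
proof -
  assume f: "f \<in> Mor C" "Tgt C f = shO C m (Grd C V p)"
  have "shA C m (P q) \<cdot> shA C m (I p) = shA C m (P q \<cdot> I p)" by simp
  then show ?thesis using f by (subst Cmp_reassoc) (auto simp: P_I)
qed

text \<open>Stated under the vanishing hypothesis because the induction for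
  \<open>e_comp_zero\<close> applies it at stage k, before vanishing is known for all k.\<close>

lemma epow_I_aux:
  assumes "\<And>q. q \<noteq> p + 2 * int k \<Longrightarrow> e_comp k p q = Zero C (Grd C V p) (shO C k (Grd C V q))"
  shows "epow C e k \<cdot> I p = shA C k (I (p + 2 * int k)) \<cdot> e_comp k p (p + 2 * int k)"
proof (rule shV_cancel)
  fix q
  show "shA C k (P q) \<cdot> (epow C e k \<cdot> I p) = shA C k (P q) \<cdot> (shA C k (I (p + 2 * int k)) \<cdot> e_comp k p (p + 2 * int k))"
    using assms[of q] by (simp add: sh_P_I, simp add: e_comp_def)
qed auto

lemma e_comp_zero: "q \<noteq> p + 2 * int k \<Longrightarrow> e_comp k p q = Zero C (Grd C V p) (shO C k (Grd C V q))"
proof (induction k arbitrary: q)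
  case 0
  then show ?case by (simp add: e_comp_def P_I)
next
  case (Suc k)
  let ?q = "p + 2 * int k"
  have *: "shA C k (ShA C (P q)) \<cdot> (shA C k e \<cdot> shA C k (I ?q)) = shA C k (ShA C (P q) \<cdot> (e \<cdot> I ?q))"
    by simp
  have "e_comp (Suc k) p q = shA C k (ShA C (P q)) \<cdot> (shA C k e \<cdot> (epow C e k \<cdot> I p))"
    unfolding e_comp_def epow_Suc'[OF e_Hom] by (simp add: funpow_swap1)
  also have "\<dots> = (shA C k (ShA C (P q)) \<cdot> (shA C k e \<cdot> shA C k (I ?q))) \<cdot> e_comp k p ?q"
    using epow_I_aux[OF Suc.IH] by simp
  also have "\<dots> = Zero C (Grd C V p) (shO C (Suc k) (Grd C V q))"
    unfolding * using e_graded[of q ?q] Suc.prems by (simp add: funpow_swap1)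
  finally show ?case .
qed

lemma epow_I: "q = p + 2 * int k \<Longrightarrow> epow C e k \<cdot> I p = shA C k (I q) \<cdot> e_comp k p q"
  using epow_I_aux[OF e_comp_zero] by simp

lemma epow_I_Cmp: "\<lbrakk>q = p + 2 * int k; f \<in> Mor C; Tgt C f = Grd C V p\<rbrakk> \<Longrightarrow>
    epow C e k \<cdot> (I p \<cdot> f) = shA C k (I q) \<cdot> (e_comp k p q \<cdot> f)"
  by (subst Cmp_reassoc[OF epow_I]) auto

lemma P_epow: "p = q - 2 * int k \<Longrightarrow> shA C k (P q) \<cdot> epow C e k = e_comp k p q \<cdot> P p"
proof (rule V_cancel_op)
  fix j assume p: "p = q - 2 * int k"
  have "(shA C k (P q) \<cdot> epow C e k) \<cdot> I j = e_comp k j q" by (simp add: e_comp_def)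
  also have "\<dots> = (e_comp k p q \<cdot> P p) \<cdot> I j" using e_comp_zero[of q j k] p by (auto simp: P_I)
  finally show "(shA C k (P q) \<cdot> epow C e k) \<cdot> I j = (e_comp k p q \<cdot> P p) \<cdot> I j" .
qed auto

lemma P_epow_Cmp: "\<lbrakk>p = q - 2 * int k; f \<in> Mor C; Tgt C f = Und C V\<rbrakk> \<Longrightarrow>
    shA C k (P q) \<cdot> (epow C e k \<cdot> f) = e_comp k p q \<cdot> (P p \<cdot> f)"
  by (subst Cmp_reassoc[OF P_epow]) auto

lemma e_comp_add:
  assumes "q = p + 2 * int l"
  shows "shA C l (e_comp k q s) \<cdot> e_comp l p q = e_comp (k + l) p s"
proof -
  have "e_comp (k + l) p s = shA C l (shA C k (P s)) \<cdot> (shA C l (epow C e k) \<cdot> (epow C e l \<cdot> I p))"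
    unfolding e_comp_def epow_add[OF e_Hom] unfolding add.commute[of k l] by (simp add: funpow_add)
  also have "\<dots> = shA C l (e_comp k q s) \<cdot> e_comp l p q"
    using assms by (subst epow_I[OF assms]) (simp add: e_comp_def[of k])
  finally show ?thesis by simp
qed

lemma e_comp_0: "e_comp 0 p p = Idn C (Grd C V p)"
  by (simp add: e_comp_def P_I)

text \<open>Keeping \<open>q\<close> apart from p + 2k allows target degrees in other forms, such as
  k for p = -k.\<close>

lemma gre_eq: "q = p + 2 * int k \<Longrightarrow> gre C V e k p = e_comp k p q"
proof -
  assume q: "q = p + 2 * int k"
  then have q': "p = q - 2 * int k" by simp
  have f: "factors C (shA C k (Fil V q)) (epow C e k \<cdot> Fil V p)"
  proof (rule factors_shFil)
    fix j assume "q < j"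
    then show "shA C k (P j) \<cdot> (epow C e k \<cdot> Fil V p) = Zero C (Src C (epow C e k \<cdot> Fil V p)) (shO C k (Grd C V j))"
      using q by (subst P_epow_Cmp[OF refl]) (auto simp: P_Fil)
  qed auto
  note [simp] = fac_simps[OF sh_mono f]
  have eq: "shA C k (Quo V q) \<cdot> fac C (shA C k (Fil V q)) (epow C e k \<cdot> Fil V p) = e_comp k p q \<cdot> Quo V p"
    by (simp add: Quo_eq P_epow_Cmp[OF q'])
  show ?thesis unfolding gre_def gr_def q[symmetric] eq
  proof (rule the_equality)
    fix g assume g: "g \<in> Hom C (Grd C V p) (shO C k (Grd C V q)) \<and> g \<cdot> Quo V p = e_comp k p q \<cdot> Quo V p"
    show "g = e_comp k p q" by (rule epi_cancel[OF Quo_epi[of p]]) (use g in auto)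
  qed simp
qed

text \<open>Replacing \<open>V\<^sub>p\<close> by \<open>V\<^sub>p(\<lfloor>(p + s)/2\<rfloor>)\<close> turns the components \<open>V\<^sub>p \<rightarrow> V\<^sub>p\<^sub>+\<^sub>2(1)\<close> of \<open>e\<close> into arrows without
  a shift. The truncation by \<open>nat\<close> only affects zero objects when \<open>s \<ge> r\<close>.\<close>

definition frame_shift :: "int \<Rightarrow> int \<Rightarrow> nat" where "frame_shift s p = nat ((p + s) div 2)"

definition frame_ob :: "int \<Rightarrow> int \<Rightarrow> 'o" where "frame_ob s p = shO C (frame_shift s p) (Grd C V p)"

definition frame_pow :: "int \<Rightarrow> int \<Rightarrow> int \<Rightarrow> 'a" where
  "frame_pow s p q = (if p \<le> q \<and> even (q - p) \<and> 0 \<le> p + s then shA C (frame_shift s p) (e_comp (nat ((q - p) div 2)) p q)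
     else Zero C (frame_ob s p) (frame_ob s q))"

text \<open>The condition on p + s keeps clear of the truncation by \<open>nat\<close>; rounding in
  \<open>div\<close> is harmless, as both degrees have the same parity.\<close>

lemma frame_shift_add: "\<lbrakk>0 \<le> p + s; q = p + 2 * int k\<rbrakk> \<Longrightarrow> frame_shift s q = frame_shift s p + k"
  unfolding frame_shift_def by (simp add: nat_add_distrib add.commute add.left_commute)

lemma frame_ob_Ob [simp]: "frame_ob s p \<in> Ob C"
  by (simp add: frame_ob_def)

lemma frame_pow_eq: "\<lbrakk>0 \<le> p + s; q = p + 2 * int k\<rbrakk> \<Longrightarrow> frame_pow s p q = shA C (frame_shift s p) (e_comp k p q)"
  by (simp add: frame_pow_def)

lemma frame_ob_add: "\<lbrakk>0 \<le> p + s; q = p + 2 * int k\<rbrakk> \<Longrightarrow> frame_ob s q = shO C (frame_shift s p) (shO C k (Grd C V q))"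
  using frame_shift_add[of p s q k] by (simp add: frame_ob_def funpow_add)

lemma even_diffE:
  assumes "p \<le> (q :: int)" "even (q - p)"
  obtains k where "q = p + 2 * int k"
proof
  show "q = p + 2 * int (nat ((q - p) div 2))" using assms by auto
qed

lemma frame_pow_Hom: "frame_pow s p q \<in> Hom C (frame_ob s p) (frame_ob s q)"
proof (cases "p \<le> q \<and> even (q - p) \<and> 0 \<le> p + s")
  case True
  then obtain k where k: "q = p + 2 * int k" using even_diffE[of p q] by blast
  show ?thesis using True frame_ob_add[OF _ k] frame_pow_eq[OF _ k] by (simp add: frame_ob_def)
next
  case False
  then show ?thesis by (auto simp: frame_pow_def)
qed

lemma frame_ob_zero: "p \<notin> {- int r..int r} \<Longrightarrow> is_zero_ob C (frame_ob s p)"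
  unfolding frame_ob_def by (intro Shm.map_zero_ob Grd_zero)

end

section \<open>The primitive decomposition of the graded pieces\<close>

locale lefschetz_split = graded_split C r V I P e for C :: "('o, 'a) shcat" (structure) and r V I P e +
  assumes e_comp_iso: "is_iso C (e_comp k (- int k) (int k))"
begin

text \<open>Because s >= r, the degrees with a truncated exponent carry zero objects, where all laws
  are trivial. The kernels \<open>k i\<close> are given for i <= r; beyond that the frame objects
  are zero and the identity is a kernel of the zero arrow.\<close>

lemma frame_lefschetz:
  assumes s: "int r \<le> s" and k: "\<And>i. i \<le> r \<Longrightarrow> is_ker C (e_comp (i + 1) (- int i) (int i + 2)) (k i)"
  shows "lefschetz C (frame_ob s) (frame_pow s) r (\<lambda>i. if i \<le> r then shA C (frame_shift s (- int i)) (k i) else Idn C (frame_ob s (- int i)))"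
proof
  show "frame_ob s p \<in> Ob C" for p by simp
  show "frame_pow s p q \<in> Hom C (frame_ob s p) (frame_ob s q)" for p q by (rule frame_pow_Hom)
  show "is_zero_ob C (frame_ob s p)" if "\<bar>p\<bar> > int r" for p using that by (intro frame_ob_zero) auto
  have sz: "is_zero_ob C (frame_ob s p)" if "p + s < 0" for p using that s by (intro frame_ob_zero) auto
  show "frame_pow s p p = Idn C (frame_ob s p)" for p
  proof (cases "p + s < 0")
    case True
    then show ?thesis using zero_ob_Idn[OF sz[OF True]] by (simp add: frame_pow_def)
  next
    case False
    then show ?thesis by (simp add: frame_pow_def e_comp_0 frame_ob_def)
  qed
  show "frame_pow s q q' \<cdot> frame_pow s p q = frame_pow s p q'" if pq: "p \<le> q" "q \<le> q'" "even (q - p)" "even (q' - q)" for p q q'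
  proof (cases "p + s < 0")
    case True
    then show ?thesis using frame_pow_Hom[of s p q] frame_pow_Hom[of s q q'] by (simp add: frame_pow_def[of s p])
  next
    case False
    obtain l where l: "q = p + 2 * int l" using pq even_diffE[of p q] by blast
    obtain m where m: "q' = q + 2 * int m" using pq even_diffE[of q q'] by blast
    have q': "q' = p + 2 * int (m + l)" using l m by simp
    have 0: "0 \<le> p + s" "0 \<le> q + s" using False pq by auto
    have "frame_pow s q q' \<cdot> frame_pow s p q = shA C (frame_shift s p) (shA C l (e_comp m q q')) \<cdot> shA C (frame_shift s p) (e_comp l p q)"
      by (simp add: frame_pow_eq[OF 0(1) l] frame_pow_eq[OF 0(2) m] frame_shift_add[OF 0(1) l] funpow_add)
    also have "\<dots> = shA C (frame_shift s p) (shA C l (e_comp m q q') \<cdot> e_comp l p q)" by simp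
    also have "\<dots> = frame_pow s p q'" unfolding e_comp_add[OF l] frame_pow_eq[OF 0(1) q'] ..
    finally show ?thesis .
  qed
  show "is_iso C (frame_pow s (- int i) (int i))" for i
  proof (cases "- int i + s < 0")
    case True
    then have "int i \<notin> {- int r..int r}" using s by auto
    then show ?thesis using sz[OF True] frame_ob_zero[of "int i" s] frame_pow_Hom[of s "- int i" "int i"] by (intro zero_ob_iso) auto
  next
    case False
    then have "frame_pow s (- int i) (int i) = shA C (frame_shift s (- int i)) (e_comp i (- int i) (int i))" by (intro frame_pow_eq) auto
    then show ?thesis using e_comp_iso[of i] by (simp add: Shm.map_iso)
  qed
  show "is_ker C (frame_pow s (- int i) (int i + 2)) (if i \<le> r then shA C (frame_shift s (- int i)) (k i) else Idn C (frame_ob s (- int i)))" for i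
  proof (cases "i \<le> r")
    case True
    then have "frame_pow s (- int i) (int i + 2) = shA C (frame_shift s (- int i)) (e_comp (i + 1) (- int i) (int i + 2))"
      using s by (intro frame_pow_eq) auto
    then show ?thesis using True k[OF True] by (auto intro: Shm.map_ker)
  next
    case False
    let ?X = "frame_ob s (- int i)" and ?R = "frame_pow s (- int i) (int i + 2)"
    have R: "?R \<in> Mor C" "Src C ?R = ?X" "Tgt C ?R = frame_ob s (int i + 2)" using frame_pow_Hom[of s "- int i" "int i + 2"] by auto
    have "is_zero_ob C ?X" using False by (intro frame_ob_zero) auto
    then have "?R = Zero C ?X (Tgt C ?R)" using R by (intro zero_ob_Zero) auto
    then have "is_ker C ?R (Idn C ?X)"
      using R by (intro kerI monoI) (auto intro!: factorsI[of "Idn C ?X"])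
    then show ?thesis using False by simp
  qed
qed

definition lift :: "(nat \<Rightarrow> 'a) \<Rightarrow> nat \<Rightarrow> nat \<Rightarrow> 'a" where
  "lift k i j = transl C j (Grd C V (- int i + 2 * int j)) (e_comp j (- int i) (- int i + 2 * int j) \<cdot> k i)"

text \<open>This is the degree q part of the isomorphism \<epsilon>. Its summands P_{-i}(-j) carry
  negative shifts, which do not occur in the frame. After shifting up, each \<open>lift\<close>
  becomes the embedding \<open>L.a i q\<close> composed with a shifted counit, and
  \<open>reflect_dsum\<close> applies.\<close>

lemma prim_dsum:
  assumes k: "\<And>i. i \<le> r \<Longrightarrow> is_ker C (e_comp (i + 1) (- int i) (int i + 2)) (k i)"
    and q: "q \<in> {- int r..int r}"
  shows "\<exists>\<pi>. is_dsum C {i. i \<le> r \<and> \<bar>q\<bar> \<le> int i \<and> even (q - int i)} (\<lambda>i. (UnO C ^^ nat ((int i + q) div 2)) (Src C (k i)))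
    (Grd C V q) (\<lambda>i. lift k i (nat ((int i + q) div 2))) \<pi>"
proof -
  define kX where "kX = (\<lambda>i. if i \<le> r then shA C (frame_shift (int r) (- int i)) (k i) else Idn C (frame_ob (int r) (- int i)))"
  interpret L: lefschetz C "frame_ob (int r)" "frame_pow (int r)" r kX
    unfolding kX_def using k by (intro frame_lefschetz) auto
  have idx: "{i. i \<le> r \<and> \<bar>q\<bar> \<le> int i \<and> even (q - int i)} = L.idx q" by (simp add: L.idx_def)
  let ?j = "\<lambda>i. nat ((int i + q) div 2)"
  have S: "is_dsum C (L.idx q) (\<lambda>i. Src C (kX i)) (shO C (frame_shift (int r) q) (Grd C V q)) (\<lambda>i. L.a i q) (\<lambda>i. L.b i q)"
    using L.lefschetz_dsum[of q] by (simp add: frame_ob_def)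
  show ?thesis unfolding idx
  proof (rule Shm.reflect_dsum[OF S])
    fix i assume i: "i \<in> L.idx q"
    then have ir: "i \<le> r" "\<bar>q\<bar> \<le> int i" "even (q - int i)" by (auto simp: L.idx_def)
    have j: "- int i + 2 * int (?j i) = q" using ir by auto
    note [simp] = ker_simps(2,3)[OF k[OF ir(1)], simplified]
    let ?g = "e_comp (?j i) (- int i) q \<cdot> k i"
    have lift: "lift k i (?j i) = transl C (?j i) (Grd C V q) ?g" unfolding lift_def j ..
    show "lift k i (?j i) \<in> Hom C ((UnO C ^^ ?j i) (Src C (k i))) (Grd C V q)"
      unfolding lift by simp
    let ?n = "frame_shift (int r) (- int i)" and ?c = "shA C (frame_shift (int r) (- int i)) (counit (?j i) (Src C (k i)))"
    have n0: "0 \<le> - int i + int r" using ir by simp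
    have nq: "frame_shift (int r) q = ?n + ?j i" using frame_shift_add[OF n0 j[symmetric]] .
    have "shA C (frame_shift (int r) q) (lift k i (?j i)) = shA C ?n (shA C (?j i) (lift k i (?j i)))"
      unfolding nq by (simp add: funpow_add)
    also have "\<dots> = shA C ?n (?g \<cdot> counit (?j i) (Src C (k i)))"
      unfolding lift by (subst Sh_transl) simp_all
    also have "\<dots> = L.a i q \<cdot> ?c"
      unfolding L.a_def unfolding kX_def using ir by (simp add: frame_pow_eq[OF n0 j[symmetric]])
    finally have "shA C (frame_shift (int r) q) (lift k i (?j i)) = L.a i q \<cdot> ?c" .
    moreover have "is_iso C ?c" by (intro Shm.map_iso) simp
    moreover have "?c \<in> Hom C (shO C (frame_shift (int r) q) ((UnO C ^^ ?j i) (Src C (k i)))) (Src C (kX i))"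
      unfolding nq kX_def using ir by (simp add: funpow_add)
    ultimately show "is_iso C ?c \<and> ?c \<in> Hom C (shO C (frame_shift (int r) q) ((UnO C ^^ ?j i) (Src C (k i)))) (Src C (kX i)) \<and>
      shA C (frame_shift (int r) q) (lift k i (?j i)) = L.a i q \<cdot> ?c" by blast
  qed simp
qed

text \<open>A pair (i, j) amounts to a degree q = -i + 2j together with an index i in the
  decomposition of V_q; distinct pairs of the same degree differ in i.\<close>

lemma prim_total_dsum:
  assumes k: "\<And>i. i \<le> r \<Longrightarrow> is_ker C (e_comp (i + 1) (- int i) (int i + 2)) (k i)"
  shows "\<exists>\<pi>. is_dsum C {(i, j). j \<le> i \<and> i \<le> r} (\<lambda>(i, j). (UnO C ^^ j) (Src C (k i))) (Sum C V)
    (\<lambda>(i, j). Inj V (- int i + 2 * int j) \<cdot> lift k i j) \<pi>"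
proof -
  define idx where "idx q = {i. i \<le> r \<and> \<bar>q\<bar> \<le> int i \<and> even (q - int i)}" for q
  define jj where "jj q i = nat ((int i + q) div 2)" for q i
  have "\<exists>B. \<forall>q. q \<in> {- int r..int r} \<longrightarrow> is_dsum C (idx q) (\<lambda>i. (UnO C ^^ jj q i) (Src C (k i)))
    (Grd C V q) (\<lambda>i. lift k i (jj q i)) (B q)"
    unfolding idx_def jj_def by (intro choice) (use prim_dsum[OF k] in blast)
  then obtain B where B: "\<And>q. q \<in> {- int r..int r} \<Longrightarrow> is_dsum C (idx q) (\<lambda>i. (UnO C ^^ jj q i) (Src C (k i)))
    (Grd C V q) (\<lambda>i. lift k i (jj q i)) (B q)" by blast
  let ?J = "{(i, j). j \<le> i \<and> i \<le> r}"
  let ?q = "\<lambda>i j. - int i + 2 * int j :: int"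
  have J: "?q i j \<in> {- int r..int r}" "i \<in> idx (?q i j)" "jj (?q i j) i = j" if "j \<le> i" "i \<le> r" for i j
    using that by (auto simp: idx_def jj_def)
  have BJ: "lift k i j \<in> Hom C ((UnO C ^^ j) (Src C (k i))) (Grd C V (?q i j))"
    "B (?q i j) i \<in> Hom C (Grd C V (?q i j)) ((UnO C ^^ j) (Src C (k i)))"
    "B (?q i j) i \<cdot> lift k i j = Idn C ((UnO C ^^ j) (Src C (k i)))" if "j \<le> i" "i \<le> r" for i j
    using dsum_simps(4-10)[OF B[OF J(1)[OF that]] J(2)[OF that], unfolded J(3)[OF that]] by simp_all
  note [simp] = BJ[unfolded Hom_iff] BJ[simplified] ker_simps(2)[OF k]
  have B0: "B (?q i j) i' \<cdot> lift k i j = Zero C ((UnO C ^^ j) (Src C (k i))) ((UnO C ^^ j') (Src C (k i')))"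
    if "j \<le> i" "i \<le> r" "j' \<le> i'" "i' \<le> r" "?q i' j' = ?q i j" "i \<noteq> i'" for i j i' j'
    using dsum_simps(11)[OF B[OF J(1)[OF that(1,2)]], of i i'] J(2,3)[OF that(1,2)] J(2,3)[OF that(3,4)] that(5,6) by simp
  have "is_dsum C ?J (\<lambda>(i, j). (UnO C ^^ j) (Src C (k i))) (Sum C V)
    (\<lambda>(i, j). Inj V (?q i j) \<cdot> lift k i j) (\<lambda>(i, j). B (?q i j) i \<cdot> Prj V (?q i j))"
  proof (rule dsumI)
    show "finite ?J" by (rule finite_subset[of _ "{..r} \<times> {..r}"]) auto
    fix x assume x: "x \<in> ?J"
    obtain i j where ij: "x = (i, j)" "j \<le> i" "i \<le> r" using x by auto
    note PI = dsum_simps(10,11)[OF star_dsum]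
    show "(case x of (i, j) \<Rightarrow> B (?q i j) i \<cdot> Prj V (?q i j)) \<cdot> (case x of (i, j) \<Rightarrow> Inj V (?q i j) \<cdot> lift k i j) =
      Idn C (case x of (i, j) \<Rightarrow> (UnO C ^^ j) (Src C (k i)))"
      using ij J(1)[OF ij(2,3)] by (simp add: Cmp_reassoc[OF PI(1)])
    fix y assume y: "y \<in> ?J" "x \<noteq> y"
    obtain i' j' where ij': "y = (i', j')" "j' \<le> i'" "i' \<le> r" using y by auto
    show "(case y of (i, j) \<Rightarrow> B (?q i j) i \<cdot> Prj V (?q i j)) \<cdot> (case x of (i, j) \<Rightarrow> Inj V (?q i j) \<cdot> lift k i j) =
      Zero C (case x of (i, j) \<Rightarrow> (UnO C ^^ j) (Src C (k i))) (case y of (i, j) \<Rightarrow> (UnO C ^^ j) (Src C (k i)))"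
    proof (cases "?q i j = ?q i' j'")
      case True
      then have "i \<noteq> i'" using y ij ij' by auto
      then have "B (?q i j) i' \<cdot> lift k i j = Zero C ((UnO C ^^ j) (Src C (k i))) ((UnO C ^^ j') (Src C (k i')))"
        using B0[OF ij(2,3) ij'(2,3)] True by simp
      then have "B (?q i' j') i' \<cdot> (Prj V (?q i' j') \<cdot> (Inj V (?q i j) \<cdot> lift k i j)) = Zero C ((UnO C ^^ j) (Src C (k i))) ((UnO C ^^ j') (Src C (k i')))"
        unfolding True[symmetric] using ij J(1)[OF ij(2,3)] by (simp add: Cmp_reassoc[OF PI(1)])
      then show ?thesis using ij ij' by simp
    next
      case False
      then show ?thesis using ij ij' J(1)[OF ij(2,3)] J(1)[OF ij'(2,3)] by (simp add: Cmp_reassoc[OF PI(2)])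
    qed
  next
    fix t assume t: "t \<in> Mor C" "Tgt C t = Sum C V"
      "\<And>x. x \<in> ?J \<Longrightarrow> (case x of (i, j) \<Rightarrow> B (?q i j) i \<cdot> Prj V (?q i j)) \<cdot> t = Zero C (Src C t) (case x of (i, j) \<Rightarrow> (UnO C ^^ j) (Src C (k i)))"
    show "t = Zero C (Src C t) (Sum C V)"
    proof (rule dsum_cancel[OF star_dsum])
      fix q assume q: "q \<in> {- int r..int r}"
      have "Prj V q \<cdot> t = Zero C (Src C t) (Grd C V q)"
      proof (rule dsum_cancel[OF B[OF q]])
        fix i assume i: "i \<in> idx q"
        then have ij: "jj q i \<le> i" "i \<le> r" "?q i (jj q i) = q" by (auto simp: idx_def jj_def)
        have "(B q i \<cdot> Prj V q) \<cdot> t = Zero C (Src C t) ((UnO C ^^ jj q i) (Src C (k i)))"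
          using t(3)[of "(i, jj q i)"] ij by auto
        then show "B q i \<cdot> (Prj V q \<cdot> t) = B q i \<cdot> Zero C (Src C t) (Grd C V q)"
          using t(1,2) BJ[OF ij(1,2)] ij(3) by simp
      qed (use t(1,2) in auto)
      then show "Prj V q \<cdot> t = Prj V q \<cdot> Zero C (Src C t) (Sum C V)" using t(1,2) by simp
    qed (use t(1,2) in auto)
  qed auto
  then show ?thesis by blast
qed

end

section \<open>The first isomorphism \<open>\<phi>\<^sub>I\<close>\<close>

lemma (in linear_category) coker_desc:
  assumes "is_coker C f c" "h \<in> Mor C" "Src C h = Tgt C f" "h \<cdot> f = Zero C (Src C f) (Tgt C h)"
  shows "\<exists>u. u \<in> Hom C (Tgt C c) (Tgt C h) \<and> u \<cdot> c = h"
  using assms unfolding is_coker_def by (metis (no_types, lifting))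

context split_filt
begin

lemma coker_simps [simp]: "coker C (Fil V p) \<in> Mor C" "Src C (coker C (Fil V p)) = Und C V"
    "coker C (Fil V p) \<cdot> Fil V p = Zero C (Src C (Fil V p)) (Tgt C (coker C (Fil V p)))"
  using coker_is_coker[of "Fil V p"] by (auto simp: is_coker_def)

lemma Fil_ker: "is_ker C (coker C (Fil V p)) (Fil V p)"
  by (rule mono_ker_coker) (simp_all add: coker_is_coker)

lemma coker_factors:
  assumes "factors C (Fil V p) u"
  shows "coker C (Fil V p) \<cdot> u = Zero C (Src C u) (Tgt C (coker C (Fil V p)))"
proof -
  note f = fac_simps[OF Fil_mono assms]
  have "coker C (Fil V p) \<cdot> (Fil V p \<cdot> fac C (Fil V p) u) = Zero C (Src C u) (Tgt C (coker C (Fil V p)))"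
    using f(1-3) by (subst Cmp_reassoc[OF coker_simps(3)]) simp_all
  then show ?thesis using f(4) by simp
qed

lemma P_through_coker:
  assumes "p < j"
  obtains u where "u \<in> Hom C (Tgt C (coker C (Fil V p))) (Grd C V j)" "u \<cdot> coker C (Fil V p) = P j"
proof -
  show ?thesis
    using coker_desc[OF coker_is_coker[of "Fil V p"], of "P j"] P_Fil[OF assms] that by auto
qed

lemma gr_incl_eq: "gr_incl C V p = coker C (Fil V (p - 1)) \<cdot> I p"
  unfolding gr_incl_def
proof (rule the_equality)
  let ?c = "coker C (Fil V (p - 1))"
  note f = fac_simps[OF Fil_mono Fil_factors[of "p - 1" p, simplified]]
  note i = fac_simps[OF Fil_mono I_factors[of p p, simplified]]
  have "(?c \<cdot> Fil V p) \<cdot> fac C (Fil V p) (Fil V (p - 1)) = Zero C (Src C (Fil V (p - 1))) (Tgt C ?c)"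
    using f by simp
  then have "?c \<cdot> Fil V p = ((?c \<cdot> Fil V p) \<cdot> fac C (Fil V p) (I p)) \<cdot> Quo V p"
    by (intro Quo_factor_through) simp_all
  also have "(?c \<cdot> Fil V p) \<cdot> fac C (Fil V p) (I p) = ?c \<cdot> I p" using i by simp
  finally have eq: "(?c \<cdot> I p) \<cdot> Quo V p = ?c \<cdot> Fil V p" by simp
  then show "?c \<cdot> I p \<in> Hom C (Grd C V p) (Tgt C ?c) \<and> (?c \<cdot> I p) \<cdot> Quo V p = ?c \<cdot> Fil V p" by simp
  fix g assume g: "g \<in> Hom C (Grd C V p) (Tgt C ?c) \<and> g \<cdot> Quo V p = ?c \<cdot> Fil V p"
  then have "g \<cdot> Quo V p = (?c \<cdot> I p) \<cdot> Quo V p" using eq by simp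
  then show "g = ?c \<cdot> I p" by (rule epi_cancel[OF Quo_epi]) (use g in auto)
qed

text \<open>F_{-r-1} is zero, so the quotient map from F_{-r} is invertible, with the section given
  by I_{-r} as its inverse.\<close>

lemma first_incl_eq: "first_incl C r V = I (- int r)"
proof -
  let ?F = "Fil V (- int r)" and ?Q = "Quo V (- int r)"
  note f = fac_simps[OF Fil_mono Fil_factors[of "- int r - 1" "- int r", simplified]]
  note i = fac_simps[OF Fil_mono I_factors[of "- int r" "- int r", simplified]]
  have "fac C ?F (Fil V (- int r - 1)) = Zero C (Src C (Fil V (- int r - 1))) (Src C ?F)"
    using zero_ob_Zero(1)[OF Fil_zero[of "- int r - 1"] f(1)] f by simp
  then have "Idn C (Src C ?F) = (Idn C (Src C ?F) \<cdot> fac C ?F (I (- int r))) \<cdot> ?Q"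
    by (intro Quo_factor_through) simp_all
  then have "fac C ?F (I (- int r)) \<cdot> ?Q = Idn C (Src C ?F)" using i by simp
  then have "cinv C ?Q = fac C ?F (I (- int r))" using Quo_section[of "- int r"] i by (intro cinv_eqI) auto
  then show ?thesis using i by (simp add: first_incl_def)
qed

lemma last_quot_eq: "last_quot C r V = P (int r)"
  using Fil_iso[of "int r"] by (simp add: last_quot_def Quo_eq)

end

context lefschetz_split
begin

text \<open>e^r carries I_{-r} to the shifted I_r after e_r, so the inverse of e_r cancels;
  naturality of \<open>unsh\<close> removes the shift.\<close>

lemma last_incl_eq: "last_incl C r V e = I (int r)"
proof -
  have "epow C e r \<cdot> (I (- int r) \<cdot> cinv C (e_comp r (- int r) (int r))) = shA C r (I (int r))"
    using e_comp_iso[of r] epow_I_Cmp[of "int r" "- int r" r "cinv C (e_comp r (- int r) (int r))"] by simp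
  then have "last_incl C r V e = transl C r (Und C V) (shA C r (I (int r))) \<cdot> cinv C (unsh C r (Grd C V (int r)))"
    unfolding last_incl_def first_incl_eq using gre_eq[of "int r" "- int r" r] e_comp_iso[of r] by simp
  then show ?thesis using transl_map[of "I (int r)" r] by simp
qed

lemma prim_ker: "is_ker C (gre C V e (i + 1) (- int i)) k \<Longrightarrow> is_ker C (e_comp (i + 1) (- int i) (int i + 2)) k"
  by (subst gre_eq[symmetric]) auto

text \<open>The components of \<open>f\<close> are determined one by one. Above -i they vanish by
  the filtration, and in degree -i the lifting condition fixes them. In degree -s with s > i, the
  condition for s has V_s(s)-component e^s P_{-s} f, and e^s is invertible on V_{-s}.\<close>

lemma is_prim_lift_iff:
  assumes k: "is_ker C (e_comp (i + 1) (- int i) (int i + 2)) k"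
  shows "is_prim_lift C V e i k f \<longleftrightarrow> f = I (- int i) \<cdot> k"
proof
  note [simp] = ker_simps(2,3)[OF k, simplified]
  assume L: "is_prim_lift C V e i k f"
  then have f: "f \<in> Mor C" "Src C f = Src C k" "Tgt C f = Und C V" "factors C (Fil V (- int i)) f"
    "coker C (Fil V (- int i - 1)) \<cdot> f = gr_incl C V (- int i) \<cdot> k"
    and fs: "\<And>s. s > i \<Longrightarrow> shA C s (coker C (Fil V (int s - 1))) \<cdot> (epow C e s \<cdot> f) =
      Zero C (Src C k) (shO C s (Tgt C (coker C (Fil V (int s - 1)))))"
    unfolding is_prim_lift_def by auto
  have eq: "P q \<cdot> f = P q \<cdot> (I (- int i) \<cdot> k)" for q
  proof -
    consider "q > - int i" | "q = - int i" | "q < - int i" by linarith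
    then show ?thesis
    proof cases
      case 1
      then show ?thesis using P_factors_Fil[OF f(4) 1] f by (simp add: P_I_Cmp)
    next
      case 2
      then have "- int i - 1 < q" by simp
      then obtain u where u: "u \<in> Hom C (Tgt C (coker C (Fil V (- int i - 1)))) (Grd C V q)" "u \<cdot> coker C (Fil V (- int i - 1)) = P q"
        by (rule P_through_coker)
      have "P q \<cdot> f = u \<cdot> (coker C (Fil V (- int i - 1)) \<cdot> f)" unfolding u(2)[symmetric] using u(1) f by simp
      also have "\<dots> = (u \<cdot> coker C (Fil V (- int i - 1))) \<cdot> (I (- int i) \<cdot> k)"
        unfolding f(5) gr_incl_eq using u(1) by simp
      finally show ?thesis unfolding u(2) .
    next
      case 3
      define s where "s = nat (- q)"
      have q: "q = - int s" and s: "s > i" using 3 by (auto simp: s_def)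
      have "int s - 1 < int s" by simp
      then obtain u where u: "u \<in> Hom C (Tgt C (coker C (Fil V (int s - 1)))) (Grd C V (int s))" "u \<cdot> coker C (Fil V (int s - 1)) = P (int s)"
        by (rule P_through_coker)
      have "e_comp s (- int s) (int s) \<cdot> (P (- int s) \<cdot> f) = shA C s (u \<cdot> coker C (Fil V (int s - 1))) \<cdot> (epow C e s \<cdot> f)"
        unfolding u(2) using f by (intro P_epow_Cmp[symmetric]) auto
      also have "\<dots> = shA C s u \<cdot> (shA C s (coker C (Fil V (int s - 1))) \<cdot> (epow C e s \<cdot> f))"
        using u(1) f by simp
      also have "\<dots> = e_comp s (- int s) (int s) \<cdot> Zero C (Src C k) (Grd C V q)"
        unfolding fs[OF s] using u(1) q by simp
      finally have "P q \<cdot> f = Zero C (Src C k) (Grd C V q)"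
        unfolding q by (rule iso_cancel_left[OF e_comp_iso]) (use f q in auto)
      then show ?thesis using 3 f by (simp add: P_I_Cmp)
    qed
  qed
  show "f = I (- int i) \<cdot> k" by (rule shV_cancel[where m = 0]) (use f eq in auto)
next
  note [simp] = ker_simps(2,3)[OF k, simplified]
  assume f: "f = I (- int i) \<cdot> k"
  have "shA C s (coker C (Fil V (int s - 1))) \<cdot> (epow C e s \<cdot> (I (- int i) \<cdot> k)) =
      Zero C (Src C k) (shO C s (Tgt C (coker C (Fil V (int s - 1)))))" if s: "s > i" for s
  proof -
    \<comment> \<open>As s > i, the power e^s contains e^(i+1), which kills \<open>k\<close>; so e^s
      f vanishes outright and not merely modulo F_{s-1}.\<close>
    obtain l where l: "s = (i + 1) + l" using s by (metis Suc_eq_plus1 Suc_leI le_Suc_ex)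
    have l': "s = l + (i + 1)" using l by simp
    let ?q = "- int i + 2 * int s"
    have "e_comp s (- int i) ?q = shA C (i + 1) (e_comp l (int i + 2) ?q) \<cdot> e_comp (i + 1) (- int i) (int i + 2)"
      unfolding l' by (rule e_comp_add[symmetric]) simp
    then have "e_comp s (- int i) ?q \<cdot> k = shA C (i + 1) (e_comp l (int i + 2) ?q) \<cdot> (e_comp (i + 1) (- int i) (int i + 2) \<cdot> k)"
      by (simp add: funpow_swap1)
    also have "\<dots> = Zero C (Src C k) (shO C s (Grd C V ?q))"
      unfolding ker_simps(4)[OF k] by (simp add: l funpow_add funpow_swap1)
    finally have "epow C e s \<cdot> (I (- int i) \<cdot> k) = Zero C (Src C k) (shO C s (Und C V))"
      by (subst epow_I_Cmp[OF refl]) simp_all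
    then show ?thesis by simp
  qed
  moreover have "factors C (Fil V (- int i)) (I (- int i) \<cdot> k)"
    by (rule factors_Fil) (auto simp: P_I_Cmp)
  ultimately show "is_prim_lift C V e i k f"
    unfolding is_prim_lift_def f gr_incl_eq by simp
qed

text \<open>Since f_i is I_{-i} on the primitive part, \<sigma> equals \<Phi> \<epsilon> summand by
  summand, and \<epsilon> is invertible by the primitive decomposition. The choice of kernels and of
  the sum therefore drops out.\<close>

lemma is_phi_I_iff: "is_phi_I C r V e \<phi> \<longleftrightarrow> \<phi> = \<Phi>"
proof -
  let ?J = "{(i, j). j \<le> i \<and> i \<le> r}"
  have main: "hsum C D (Und C V) (\<lambda>(i, j). transl C j (Und C V) (epow C e j \<cdot> f i) \<cdot> \<pi>D (i, j)) ?J \<cdot>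
      cinv C (hsum C D (Sum C V) (\<lambda>(i, j). Inj V (- int i + 2 * int j) \<cdot>
               transl C j (Grd C V (- int i + 2 * int j)) (gre C V e j (- int i) \<cdot> k i) \<cdot> \<pi>D (i, j)) ?J) = \<Phi>"
    if k: "\<And>i. i \<le> r \<Longrightarrow> is_ker C (e_comp (i + 1) (- int i) (int i + 2)) (k i)"
      and f: "\<And>i. i \<le> r \<Longrightarrow> f i = I (- int i) \<cdot> k i"
      and D: "is_dsum C ?J (\<lambda>(i, j). (UnO C ^^ j) (Src C (k i))) D \<iota>D \<pi>D" for k f D \<iota>D \<pi>D
  proof -
    let ?q = "\<lambda>i j. - int i + 2 * int j :: int"
    note [simp] = ker_simps(2,3)[OF k, simplified]
    obtain \<pi> where S: "is_dsum C ?J (\<lambda>(i, j). (UnO C ^^ j) (Src C (k i))) (Sum C V) (\<lambda>(i, j). Inj V (?q i j) \<cdot> lift k i j) \<pi>"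
      using prim_total_dsum[OF k] by blast
    note DS = dsum_simps(7-9)[OF D]
    have pD [simp]: "\<pi>D (i, j) \<in> Mor C" "Src C (\<pi>D (i, j)) = D" "Tgt C (\<pi>D (i, j)) = (UnO C ^^ j) (Src C (k i))"
      if "j \<le> i" "i \<le> r" for i j using DS[of "(i, j)"] that by auto
    have lift [simp]: "lift k i j \<in> Mor C" "Src C (lift k i j) = (UnO C ^^ j) (Src C (k i))" "Tgt C (lift k i j) = Grd C V (?q i j)"
      if "i \<le> r" for i j using that by (simp_all add: lift_def)
    have D_Ob [simp]: "D \<in> Ob C" "finite ?J" by (rule dsum_simps(2)[OF D]) (rule dsum_simps(1)[OF D])
    let ?\<epsilon> = "hsum C D (Sum C V) (\<lambda>x. (case x of (i, j) \<Rightarrow> Inj V (?q i j) \<cdot> lift k i j) \<cdot> \<pi>D x) ?J"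
    have iso: "is_iso C ?\<epsilon>" by (rule dsum_iso[OF D S])
    have \<epsilon>: "hsum C D (Sum C V) (\<lambda>(i, j). Inj V (?q i j) \<cdot> transl C j (Grd C V (?q i j)) (gre C V e j (- int i) \<cdot> k i) \<cdot> \<pi>D (i, j)) ?J = ?\<epsilon>"
    proof (rule hsum_cong)
      fix x assume "x \<in> ?J"
      then obtain i j where x: "x = (i, j)" "j \<le> i" "i \<le> r" by auto
      have "transl C j (Grd C V (?q i j)) (gre C V e j (- int i) \<cdot> k i) = lift k i j"
        unfolding lift_def by (subst gre_eq[OF refl]) simp
      then show "(case x of (i, j) \<Rightarrow> Inj V (?q i j) \<cdot> transl C j (Grd C V (?q i j)) (gre C V e j (- int i) \<cdot> k i) \<cdot> \<pi>D (i, j)) =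
        (case x of (i, j) \<Rightarrow> Inj V (?q i j) \<cdot> lift k i j) \<cdot> \<pi>D x" using x by simp
      show "(case x of (i, j) \<Rightarrow> Inj V (?q i j) \<cdot> lift k i j) \<cdot> \<pi>D x \<in> Hom C D (Sum C V)"
        using x pD[OF x(2,3)] lift[OF x(3), of j] by simp
    qed auto
    have \<epsilon>_Hom: "?\<epsilon> \<in> Hom C D (Sum C V)"
    proof (rule hsum_Hom)
      fix x assume "x \<in> ?J"
      then obtain i j where x: "x = (i, j)" "j \<le> i" "i \<le> r" by auto
      show "(case x of (i, j) \<Rightarrow> Inj V (?q i j) \<cdot> lift k i j) \<cdot> \<pi>D x \<in> Hom C D (Sum C V)"
        using x pD[OF x(2,3)] lift[OF x(3), of j] by simp
    qed auto
    have "\<Phi> \<cdot> ?\<epsilon> = hsum C D (Und C V) (\<lambda>x. \<Phi> \<cdot> ((case x of (i, j) \<Rightarrow> Inj V (?q i j) \<cdot> lift k i j) \<cdot> \<pi>D x)) ?J"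
    proof (subst Cmp_hsum(1))
      fix x assume "x \<in> ?J"
      then obtain i j where x: "x = (i, j)" "j \<le> i" "i \<le> r" by auto
      show "(case x of (i, j) \<Rightarrow> Inj V (?q i j) \<cdot> lift k i j) \<cdot> \<pi>D x \<in> Hom C D (Sum C V)"
        using x pD[OF x(2,3)] lift[OF x(3), of j] by simp
    qed auto
    also have "hsum C D (Und C V) (\<lambda>(i, j). transl C j (Und C V) (epow C e j \<cdot> f i) \<cdot> \<pi>D (i, j)) ?J = \<dots>"
    proof (rule hsum_cong)
      fix x assume "x \<in> ?J"
      then obtain i j where x: "x = (i, j)" "j \<le> i" "i \<le> r" by auto
      note [simp] = pD[OF x(2,3)] lift[OF x(3), of j, simplified]
      have "transl C j (Und C V) (epow C e j \<cdot> f i) = transl C j (Tgt C (I (?q i j))) (shA C j (I (?q i j)) \<cdot> (e_comp j (- int i) (?q i j) \<cdot> k i))"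
        unfolding f[OF x(3)] using x by (subst epow_I_Cmp[OF refl]) simp_all
      also have "\<dots> = I (?q i j) \<cdot> lift k i j"
        using x by (subst transl_natural) (simp_all add: lift_def)
      finally have "transl C j (Und C V) (epow C e j \<cdot> f i) = I (?q i j) \<cdot> lift k i j" .
      moreover have "\<Phi> \<cdot> (Inj V (?q i j) \<cdot> lift k i j \<cdot> \<pi>D (i, j)) = I (?q i j) \<cdot> lift k i j \<cdot> \<pi>D (i, j)"
        using x by (simp add: Cmp_reassoc[OF \<Phi>_Inj])
      ultimately show "(case x of (i, j) \<Rightarrow> transl C j (Und C V) (epow C e j \<cdot> f i) \<cdot> \<pi>D (i, j)) =
        \<Phi> \<cdot> ((case x of (i, j) \<Rightarrow> Inj V (?q i j) \<cdot> lift k i j) \<cdot> \<pi>D x)" using x by simp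
      show "\<Phi> \<cdot> ((case x of (i, j) \<Rightarrow> Inj V (?q i j) \<cdot> lift k i j) \<cdot> \<pi>D x) \<in> Hom C D (Und C V)"
        using x by simp
    qed auto
    finally show ?thesis unfolding \<epsilon> using iso \<epsilon>_Hom by simp
  qed
  show ?thesis
  proof
    assume "is_phi_I C r V e \<phi>"
    then obtain k f D \<iota>D \<pi>D where
      kf: "\<forall>i\<le>r. is_ker C (gre C V e (i + 1) (- int i)) (k i) \<and> is_prim_lift C V e i (k i) (f i)"
      and D: "is_dsum C ?J (\<lambda>(i, j). (UnO C ^^ j) (Src C (k i))) D \<iota>D \<pi>D"
      and \<phi>: "\<phi> = hsum C D (Und C V) (\<lambda>(i, j). transl C j (Und C V) (epow C e j \<cdot> f i) \<cdot> \<pi>D (i, j)) ?J \<cdot>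
      cinv C (hsum C D (Sum C V) (\<lambda>(i, j). Inj V (- int i + 2 * int j) \<cdot>
               transl C j (Grd C V (- int i + 2 * int j)) (gre C V e j (- int i) \<cdot> k i) \<cdot> \<pi>D (i, j)) ?J)"
      unfolding is_phi_I_def Let_def by blast
    have k: "is_ker C (e_comp (i + 1) (- int i) (int i + 2)) (k i)" if "i \<le> r" for i using kf that prim_ker by blast
    have f: "f i = I (- int i) \<cdot> k i" if "i \<le> r" for i using is_prim_lift_iff[OF k[OF that]] kf that by blast
    show "\<phi> = \<Phi>" unfolding \<phi> by (rule main[OF k f D])
  next
    \<comment> \<open>The definite description requires that some choice exists, so kernels and a
      direct sum are produced here.\<close>
    assume \<phi>: "\<phi> = \<Phi>"
    have "\<exists>k. \<forall>i. is_ker C (e_comp (i + 1) (- int i) (int i + 2)) (k i)"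
      by (intro choice allI ex_ker) simp
    then obtain k where k: "\<And>i. is_ker C (e_comp (i + 1) (- int i) (int i + 2)) (k i)" by blast
    note [simp] = ker_simps(2)[OF k]
    have "finite ?J" by (rule finite_subset[of _ "{..r} \<times> {..r}"]) auto
    then have "\<exists>D \<iota>D \<pi>D. is_dsum C ?J (\<lambda>(i, j). (UnO C ^^ j) (Src C (k i))) D \<iota>D \<pi>D"
      by (rule finite_dsum_exists) auto
    then obtain D \<iota>D \<pi>D where D: "is_dsum C ?J (\<lambda>(i, j). (UnO C ^^ j) (Src C (k i))) D \<iota>D \<pi>D" by blast
    have "is_ker C (gre C V e (i + 1) (- int i)) (k i)" for i
      using k[of i] by (subst gre_eq[of "int i + 2"]) auto
    moreover have "is_prim_lift C V e i (k i) (I (- int i) \<cdot> k i)" for i using is_prim_lift_iff[OF k] by simp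
    ultimately show "is_phi_I C r V e \<phi>" unfolding is_phi_I_def Let_def \<phi>
      using main[OF k refl D] D
      by (intro exI[of _ k] exI[of _ "\<lambda>i. I (- int i) \<cdot> k i"] exI[of _ D] exI[of _ \<iota>D] exI[of _ \<pi>D]) simp
  qed
qed

lemma phi_I_eq: "phi_I C r V e = \<Phi>"
  unfolding phi_I_def is_phi_I_iff by simp

end

section \<open>The isomorphism \<open>\<omega>\<^sub>I\<close>\<close>

lemma pullback_factors:
  assumes "is_pullback C f g f' g'" "h \<in> Mor C" "k \<in> Mor C" "Src C h = Src C k" "Tgt C h = Src C f" "Tgt C k = Src C g"
    "f \<cdot>\<^bsub>C\<^esub> h = g \<cdot>\<^bsub>C\<^esub> k"
  shows "factors C f' h"
  using assms unfolding is_pullback_def factors_def by (metis (no_types, lifting))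

text \<open>The kernel of (p e^r, p), expressed in components: p e^r is the isomorphism e_r after
  P_{-r}, so it is the common kernel of P_r and P_{-r}, where r = s + 1.\<close>

locale omega_kernel = lefschetz_split C "Suc s" V I P e
  for C :: "('o, 'a) shcat" (structure) and s V I P e +
  fixes \<iota> :: 'a
  assumes \<iota>_mono: "is_mono C \<iota>"
    and \<iota>_Tgt [simp]: "Tgt C \<iota> = Und C V"
    and P_\<iota>: "P (int (Suc s)) \<cdot> \<iota> = Zero C (Src C \<iota>) (Grd C V (int (Suc s)))"
      "P (- int (Suc s)) \<cdot> \<iota> = Zero C (Src C \<iota>) (Grd C V (- int (Suc s)))"
    and \<iota>_factors: "\<lbrakk>u \<in> Mor C; Tgt C u = Und C V; P (int (Suc s)) \<cdot> u = Zero C (Src C u) (Grd C V (int (Suc s)));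
      P (- int (Suc s)) \<cdot> u = Zero C (Src C u) (Grd C V (- int (Suc s)))\<rbrakk> \<Longrightarrow> factors C \<iota> u"
begin

abbreviation "R \<equiv> {- int s..int s}"

lemma R_Suc: "p \<in> {- int (Suc s)..int (Suc s)} \<longleftrightarrow> p \<in> R \<or> p = int (Suc s) \<or> p = - int (Suc s)"
  by auto

lemma \<iota>_Mor [simp]: "\<iota> \<in> Mor C"
  using \<iota>_mono by (rule mono_Mor)

definition J :: "int \<Rightarrow> 'a" where "J p = fac C \<iota> (I p)"

lemma J_simps [simp]:
  assumes "p \<in> R"
  shows "J p \<in> Mor C" "Src C (J p) = Grd C V p" "Tgt C (J p) = Src C \<iota>" "\<iota> \<cdot> J p = I p"
proof -
  have "factors C \<iota> (I p)" using assms by (intro \<iota>_factors) (auto simp: P_I)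
  then show "J p \<in> Mor C" "Src C (J p) = Grd C V p" "Tgt C (J p) = Src C \<iota>" "\<iota> \<cdot> J p = I p"
    using fac_simps[OF \<iota>_mono] by (auto simp: J_def)
qed

lemma \<iota>_zero:
  assumes "t \<in> Mor C" "Tgt C t = Src C \<iota>" "\<And>p. p \<in> R \<Longrightarrow> P p \<cdot> (\<iota> \<cdot> t) = Zero C (Src C t) (Grd C V p)"
  shows "t = Zero C (Src C t) (Src C \<iota>)"
proof -
  have "\<iota> \<cdot> t = Zero C (Src C t) (Und C V)"
  proof (rule dsum_cancel[OF dsum_V])
    fix p assume "p \<in> {- int (Suc s)..int (Suc s)}"
    then show "P p \<cdot> (\<iota> \<cdot> t) = P p \<cdot> Zero C (Src C t) (Und C V)"
      unfolding R_Suc using assms by (auto simp: Cmp_reassoc[OF P_\<iota>(1)] Cmp_reassoc[OF P_\<iota>(2)] simp del: of_nat_Suc)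
  qed (use assms(1,2) in auto)
  then have "\<iota> \<cdot> t = \<iota> \<cdot> Zero C (Src C t) (Src C \<iota>)" using assms(1) by simp
  then show ?thesis by (rule mono_cancel[OF \<iota>_mono]) (use assms(1,2) in auto)
qed

lemma J_dsum: "is_dsum C R (Grd C V) (Src C \<iota>) J (\<lambda>p. P p \<cdot> \<iota>)"
proof (rule dsumI)
  fix t assume "t \<in> Mor C" "Tgt C t = Src C \<iota>" "\<And>i. i \<in> R \<Longrightarrow> (P i \<cdot> \<iota>) \<cdot> t = Zero C (Src C t) (Grd C V i)"
  then show "t = Zero C (Src C t) (Src C \<iota>)" by (intro \<iota>_zero) auto
qed (auto simp: P_I)

text \<open>The retraction of \<iota> that kills V_{-r} and V_r; in \<open>V_dsum\<close> it is the
  projection onto the middle summand.\<close>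

definition \<Theta> :: 'a where "\<Theta> = hsum C (Und C V) (Src C \<iota>) (\<lambda>p. (if p \<in> R then J p else Zero C (Grd C V p) (Src C \<iota>)) \<cdot> P p) {- int (Suc s)..int (Suc s)}"

lemma \<Theta>_simps [simp]: "\<Theta> \<in> Mor C" "Src C \<Theta> = Und C V" "Tgt C \<Theta> = Src C \<iota>"
  and \<Theta>_I: "p \<in> {- int (Suc s)..int (Suc s)} \<Longrightarrow> \<Theta> \<cdot> I p = (if p \<in> R then J p else Zero C (Grd C V p) (Src C \<iota>))"
proof -
  note * = dsum_copair[OF dsum_V, of "Src C \<iota>" "\<lambda>p. if p \<in> R then J p else Zero C (Grd C V p) (Src C \<iota>)"]
  show "\<Theta> \<in> Mor C" "Src C \<Theta> = Und C V" "Tgt C \<Theta> = Src C \<iota>"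
    using *(1) by (auto simp: \<Theta>_def)
  show "p \<in> {- int (Suc s)..int (Suc s)} \<Longrightarrow> \<Theta> \<cdot> I p = (if p \<in> R then J p else Zero C (Grd C V p) (Src C \<iota>))"
    using *(2)[of p] by (auto simp: \<Theta>_def)
qed

lemma P_\<iota>_\<Theta>: "p \<in> R \<Longrightarrow> P p \<cdot> (\<iota> \<cdot> \<Theta>) = P p"
proof (rule dsum_cancel_op[OF dsum_V])
  fix j assume p: "p \<in> R" and j: "j \<in> {- int (Suc s)..int (Suc s)}"
  show "(P p \<cdot> (\<iota> \<cdot> \<Theta>)) \<cdot> I j = P p \<cdot> I j"
    using \<Theta>_I[OF j] p by (auto simp: P_I simp del: of_nat_Suc)
qed auto

lemma P_\<iota>_\<Theta>_Cmp: "\<lbrakk>p \<in> R; t \<in> Mor C; Tgt C t = Und C V\<rbrakk> \<Longrightarrow> P p \<cdot> (\<iota> \<cdot> (\<Theta> \<cdot> t)) = P p \<cdot> t"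
  using Cmp_reassoc[OF P_\<iota>_\<Theta>, of p t] by simp

lemma \<Theta>_\<iota>: "\<Theta> \<cdot> \<iota> = Idn C (Src C \<iota>)"
proof (rule dsum_cancel_op[OF J_dsum])
  fix p assume "p \<in> R"
  then show "(\<Theta> \<cdot> \<iota>) \<cdot> J p = Idn C (Src C \<iota>) \<cdot> J p" using \<Theta>_I[of p] by simp
qed auto

lemma \<iota>_\<Theta>_I: "p \<in> R \<Longrightarrow> \<iota> \<cdot> (\<Theta> \<cdot> I p) = I p"
  using \<Theta>_I[of p] by simp

lemma V_dsum: "is_dsum C {0::nat, 1, 2}
    (\<lambda>j. if j = 0 then Grd C V (- int (Suc s)) else if j = 1 then Src C \<iota> else Grd C V (int (Suc s)))
    (Und C V) (\<lambda>j. if j = 0 then I (- int (Suc s)) else if j = 1 then \<iota> else I (int (Suc s)))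
    (\<lambda>j. if j = 0 then P (- int (Suc s)) else if j = 1 then \<Theta> else P (int (Suc s)))"
proof (rule dsumI)
  fix t assume t: "t \<in> Mor C" "Tgt C t = Und C V"
    "\<And>j. j \<in> {0::nat, 1, 2} \<Longrightarrow> (if j = 0 then P (- int (Suc s)) else if j = 1 then \<Theta> else P (int (Suc s))) \<cdot> t =
      Zero C (Src C t) (if j = 0 then Grd C V (- int (Suc s)) else if j = 1 then Src C \<iota> else Grd C V (int (Suc s)))"
  have 0: "P (- int (Suc s)) \<cdot> t = Zero C (Src C t) (Grd C V (- int (Suc s)))" using t(3)[of 0] by simp
  have 1: "\<Theta> \<cdot> t = Zero C (Src C t) (Src C \<iota>)" using t(3)[of 1] by simp
  have 2: "P (int (Suc s)) \<cdot> t = Zero C (Src C t) (Grd C V (int (Suc s)))" using t(3)[of 2] by simp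
  show "t = Zero C (Src C t) (Und C V)"
  proof (rule dsum_cancel[OF dsum_V])
    fix p assume "p \<in> {- int (Suc s)..int (Suc s)}"
    then consider "p \<in> R" | "p = int (Suc s)" | "p = - int (Suc s)" unfolding R_Suc by blast
    then show "P p \<cdot> t = P p \<cdot> Zero C (Src C t) (Und C V)"
    proof cases
      case 1
      then have "P p \<cdot> t = P p \<cdot> (\<iota> \<cdot> (\<Theta> \<cdot> t))" using P_\<iota>_\<Theta>_Cmp t(1,2) by simp
      also have "\<dots> = Zero C (Src C t) (Grd C V p)" unfolding \<open>\<Theta> \<cdot> t = _\<close> using t(1) by simp
      finally show ?thesis using t(1) by simp
    qed (use 0 2 t(1) in \<open>simp_all del: of_nat_Suc\<close>)
  qed (use t(1,2) in auto)
qed (auto simp: P_I P_\<iota> \<Theta>_\<iota> \<Theta>_I simp del: of_nat_Suc)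

end

locale omega_step = omega_kernel C s V I P e \<iota>
  for C :: "('o, 'a) shcat" (structure) and s V I P e \<iota> +
  fixes K :: "'a filt"
  assumes Und_K: "Und C K = Src C \<iota>"
    and Fil_K_mono: "is_mono C (Fil K p)"
    and Fil_K_Tgt: "Tgt C (Fil K p) = Src C \<iota>"
    and Fil_K: "is_pullback C \<iota> (Fil V p) (Fil K p) (fac C (Fil V p) (\<iota> \<cdot> Fil K p))"
    and Quo_K_Mor: "Quo K p \<in> Mor C" "Src C (Quo K p) = Src C (Fil K p)"
    and Quo_K: "p \<in> {- int s..int s} \<Longrightarrow> Quo K p = Quo V p \<cdot> fac C (Fil V p) (\<iota> \<cdot> Fil K p)"
    and Grd_K_zero: "p \<notin> {- int s..int s} \<Longrightarrow> is_zero_ob C (Grd C K p)"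
    and Inj_K: "Inj K p \<in> Hom C (Grd C K p) (Sum C K)"
    and Prj_K: "Prj K p \<in> Hom C (Sum C K) (Grd C K p)"
    and star_K: "is_dsum C {- int s..int s} (Grd C K) (Sum C K) (Inj K) (Prj K)"
begin

lemma \<iota>_Fil_K: "fac C (Fil V p) (\<iota> \<cdot> Fil K p) \<in> Hom C (Src C (Fil K p)) (Src C (Fil V p))"
    "Fil V p \<cdot> fac C (Fil V p) (\<iota> \<cdot> Fil K p) = \<iota> \<cdot> Fil K p"
  using Fil_K[of p] by (auto simp: is_pullback_def)

lemma Grd_K: "p \<in> R \<Longrightarrow> Grd C K p = Grd C V p"
  using Quo_K[of p] \<iota>_Fil_K(1)[of p] by (simp add: Grd_def[of C K])

lemma Grd_K_Ob [simp]: "Grd C K p \<in> Ob C"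
  using Inj_K[of p] Ob_simps(1)[of "Inj K p"] by simp

text \<open>Outside \<open>R\<close> the piece K_p is some zero object, unrelated to V_p, which may
  be nonzero in the degrees s + 1 and -s - 1. Zero arrows are put there.\<close>

definition JK :: "int \<Rightarrow> 'a" where "JK p = (if p \<in> R then J p else Zero C (Grd C K p) (Und C K))"

definition PK :: "int \<Rightarrow> 'a" where "PK p = (if p \<in> R then P p \<cdot> \<iota> else Zero C (Und C K) (Grd C K p))"

text \<open>The K-component of the conjugate of \<open>e\<close> by w, written without the chosen
  sum D; \<open>omega_step\<close> shows that every choice of D gives it.\<close>

definition e' :: 'a where "e' = ShA C \<Theta> \<cdot> (e \<cdot> \<iota>)"

lemma K_split: "split_filt C s K JK PK"
proof
  have [simp]: "Fil K p \<in> Mor C" for p using Fil_K_mono by (rule mono_Mor)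
  note [simp] = Fil_K_mono Fil_K_Tgt Und_K
  fix p
  show "is_mono C (Fil K p)" "Tgt C (Fil K p) = Und C K" by simp_all
  show "JK p \<in> Hom C (Grd C K p) (Und C K)" "PK p \<in> Hom C (Und C K) (Grd C K p)"
    by (auto simp: JK_def PK_def Grd_K)
  have z: "Idn C (Grd C K p) = Zero C (Grd C K p) (Grd C K p)" if "p \<notin> R"
    using Grd_K_zero[OF that] by (rule zero_ob_Idn)
  show "PK q \<cdot> JK p = (if p = q then Idn C (Grd C K p) else Zero C (Grd C K p) (Grd C K q))" for q
    using z by (auto simp: JK_def PK_def Grd_K P_I)
  have "hsum C (Src C \<iota>) (Src C \<iota>) (\<lambda>p. JK p \<cdot> PK p) R = hsum C (Src C \<iota>) (Src C \<iota>) (\<lambda>p. J p \<cdot> (P p \<cdot> \<iota>)) R"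
    by (intro hsum_cong) (auto simp: JK_def PK_def)
  then show "hsum C (Und C K) (Und C K) (\<lambda>p. JK p \<cdot> PK p) R = Idn C (Und C K)"
    using dsum_simps(12)[OF J_dsum] by simp
  show "p \<notin> R \<Longrightarrow> is_zero_ob C (Grd C K p)" by (rule Grd_K_zero)
  show "factors C (Fil K p) (JK j)" if j: "j \<le> p" for j
  proof (cases "j \<in> R")
    case True
    note f = fac_simps[OF Fil_mono I_factors[OF j]]
    have "factors C (Fil K p) (J j)"
      by (rule pullback_factors[OF Fil_K[of p], of _ "fac C (Fil V p) (I j)"]) (use True f in simp_all)
    then show ?thesis using True by (simp add: JK_def)
  next
    case False
    then show ?thesis by (auto simp: JK_def intro!: factorsI[of _ "Zero C (Grd C K j) (Src C (Fil K p))"])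
  qed
  have PF: "P j \<cdot> (\<iota> \<cdot> Fil K p) = (P j \<cdot> Fil V p) \<cdot> fac C (Fil V p) (\<iota> \<cdot> Fil K p)" for j
    using \<iota>_Fil_K[of p] by simp
  show "PK j \<cdot> Fil K p = Zero C (Src C (Fil K p)) (Grd C K j)" if "p < j" for j
    using PF[of j] P_Fil[OF that] \<iota>_Fil_K(1)[of p] by (auto simp: PK_def Grd_K)
  show "Quo K p = PK p \<cdot> Fil K p"
  proof (cases "p \<in> R")
    case True
    then show ?thesis using PF[of p] Quo_K[of p] by (simp add: PK_def Quo_eq)
  next
    case False
    then show ?thesis using Quo_K_Mor[of p] zero_ob_Zero(2)[OF Grd_K_zero[OF False], of "Quo K p"]
      by (auto simp: PK_def Grd_def[of C K])
  qed
  show "Inj K p \<in> Hom C (Grd C K p) (Sum C K)" "Prj K p \<in> Hom C (Sum C K) (Grd C K p)" by (fact Inj_K Prj_K)+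
qed (fact star_K)

sublocale K: split_filt C s K JK PK
  by (rule K_split)

lemma e'_simps [simp]: "e' \<in> Mor C" "Src C e' = Src C \<iota>" "Tgt C e' = ShO C (Src C \<iota>)"
  by (simp_all add: e'_def)

lemma PK_\<Theta>: "q \<in> R \<Longrightarrow> PK q \<cdot> \<Theta> = P q"
  using P_\<iota>_\<Theta>[of q] by (simp add: PK_def)

sublocale K: graded_split C s K JK PK e'
proof
  show "e' \<in> Hom C (Und C K) (ShO C (Und C K))" by (simp add: Und_K)
  fix p q :: int assume pq: "q \<noteq> p + 2"
  show "ShA C (PK q) \<cdot> (e' \<cdot> JK p) = Zero C (Grd C K p) (ShO C (Grd C K q))"
  proof (cases "p \<in> R \<and> q \<in> R")
    case True
    have "ShA C (PK q) \<cdot> (e' \<cdot> JK p) = (ShA C (PK q) \<cdot> ShA C \<Theta>) \<cdot> (e \<cdot> (\<iota> \<cdot> JK p))"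
      unfolding e'_def by (simp add: Und_K)
    also have "ShA C (PK q) \<cdot> ShA C \<Theta> = ShA C (P q)"
      using PK_\<Theta>[of q] True by (metis Sh.map_simps(6) K.IP_simps(4,6) \<Theta>_simps(1,3) Und_K)
    finally show ?thesis using e_graded[OF pq] True by (simp add: JK_def Grd_K)
  next
    case False
    then show ?thesis using Grd_K_zero[of p] Grd_K_zero[of q] by (auto simp: JK_def PK_def Und_K Grd_K)
  qed
qed

text \<open>\<iota> \<Theta> is the identity on I_q only for q in \<open>R\<close>. If p and p + 2k
  lie in \<open>R\<close>, then so do all degrees between them, and e' loses nothing along the
  way.\<close>

lemma \<iota>_epow:
  assumes "p \<in> R" "p + 2 * int k \<in> R"
  shows "shA C k \<iota> \<cdot> (epow C e' k \<cdot> JK p) = epow C e k \<cdot> I p"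
  using assms(2)
proof (induction k)
  case 0
  then show ?case using assms(1) by (simp add: JK_def Und_K)
next
  case (Suc k)
  let ?q = "p + 2 * int (Suc k)"
  have IH: "shA C k \<iota> \<cdot> (epow C e' k \<cdot> JK p) = epow C e k \<cdot> I p" using Suc assms(1) by auto
  have e'k: "shA C k e' = shA C (Suc k) \<Theta> \<cdot> (shA C k e \<cdot> shA C k \<iota>)"
    by (simp add: e'_def funpow_swap1)
  have "shA C (Suc k) \<iota> \<cdot> (epow C e' (Suc k) \<cdot> JK p) =
    (shA C (Suc k) \<iota> \<cdot> (shA C (Suc k) \<Theta> \<cdot> shA C k e)) \<cdot> (shA C k \<iota> \<cdot> (epow C e' k \<cdot> JK p))"
    unfolding epow_Suc'[OF K.e_Hom] e'k by (simp add: Und_K funpow_swap1)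
  also have "\<dots> = shA C (Suc k) \<iota> \<cdot> (shA C (Suc k) \<Theta> \<cdot> (epow C e (Suc k) \<cdot> I p))"
    unfolding IH epow_Suc'[OF e_Hom] by (simp add: funpow_swap1)
  also have "\<dots> = (shA C (Suc k) \<iota> \<cdot> (shA C (Suc k) \<Theta> \<cdot> shA C (Suc k) (I ?q))) \<cdot> e_comp (Suc k) p ?q"
    unfolding epow_I[OF refl] by (simp add: funpow_swap1)
  also have "shA C (Suc k) \<iota> \<cdot> (shA C (Suc k) \<Theta> \<cdot> shA C (Suc k) (I ?q)) = shA C (Suc k) (\<iota> \<cdot> (\<Theta> \<cdot> I ?q))"
    by (subst Shm.map_simps(6), simp, simp, simp)+ simp
  also have "\<dots> = shA C (Suc k) (I ?q)" using \<iota>_\<Theta>_I[OF Suc.prems] by simp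
  finally show ?case using epow_I[of ?q p "Suc k"] by simp
qed

lemma e_comp_K:
  assumes "p \<in> R" "q \<in> R" "q = p + 2 * int k"
  shows "K.e_comp k p q = e_comp k p q"
proof -
  have "K.e_comp k p q = shA C k (P q) \<cdot> (shA C k \<iota> \<cdot> (epow C e' k \<cdot> JK p))"
    unfolding K.e_comp_def using assms(2) by (simp add: PK_def Und_K)
  then show ?thesis using \<iota>_epow[of p k] assms by (simp add: e_comp_def)
qed

sublocale K: lefschetz_split C s K JK PK e'
proof
  fix k show "is_iso C (K.e_comp k (- int k) (int k))"
  proof (cases "k \<le> s")
    case True
    then show ?thesis using e_comp_K[of "- int k" "int k" k] e_comp_iso[of k] by auto
  next
    case False
    then show ?thesis using Grd_K_zero[of "- int k"] Shm.map_zero_ob[OF Grd_K_zero[of "int k"], of k]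
      by (intro zero_ob_iso) auto
  qed
qed

text \<open>Both sides have the same components in \<open>V\<^sub>-\<^sub>r\<close>, \<open>K\<close> and \<open>V\<^sub>r\<close>.\<close>

lemma omega_step:
  assumes D: "is_dsum C {0::nat, 1, 2}
          (\<lambda>j. if j = 0 then Grd C V (- int (Suc s)) else if j = 1 then Und C K else Grd C V (int (Suc s))) D \<iota>D \<pi>D"
  defines "w \<equiv> hsum C D (Und C V)
     (\<lambda>j. (if j = 0 then I (- int (Suc s)) else if j = 1 then \<iota> else I (int (Suc s))) \<cdot> \<pi>D j) {0, 1, 2}"
  shows "ShA C (\<pi>D 1) \<cdot> (ShA C (cinv C w) \<cdot> e \<cdot> w) \<cdot> \<iota>D 1 = e'"
    "w \<cdot> hsum C (Sum C V) D (\<lambda>j. \<iota>D j \<cdot> (if j = 0 then Prj V (- int (Suc s))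
      else if j = 1 then K.\<Phi> \<cdot> hsum C (Sum C V) (Sum C K) (\<lambda>j. Inj K j \<cdot> Prj V j) R
      else Prj V (int (Suc s)))) {0, 1, 2} = \<Phi>"
proof -
  let ?r = "int (Suc s)"
  note D' = D[unfolded Und_K]
  have [simp]: "D \<in> Ob C" by (rule dsum_simps(2)[OF D])
  note Dsimps [simp] = dsum_simps(4-9)[OF D', of 0, simplified] dsum_simps(4-9)[OF D', of 1, simplified] dsum_simps(4-9)[OF D', of 2, simplified]
  have w_iso: "is_iso C w"
    unfolding w_def using dsum_iso[OF D' V_dsum] by simp
  have w: "w \<in> Hom C D (Und C V)" "\<And>j. j \<in> {0::nat, 1, 2} \<Longrightarrow> w \<cdot> \<iota>D j = (if j = 0 then I (- ?r) else if j = 1 then \<iota> else I ?r)"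
    unfolding w_def using dsum_copair[OF D', of "Und C V" "\<lambda>j. if j = 0 then I (- ?r) else if j = 1 then \<iota> else I ?r"] by simp_all
  have w\<iota>: "w \<cdot> \<iota>D 0 = I (- ?r)" "w \<cdot> \<iota>D 1 = \<iota>" "w \<cdot> \<iota>D 2 = I ?r" using w(2)[of 0] w(2)[of 1] w(2)[of 2] by simp_all
  note [simp] = w(1)[unfolded Hom_iff]
  \<comment> \<open>The projections of \<open>V_dsum\<close> after w are those of D. Hence \<Theta>
    can stand for the projection after the inverse of w, and that inverse need not be
    computed.\<close>
  have pw: "(if j = 0 then P (- ?r) else if j = 1 then \<Theta> else P ?r) \<cdot> w = \<pi>D j" if j: "j \<in> {0, 1, 2}" for j :: nat
  proof (rule dsum_cancel_op[OF D'])
    fix i :: nat assume i: "i \<in> {0, 1, 2}"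
    show "((if j = 0 then P (- ?r) else if j = 1 then \<Theta> else P ?r) \<cdot> w) \<cdot> \<iota>D i = \<pi>D j \<cdot> \<iota>D i"
      using i j w(2)[OF i] dsum_simps(10)[OF V_dsum, of i] dsum_simps(11)[OF V_dsum, of i j]
        dsum_simps(10)[OF D', of i] dsum_simps(11)[OF D', of i j]
      by (cases "i = j") (auto simp del: of_nat_Suc)
  qed (use j in auto)
  have pw': "P (- ?r) \<cdot> w = \<pi>D 0" "\<Theta> \<cdot> w = \<pi>D 1" "P ?r \<cdot> w = \<pi>D 2" using pw[of 0] pw[of 1] pw[of 2] by simp_all
  have "ShA C (\<pi>D 1) \<cdot> ShA C (cinv C w) = ShA C ((\<Theta> \<cdot> w) \<cdot> cinv C w)"
    unfolding pw' using w_iso by simp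
  also have "\<dots> = ShA C \<Theta>" using w_iso by simp
  finally have "(ShA C (\<pi>D 1) \<cdot> ShA C (cinv C w)) \<cdot> (e \<cdot> (w \<cdot> \<iota>D 1)) = ShA C \<Theta> \<cdot> (e \<cdot> \<iota>)"
    unfolding w\<iota> by simp
  then show "ShA C (\<pi>D 1) \<cdot> (ShA C (cinv C w) \<cdot> e \<cdot> w) \<cdot> \<iota>D 1 = e'"
    unfolding e'_def using w_iso by simp
  define \<kappa> where "\<kappa> = hsum C (Sum C V) (Sum C K) (\<lambda>j. Inj K j \<cdot> Prj V j) R"
  have \<kappa>: "\<kappa> \<in> Hom C (Sum C V) (Sum C K)" unfolding \<kappa>_def by (intro hsum_Hom) (auto simp: Grd_K)
  have PI: "Prj V q \<cdot> Inj V p = (if p = q then Idn C (Grd C V p) else Zero C (Grd C V p) (Grd C V q))"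
    if "p \<in> {- ?r..?r}" "q \<in> {- ?r..?r}" for p q
    using dsum_simps(10)[OF star_dsum, of p] dsum_simps(11)[OF star_dsum, of p q] that by auto
  have \<kappa>_Inj: "\<kappa> \<cdot> Inj V p = (if p \<in> R then Inj K p else Zero C (Grd C V p) (Sum C K))" if p: "p \<in> {- ?r..?r}" for p
  proof -
    have "\<kappa> \<cdot> Inj V p = hsum C (Grd C V p) (Sum C K) (\<lambda>j. (Inj K j \<cdot> Prj V j) \<cdot> Inj V p) R"
      unfolding \<kappa>_def by (subst Cmp_hsum(2)) (auto simp: Grd_K)
    also have "\<dots> = hsum C (Grd C V p) (Sum C K) (\<lambda>j. if j = p then Inj K p else Zero C (Grd C V p) (Sum C K)) R"
      using PI[OF p] by (intro hsum_cong) (auto simp: Grd_K)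
    also have "\<dots> = (if p \<in> R then Inj K p else Zero C (Grd C V p) (Sum C K))"
    proof (cases "p \<in> R")
      case True
      then show ?thesis using hsum_single[of "Grd C V p" "Sum C K" R p "\<lambda>j. if j = p then Inj K p else Zero C (Grd C V p) (Sum C K)"]
        by (auto simp: Grd_K)
    next
      case False
      then show ?thesis by (auto intro!: hsum_Zero)
    qed
    finally show ?thesis .
  qed
  let ?f = "\<lambda>j::nat. if j = 0 then Prj V (- ?r) else if j = 1 then K.\<Phi> \<cdot> \<kappa> else Prj V ?r"
  define x where "x = hsum C (Sum C V) D (\<lambda>j. \<iota>D j \<cdot> ?f j) {0, 1, 2}"
  have x: "x \<in> Hom C (Sum C V) D" "\<And>j. j \<in> {0::nat, 1, 2} \<Longrightarrow> \<pi>D j \<cdot> x = ?f j"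
    unfolding x_def using dsum_pair[OF D', of "Sum C V" ?f] \<kappa> Und_K by simp_all
  note [simp] = x(1)[unfolded Hom_iff] \<kappa>[unfolded Hom_iff]
  have "w \<cdot> x = \<Phi>"
  proof (rule \<Phi>_eqI)
    show "w \<cdot> x \<in> Hom C (Sum C V) (Und C V)" by simp
    fix p assume p: "p \<in> {- ?r..?r}"
    show "(w \<cdot> x) \<cdot> Inj V p = I p"
    proof (rule dsum_cancel[OF V_dsum])
      fix j :: nat assume j: "j \<in> {0, 1, 2}"
      let ?p = "if j = 0 then P (- ?r) else if j = 1 then \<Theta> else P ?r"
      have "?p \<cdot> ((w \<cdot> x) \<cdot> Inj V p) = ((?p \<cdot> w) \<cdot> x) \<cdot> Inj V p" by simp
      also have "\<dots> = ?f j \<cdot> Inj V p" unfolding pw[OF j] x(2)[OF j] ..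
      also have "\<dots> = ?p \<cdot> I p"
        using p j PI[OF p, of "- ?r"] PI[OF p, of ?r] \<kappa>_Inj[OF p] \<Theta>_I[OF p] K.\<Phi>_Inj[of p]
        by (auto simp: P_I JK_def Und_K simp del: of_nat_Suc)
      finally show "?p \<cdot> ((w \<cdot> x) \<cdot> Inj V p) = ?p \<cdot> I p" .
    qed auto
  qed
  then show "w \<cdot> hsum C (Sum C V) D (\<lambda>j. \<iota>D j \<cdot> (if j = 0 then Prj V (- ?r)
      else if j = 1 then K.\<Phi> \<cdot> hsum C (Sum C V) (Sum C K) (\<lambda>j. Inj K j \<cdot> Prj V j) R else Prj V ?r)) {0, 1, 2} = \<Phi>"
    unfolding x_def \<kappa>_def .
qed

end

section \<open>From the data of the recursion to the component description\<close>

lemma (in lefschetz_split) pairing_kernel: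
  assumes n: "is_pairing C (shA C r (P (int r)) \<cdot> epow C e r) (P (int r)) n" and h: "h \<in> Mor C" "Tgt C h = Und C V"
  shows "n \<in> Mor C" "Src C n = Und C V"
    "n \<cdot> h = Zero C (Src C h) (Tgt C n) \<longleftrightarrow>
      P (int r) \<cdot> h = Zero C (Src C h) (Grd C V (int r)) \<and> P (- int r) \<cdot> h = Zero C (Src C h) (Grd C V (- int r))"
proof -
  let ?f = "shA C r (P (int r)) \<cdot> epow C e r"
  obtain \<iota> \<pi> where D: "is_dsum C {0::nat, 1} (\<lambda>i. if i = 0 then Tgt C ?f else Tgt C (P (int r))) (Tgt C n) \<iota> \<pi>"
    and \<pi>: "\<pi> 0 \<cdot> n = ?f" "\<pi> 1 \<cdot> n = P (int r)"
    using n unfolding is_pairing_def by blast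
  show N [simp]: "n \<in> Mor C" "Src C n = Und C V" using n unfolding is_pairing_def by auto
  note [simp] = dsum_simps(7-9)[OF D, of 0, simplified] dsum_simps(7-9)[OF D, of 1, simplified]
  have 0: "\<pi> 0 \<cdot> (n \<cdot> h) = e_comp r (- int r) (int r) \<cdot> (P (- int r) \<cdot> h)"
    using h Cmp_reassoc[OF \<pi>(1), of h] P_epow_Cmp[of "- int r" "int r" r h] by simp
  have 1: "\<pi> 1 \<cdot> (n \<cdot> h) = P (int r) \<cdot> h"
    using h Cmp_reassoc[OF \<pi>(2), of h] by simp
  show "n \<cdot> h = Zero C (Src C h) (Tgt C n) \<longleftrightarrow>
      P (int r) \<cdot> h = Zero C (Src C h) (Grd C V (int r)) \<and> P (- int r) \<cdot> h = Zero C (Src C h) (Grd C V (- int r))"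
  proof
    assume z: "n \<cdot> h = Zero C (Src C h) (Tgt C n)"
    have "e_comp r (- int r) (int r) \<cdot> (P (- int r) \<cdot> h) = e_comp r (- int r) (int r) \<cdot> Zero C (Src C h) (Grd C V (- int r))"
      unfolding 0[symmetric] z using h by simp
    then have "P (- int r) \<cdot> h = Zero C (Src C h) (Grd C V (- int r))"
      by (rule iso_cancel_left[OF e_comp_iso]) (use h in auto)
    moreover have "P (int r) \<cdot> h = Zero C (Src C h) (Grd C V (int r))"
      unfolding 1[symmetric] z using h by simp
    ultimately show "P (int r) \<cdot> h = Zero C (Src C h) (Grd C V (int r)) \<and> P (- int r) \<cdot> h = Zero C (Src C h) (Grd C V (- int r))"
      by simp
  next
    assume z: "P (int r) \<cdot> h = Zero C (Src C h) (Grd C V (int r)) \<and> P (- int r) \<cdot> h = Zero C (Src C h) (Grd C V (- int r))"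
    show "n \<cdot> h = Zero C (Src C h) (Tgt C n)"
    proof (rule dsum_cancel[OF D])
      fix i :: nat assume "i \<in> {0, 1}"
      then show "\<pi> i \<cdot> (n \<cdot> h) = \<pi> i \<cdot> Zero C (Src C h) (Tgt C n)"
        using 0 1 z h by auto
    qed (use h in auto)
  qed
qed

lemma omega_kernelI:
  fixes C :: "('o, 'a) shcat" (structure)
  assumes "lefschetz_split C (Suc s) V I P e"
    and n: "is_pairing C (shA C (Suc s) (P (int (Suc s))) \<cdot>\<^bsub>C\<^esub> epow C e (Suc s)) (P (int (Suc s))) n" and k: "is_ker C n \<iota>"
  shows "omega_kernel C s V I P e \<iota>"
proof -
  interpret lefschetz_split C "Suc s" V I P e by fact
  note N = pairing_kernel[OF n]
  note K = ker_simps[OF k]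
  have T: "Tgt C \<iota> = Und C V" using K N(2)[OF IP_simps(13) Fil_Tgt] by simp
  show ?thesis
  proof
    show "is_mono C \<iota>" by (rule ker_mono[OF k])
    show "Tgt C \<iota> = Und C V" by (rule T)
    show "P (int (Suc s)) \<cdot> \<iota> = Zero C (Src C \<iota>) (Grd C V (int (Suc s)))"
      "P (- int (Suc s)) \<cdot> \<iota> = Zero C (Src C \<iota>) (Grd C V (- int (Suc s)))"
      using N(3)[OF K(2) T] K(4) by blast+
    show "factors C \<iota> u" if "u \<in> Mor C" "Tgt C u = Und C V" "P (int (Suc s)) \<cdot> u = Zero C (Src C u) (Grd C V (int (Suc s)))"
      "P (- int (Suc s)) \<cdot> u = Zero C (Src C u) (Grd C V (- int (Suc s)))" for u
      using N[OF that(1,2)] that by (intro ker_factors[OF k]) simp_all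
  qed
qed

lemma omega_stepI:
  fixes C :: "('o, 'a) shcat" (structure)
  assumes "omega_kernel C s V I P e \<iota>" and i: "is_induced C s V K \<iota>"
  shows "omega_step C s V I P e \<iota> K"
proof -
  interpret omega_kernel C s V I P e \<iota> by fact
  have \<iota>: "Src C \<iota> = Und C K" using i by (simp add: is_induced_def)
  have f: "is_filt C s K" using i by (simp add: is_induced_def)
  then have Q: "is_coker C (fac C (Fil K p) (Fil K (p - 1))) (Quo K p)"
    and M: "is_mono C (Fil K p)" "Tgt C (Fil K p) = Und C K"
    and F: "factors C (Fil K p) (Fil K (p - 1))" for p
    unfolding is_filt_def is_filtration_def by (auto dest: spec[of _ "p - 1"])
  have "Quo K p \<in> Mor C" "Src C (Quo K p) = Src C (Fil K p)" for p
    using Q[of p] fac_simps[OF M(1) F, of p] by (auto simp: is_coker_def)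
  then show ?thesis
    using i M \<iota> f by unfold_locales (auto simp: is_induced_def is_filt_def)
qed

text \<open>\<open>is_omega_I\<close> asks for some filtered object on the kernel, so one is built.
  F_p K is the kernel of the map to V/F_p, which is the preimage of F_p. The kernel object itself
  serves as the sum of its graded pieces, and one zero object serves for all pieces outside
  \<open>R\<close>.\<close>

lemma (in omega_kernel) ex_induced:
  obtains K where "is_induced C s V K \<iota>" "omega_step C s V I P e \<iota> K"
proof -
  obtain Z where Z: "is_zero_ob C Z" using ex_zero_ob by blast
  note [simp] = zero_ob_Ob[OF Z]
  have "\<exists>F. \<forall>p. is_ker C (coker C (Fil V p) \<cdot> \<iota>) (F p)" by (intro choice allI ex_ker) simp
  then obtain F where F: "\<And>p. is_ker C (coker C (Fil V p) \<cdot> \<iota>) (F p)" by blast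
  note F' = ker_simps(2,3)[OF F, simplified]
  note [simp] = F' ker_mono[OF F]
  have c\<iota>F: "coker C (Fil V p) \<cdot> (\<iota> \<cdot> F p) = Zero C (Src C (F p)) (Tgt C (coker C (Fil V p)))" for p
    using ker_simps(4)[OF F[of p]] by simp
  have fF: "factors C (Fil V p) (\<iota> \<cdot> F p)" for p
    using c\<iota>F by (intro ker_factors[OF Fil_ker]) simp_all
  note [simp] = fac_simps[OF Fil_mono fF, simplified]
  define K where "K = \<lparr>Fil = F, Quo = \<lambda>p. if p \<in> R then Quo V p \<cdot> fac C (Fil V p) (\<iota> \<cdot> F p) else Zero C (Src C (F p)) Z,
    Inj = \<lambda>p. if p \<in> R then J p else Zero C Z (Src C \<iota>), Prj = \<lambda>p. if p \<in> R then P p \<cdot> \<iota> else Zero C (Src C \<iota>) Z\<rparr>"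
  have K: "Fil K = F" "Und C K = Src C \<iota>" "\<And>p. Grd C K p = (if p \<in> R then Grd C V p else Z)"
    by (auto simp: K_def Und_def Grd_def[of C K] Grd_def[of C "\<lparr>Fil = _, Quo = _, Inj = _, Prj = _\<rparr>"])
  \<comment> \<open>\<open>Sum\<close> reads off the source of \<open>Prj K 0\<close>, and degree 0
    belongs to \<open>R\<close> for every s.\<close>
  have "Prj K 0 = P 0 \<cdot> \<iota>" by (simp add: K_def)
  then have S: "Sum C K = Src C \<iota>" by (simp add: Sum_def)
  have pb: "is_pullback C \<iota> (Fil V p) (Fil K p) (fac C (Fil V p) (\<iota> \<cdot> Fil K p))" for p
    unfolding is_pullback_def
  proof (intro conjI ballI impI)
    fix h k assume h: "h \<in> Mor C" and k: "k \<in> Mor C"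
      and H: "Src C h = Src C k \<and> Tgt C h = Src C \<iota> \<and> Tgt C k = Src C (Fil V p) \<and> \<iota> \<cdot> h = Fil V p \<cdot> k"
    have "coker C (Fil V p) \<cdot> (\<iota> \<cdot> h) = Zero C (Src C h) (Tgt C (coker C (Fil V p)))"
      using coker_factors[OF factorsI[of "Fil V p" k "\<iota> \<cdot> h"]] H h k by simp
    then have fh: "factors C (F p) h" using h H by (intro ker_factors[OF F]) auto
    note f = fac_simps[OF ker_mono[OF F] fh]
    show "\<exists>!u. u \<in> Hom C (Src C h) (Src C (Fil K p)) \<and> Fil K p \<cdot> u = h \<and> fac C (Fil V p) (\<iota> \<cdot> Fil K p) \<cdot> u = k"
    proof (rule ex1I[of _ "fac C (F p) h"])
      have "Fil V p \<cdot> (fac C (Fil V p) (\<iota> \<cdot> F p) \<cdot> fac C (F p) h) = Fil V p \<cdot> k"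
        using f h H by (subst Cmp_reassoc[OF fac_simps(4)[OF Fil_mono fF]]) simp_all
      then have "fac C (Fil V p) (\<iota> \<cdot> F p) \<cdot> fac C (F p) h = k"
        by (rule mono_cancel[OF Fil_mono]) (use f h k H in auto)
      then show "fac C (F p) h \<in> Hom C (Src C h) (Src C (Fil K p)) \<and> Fil K p \<cdot> fac C (F p) h = h \<and>
        fac C (Fil V p) (\<iota> \<cdot> Fil K p) \<cdot> fac C (F p) h = k" using f by (simp add: K)
      fix u assume "u \<in> Hom C (Src C h) (Src C (Fil K p)) \<and> Fil K p \<cdot> u = h \<and> fac C (Fil V p) (\<iota> \<cdot> Fil K p) \<cdot> u = k"
      then show "u = fac C (F p) h" using fac_eqI[OF ker_mono[OF F[of p]], of u h] by (simp add: K)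
    qed
  qed (simp_all add: K)
  have step: "omega_step C s V I P e \<iota> K"
  proof
    show "Quo K p \<in> Mor C" "Src C (Quo K p) = Src C (Fil K p)" for p by (auto simp: K_def)
    show "Inj K p \<in> Hom C (Grd C K p) (Sum C K)" "Prj K p \<in> Hom C (Sum C K) (Grd C K p)" for p
      by (auto simp: K S) (auto simp: K_def)
    have "is_dsum C R (Grd C K) (Src C \<iota>) (Inj K) (Prj K)"
      using J_dsum hsum_cong[of "Src C \<iota>" "Src C \<iota>" R "\<lambda>p. Inj K p \<cdot> Prj K p" "\<lambda>p. J p \<cdot> (P p \<cdot> \<iota>)"]
      unfolding is_dsum_def K by (auto simp: K_def)
    then show "is_dsum C R (Grd C K) (Sum C K) (Inj K) (Prj K)" by (simp add: S)
  qed (use pb Z in \<open>auto simp: K\<close>, auto simp: K_def)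
  then interpret S: omega_step C s V I P e \<iota> K .
  have "is_induced C s V K \<iota>"
    unfolding is_induced_def using S.K.V_filt pb by (auto simp: K, auto simp: K_def)
  then show thesis using step by (rule that)
qed

text \<open>The recursion defining \<open>\<omega>\<^sub>I\<close> preserves the splitting, so it computes it.\<close>

theorem is_omega_I_iff:
  fixes C :: "('o, 'a) shcat" (structure)
  assumes "lefschetz_split C r V I P e"
  shows "is_omega_I C r V e \<omega> \<longleftrightarrow> \<omega> = split_filt.\<Phi> C r V I"
  using assms
proof (induction r arbitrary: V I P e \<omega>)
  case 0
  then interpret lefschetz_split C 0 V I P e by simp
  have "I 0 \<cdot> Prj V 0 = \<Phi>"
    by (rule \<Phi>_eqI) (use dsum_simps(10)[OF star_dsum, of 0] in auto)
  then show ?case using first_incl_eq by simp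
next
  case (Suc s)
  interpret lefschetz_split C "Suc s" V I P e by (rule Suc.prems)
  let ?r = "int (Suc s)"
  \<comment> \<open>The induction hypothesis and the computation of one step, for arbitrary
    admissible kernel, \<open>K\<close> and sum. One direction applies this to given data, the other
    to constructed data.\<close>
  have core: "is_omega_I C s K (ShA C (\<pi>D 1) \<cdot> (ShA C (cinv C w) \<cdot> e \<cdot> w) \<cdot> \<iota>D 1) \<omega>' \<longleftrightarrow> \<omega>' = split_filt.\<Phi> C s K (omega_step.JK C s I \<iota> K)"
      "w \<cdot> hsum C (Sum C V) D (\<lambda>j. \<iota>D j \<cdot> (if j = 0 then Prj V (- ?r)
      else if j = 1 then split_filt.\<Phi> C s K (omega_step.JK C s I \<iota> K) \<cdot> hsum C (Sum C V) (Sum C K) (\<lambda>j. Inj K j \<cdot> Prj V j) {- int s..int s}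
      else Prj V ?r)) {0, 1, 2} = \<Phi>"
    if "omega_step C s V I P e \<iota> K"
      and D: "is_dsum C {0::nat, 1, 2}
          (\<lambda>j. if j = 0 then Grd C V (- int (Suc s)) else if j = 1 then Und C K else Grd C V (int (Suc s))) D \<iota>D \<pi>D"
      and w: "w = hsum C D (Und C V) (\<lambda>j. (if j = 0 then I (- int (Suc s)) else if j = 1 then \<iota> else I (int (Suc s))) \<cdot> \<pi>D j) {0, 1, 2}"
    for \<iota> K D \<iota>D \<pi>D \<omega>' w
  proof -
    interpret S: omega_step C s V I P e \<iota> K by fact
    note * = S.omega_step[OF D, folded w]
    show "is_omega_I C s K (ShA C (\<pi>D 1) \<cdot> (ShA C (cinv C w) \<cdot> e \<cdot> w) \<cdot> \<iota>D 1) \<omega>' \<longleftrightarrow> \<omega>' = S.K.\<Phi>"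
      unfolding *(1) by (rule Suc.IH) unfold_locales
    show "w \<cdot> hsum C (Sum C V) D (\<lambda>j. \<iota>D j \<cdot> (if j = 0 then Prj V (- ?r)
      else if j = 1 then S.K.\<Phi> \<cdot> hsum C (Sum C V) (Sum C K) (\<lambda>j. Inj K j \<cdot> Prj V j) {- int s..int s}
      else Prj V ?r)) {0, 1, 2} = \<Phi>" by (rule *(2))
  qed
  show ?case
  proof
    assume "is_omega_I C (Suc s) V e \<omega>"
    then obtain n \<iota> K D \<iota>D \<pi>D \<omega>' where
      n: "is_pairing C (shA C (Suc s) (P ?r) \<cdot> epow C e (Suc s)) (P ?r) n" "is_ker C n \<iota>" "is_induced C s V K \<iota>"
      and D: "is_dsum C {0::nat, 1, 2} (\<lambda>j. if j = 0 then Grd C V (- ?r) else if j = 1 then Und C K else Grd C V ?r) D \<iota>D \<pi>D"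
      and w: "is_omega_I C s K (ShA C (\<pi>D 1) \<cdot> (ShA C (cinv C (hsum C D (Und C V)
               (\<lambda>j. (if j = 0 then I (- ?r) else if j = 1 then \<iota> else I ?r) \<cdot> \<pi>D j) {0, 1, 2})) \<cdot> e \<cdot> hsum C D (Und C V)
               (\<lambda>j. (if j = 0 then I (- ?r) else if j = 1 then \<iota> else I ?r) \<cdot> \<pi>D j) {0, 1, 2}) \<cdot> \<iota>D 1) \<omega>'"
      and \<omega>: "\<omega> = hsum C D (Und C V)
               (\<lambda>j. (if j = 0 then I (- ?r) else if j = 1 then \<iota> else I ?r) \<cdot> \<pi>D j) {0, 1, 2} \<cdot> hsum C (Sum C V) D
              (\<lambda>j. \<iota>D j \<cdot> (if j = 0 then Prj V (- ?r) else if j = 1 then \<omega>' \<cdot> hsum C (Sum C V) (Sum C K) (\<lambda>j. Inj K j \<cdot> Prj V j) {- int s..int s}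
                              else Prj V ?r)) {0, 1, 2}"
      unfolding is_omega_I.simps Let_def first_incl_eq last_quot_eq last_incl_eq by blast
    have step: "omega_step C s V I P e \<iota> K" by (rule omega_stepI[OF omega_kernelI[OF Suc.prems n(1,2)] n(3)])
    note c = core[OF step D refl]
    have \<omega>': "\<omega>' = split_filt.\<Phi> C s K (omega_step.JK C s I \<iota> K)" using w unfolding c(1) .
    show "\<omega> = \<Phi>" unfolding \<omega> \<omega>' by (rule c(2))
  next
    assume \<omega>: "\<omega> = \<Phi>"
    \<comment> \<open>Admissible data have to exist: a binary sum yields the pairing, the axioms its
      kernel, and \<open>ex_induced\<close> the filtered object.\<close>
    let ?f = "shA C (Suc s) (P ?r) \<cdot> epow C e (Suc s)"
    obtain D\<^sub>2 \<iota>\<^sub>2 \<pi>\<^sub>2 where D2: "is_dsum C {0::nat, 1} (\<lambda>i. if i = 0 then Tgt C ?f else Tgt C (P ?r)) D\<^sub>2 \<iota>\<^sub>2 \<pi>\<^sub>2"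
      using ex_dsum[of "Tgt C ?f" "Tgt C (P ?r)"] by auto
    define n where "n = hsum C (Und C V) D\<^sub>2 (\<lambda>i. \<iota>\<^sub>2 i \<cdot> (if i = 0 then ?f else P ?r)) {0::nat, 1}"
    have n': "n \<in> Hom C (Und C V) D\<^sub>2" "\<And>j. j \<in> {0::nat, 1} \<Longrightarrow> \<pi>\<^sub>2 j \<cdot> n = (if j = 0 then ?f else P ?r)"
      unfolding n_def using dsum_pair[OF D2, of "Und C V" "\<lambda>i. if i = 0 then ?f else P ?r"] by simp_all
    have n: "is_pairing C ?f (P ?r) n"
      unfolding is_pairing_def using n'(1) n'(2)[of 0] n'(2)[of 1] D2 by auto
    obtain \<iota> where \<iota>: "is_ker C n \<iota>" using ex_ker[of n] n'(1) by auto
    interpret omega_kernel C s V I P e \<iota> by (rule omega_kernelI[OF Suc.prems n \<iota>])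
    obtain K where K: "is_induced C s V K \<iota>" "omega_step C s V I P e \<iota> K" by (rule ex_induced)
    interpret S: omega_step C s V I P e \<iota> K by (rule K(2))
    have "\<exists>D \<iota>D \<pi>D. is_dsum C {0::nat, 1, 2} (\<lambda>j. if j = 0 then Grd C V (- ?r) else if j = 1 then Und C K else Grd C V ?r) D \<iota>D \<pi>D"
      by (rule finite_dsum_exists) auto
    then obtain D \<iota>D \<pi>D where D: "is_dsum C {0::nat, 1, 2} (\<lambda>j. if j = 0 then Grd C V (- ?r) else if j = 1 then Und C K else Grd C V ?r) D \<iota>D \<pi>D"
      by blast
    note c = core[OF K(2) D refl]
    show "is_omega_I C (Suc s) V e \<omega>"
      unfolding is_omega_I.simps Let_def first_incl_eq last_quot_eq last_incl_eq \<omega>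
      by (intro exI[of _ n] exI[of _ \<iota>] exI[of _ K] exI[of _ D] exI[of _ \<iota>D] exI[of _ \<pi>D] exI[of _ S.K.\<Phi>] conjI)
        (rule n \<iota> K(1) D c(1)[THEN iffD2, OF refl] c(2)[symmetric])+
  qed
qed

lemma (in lefschetz_split) omega_I_eq: "omega_I C r V e = \<Phi>"
proof -
  have "lefschetz_split C r V I P e" by unfold_locales
  from is_omega_I_iff[OF this] show ?thesis unfolding omega_I_def by (intro the_equality) auto
qed

section \<open>Duality\<close>

lemma (in linear_category) dsum_uminus:
  fixes X :: "int \<Rightarrow> 'o"
  assumes D: "is_dsum C {- a..a} X D \<iota> \<pi>"
  shows "is_dsum C {- a..a} (\<lambda>p. X (- p)) D (\<lambda>p. \<iota> (- p)) (\<lambda>p. \<pi> (- p))"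
proof (rule dsumI)
  fix t assume t: "t \<in> Mor C" "Tgt C t = D" "\<And>i. i \<in> {- a..a} \<Longrightarrow> \<pi> (- i) \<cdot> t = Zero C (Src C t) (X (- i))"
  show "t = Zero C (Src C t) D"
  proof (rule dsum_cancel[OF D])
    fix i assume i: "i \<in> {- a..a}"
    then have "- i \<in> {- a..a}" by auto
    from t(3)[OF this] show "\<pi> i \<cdot> t = \<pi> i \<cdot> Zero C (Src C t) D" using t(1,2) dsum_simps[OF D] i by simp
  qed (use t dsum_simps[OF D] in auto)
qed (use dsum_simps[OF D] in auto)

context split_filt
begin

lemma gr_incl_simps: "gr_incl C V p \<in> Mor C" "Src C (gr_incl C V p) = Grd C V p"
    "Tgt C (gr_incl C V p) = Tgt C (coker C (Fil V (p - 1)))"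
  by (simp_all add: gr_incl_eq)

lemma opfilt_simps [simp]: "Fil (opfilt C V) p = coker C (Fil V (- p - 1))" "Quo (opfilt C V) p = gr_incl C V (- p)"
    "Inj (opfilt C V) p = Prj V (- p)" "Prj (opfilt C V) p = Inj V (- p)"
    "Und (opcat C) (opfilt C V) = Und C V" "Grd (opcat C) (opfilt C V) p = Grd C V (- p)"
    "Sum (opcat C) (opfilt C V) = Sum C V"
  using gr_incl_simps[of "- p"]
  by (simp_all add: opfilt_def Und_def[of "opcat C"] Grd_def[of "opcat C"] Sum_def[of "opcat C"])

text \<open>\<open>I\<close> and \<open>P\<close> change roles, and degrees change sign. From
  \<open>P_Fil\<close> one gets the factorization of P_j through V/F_p for p < j, which is the dual
  of \<open>I_factors\<close>; conversely \<open>I_factors\<close> gives the dual of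
  \<open>P_Fil\<close>.\<close>

lemma split_filt_op: "split_filt (opcat C) r (opfilt C V) (\<lambda>p. P (- p)) (\<lambda>p. I (- p))"
proof -
  interpret op: shifted_abelian "opcat C" by (rule shifted_abelian_opcat) unfold_locales
  show ?thesis
  proof
    fix p q :: int
    show "is_mono (opcat C) (Fil (opfilt C V) p)"
      by (rule op.ker_mono[of "Fil V (- p - 1)"]) (simp add: coker_is_coker)
    show "hsum (opcat C) (Und (opcat C) (opfilt C V)) (Und (opcat C) (opfilt C V)) (\<lambda>p. P (- p) \<cdot>\<^bsub>opcat C\<^esub> I (- p)) {- int r..int r}
      = Idn (opcat C) (Und (opcat C) (opfilt C V))"
      using dsum_simps(12)[OF dsum_uminus[OF dsum_V]] by simp
    show "factors (opcat C) (Fil (opfilt C V) p) (P (- q))" if "q \<le> p"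
    proof -
      have "- p - 1 < - q" using that by simp
      then obtain u where "u \<in> Hom C (Tgt C (coker C (Fil V (- p - 1)))) (Grd C V (- q))" "u \<cdot> coker C (Fil V (- p - 1)) = P (- q)"
        by (rule P_through_coker)
      then show ?thesis by (intro op.factorsI[of _ u]) simp_all
    qed
    show "I (- q) \<cdot>\<^bsub>opcat C\<^esub> Fil (opfilt C V) p = Zero (opcat C) (Src (opcat C) (Fil (opfilt C V) p)) (Grd (opcat C) (opfilt C V) q)" if "p < q"
      using that coker_factors[OF I_factors[of "- q" "- p - 1"]] by simp
    show "Quo (opfilt C V) p = I (- p) \<cdot>\<^bsub>opcat C\<^esub> Fil (opfilt C V) p"
      by (simp add: gr_incl_eq)
    have "is_dsum (opcat C) {- int r..int r} (\<lambda>p. Grd C V (- p)) (Sum C V) (\<lambda>p. Prj V (- p)) (\<lambda>p. Inj V (- p))"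
      using dsum_uminus[OF star_dsum] by simp
    moreover have "Grd (opcat C) (opfilt C V) = (\<lambda>p. Grd C V (- p))" "Inj (opfilt C V) = (\<lambda>p. Prj V (- p))" "Prj (opfilt C V) = (\<lambda>p. Inj V (- p))"
      by auto
    ultimately show "is_dsum (opcat C) {- int r..int r} (Grd (opcat C) (opfilt C V)) (Sum (opcat C) (opfilt C V)) (Inj (opfilt C V)) (Prj (opfilt C V))"
      by simp
  qed (auto simp: P_I Grd_zero)
qed

end

context graded_split
begin

lemma oparr_simps [simp]: "oparr C e \<in> Mor C" "Src C (oparr C e) = UnO C (Und C V)" "Tgt C (oparr C e) = Und C V"
  by (simp_all add: oparr_def)

text \<open>The components of the powers of the opposite arrow are translates of those of e^k.
  Vanishing and invertibility pass to translates, which gives both the grading and HL on the dual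
  side.\<close>

lemma op_component:
  "P p \<cdot> (transl C k (Und C V) (epow C e k) \<cdot> (UnA C ^^ k) (I q)) = transl C k (Grd C V p) (e_comp k q p)"
proof -
  have "transl C k (Und C V) (epow C e k) \<cdot> (UnA C ^^ k) (I q) = transl C k (Und C V) (epow C e k \<cdot> I q)"
    by (rule transl_Cmp[symmetric]) simp_all
  also have "P p \<cdot> \<dots> = transl C k (Grd C V p) (e_comp k q p)"
    using transl_natural[of "P p" "epow C e k \<cdot> I q" k] by (simp add: e_comp_def)
  finally show ?thesis .
qed

lemma graded_split_op: "graded_split (opcat C) r (opfilt C V) (\<lambda>p. P (- p)) (\<lambda>p. I (- p)) (oparr C e)"
proof -
  interpret op: split_filt "opcat C" r "opfilt C V" "\<lambda>p. P (- p)" "\<lambda>p. I (- p)" by (rule split_filt_op)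
  show ?thesis
  proof
    show "oparr C e \<in> Hom (opcat C) (Und (opcat C) (opfilt C V)) (ShO (opcat C) (Und (opcat C) (opfilt C V)))" by simp
    fix p q :: int assume "q \<noteq> p + 2"
    then have "e_comp 1 (- q) (- p) = Zero C (Grd C V (- q)) (ShO C (Grd C V (- p)))"
      using e_comp_zero[of "- p" "- q" 1] by simp
    then have "P (- p) \<cdot> (oparr C e \<cdot> UnA C (I (- q))) = Zero C (UnO C (Grd C V (- q))) (Grd C V (- p))"
      using op_component[of "- p" 1 "- q"] by (simp add: oparr_def transl_def)
    then show "ShA (opcat C) (I (- q)) \<cdot>\<^bsub>opcat C\<^esub> (oparr C e \<cdot>\<^bsub>opcat C\<^esub> P (- p)) =
      Zero (opcat C) (Grd (opcat C) (opfilt C V) p) (ShO (opcat C) (Grd (opcat C) (opfilt C V) q))"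
      by simp
  qed
qed

end

context lefschetz_split
begin

lemma lefschetz_split_op: "lefschetz_split (opcat C) r (opfilt C V) (\<lambda>p. P (- p)) (\<lambda>p. I (- p)) (oparr C e)"
proof -
  interpret op: graded_split "opcat C" r "opfilt C V" "\<lambda>p. P (- p)" "\<lambda>p. I (- p)" "oparr C e" by (rule graded_split_op)
  show ?thesis
  proof
    fix k
    have "op.e_comp k (- int k) (int k) = transl C k (Grd C V (int k)) (e_comp k (- int k) (int k))"
      using op_component[of "int k" k "- int k"] by (simp add: op.e_comp_def epow_oparr[OF e_Hom])
    moreover have "is_iso C (transl C k (Grd C V (int k)) (e_comp k (- int k) (int k)))"
      unfolding transl_def using e_comp_iso[of k] by (intro iso_Cmp Unm.map_iso) simp_all
    ultimately show "is_iso (opcat C) (op.e_comp k (- int k) (int k))" by simp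
  qed
qed

text \<open>Read in \<open>C\<close>, the splitting of the opposite object is the arrow out of V
  with components P_p. It is a left inverse of the isomorphism \<Phi>, hence its inverse.\<close>

lemma cinv_op_\<Phi>: "cinv C (split_filt.\<Phi> (opcat C) r (opfilt C V) (\<lambda>p. P (- p))) = \<Phi>"
proof -
  interpret op: lefschetz_split "opcat C" r "opfilt C V" "\<lambda>p. P (- p)" "\<lambda>p. I (- p)" "oparr C e" by (rule lefschetz_split_op)
  have \<Psi>: "op.\<Phi> \<in> Mor C" "Src C op.\<Phi> = Und C V" "Tgt C op.\<Phi> = Sum C V" using op.\<Phi>_simps by simp_all
  have Prj: "Prj V p \<cdot> op.\<Phi> = P p" for p using op.\<Phi>_Inj[of "- p"] by simp
  have "op.\<Phi> \<cdot> \<Phi> = Idn C (Sum C V)"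
  proof (rule dsum_cancel_op[OF star_dsum])
    fix p assume p: "p \<in> {- int r..int r}"
    show "(op.\<Phi> \<cdot> \<Phi>) \<cdot> Inj V p = Idn C (Sum C V) \<cdot> Inj V p"
    proof (rule dsum_cancel[OF star_dsum])
      fix q assume q: "q \<in> {- int r..int r}"
      have "Prj V q \<cdot> (op.\<Phi> \<cdot> I p) = P q \<cdot> I p" using \<Psi> by (subst Cmp_reassoc[OF Prj]) simp_all
      then show "Prj V q \<cdot> ((op.\<Phi> \<cdot> \<Phi>) \<cdot> Inj V p) = Prj V q \<cdot> (Idn C (Sum C V) \<cdot> Inj V p)"
        using \<Psi> \<Phi>_Inj dsum_simps(10)[OF star_dsum p] dsum_simps(11)[OF star_dsum p q] by (auto simp: P_I)
    qed (use \<Psi> in auto)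
  qed (use \<Psi> in auto)
  then have "cinv C \<Phi> = op.\<Phi> \<cdot> (\<Phi> \<cdot> cinv C \<Phi>)" using \<Psi> \<Phi>_iso Cmp_reassoc[of op.\<Phi> \<Phi> "Idn C (Sum C V)" "cinv C \<Phi>"] by simp
  then have "cinv C \<Phi> = op.\<Phi>" using \<Psi> \<Phi>_iso by simp
  then show ?thesis using cinv_cinv[OF \<Phi>_iso] by simp
qed

lemma phi_II_eq: "phi_II C r V e = \<Phi>"
  using lefschetz_split.phi_I_eq[OF lefschetz_split_op] cinv_op_\<Phi> by (simp add: phi_II_def)

lemma omega_II_eq: "omega_II C r V e = \<Phi>"
  using lefschetz_split.omega_I_eq[OF lefschetz_split_op] cinv_op_\<Phi> by (simp add: omega_II_def)

end

section \<open>Good splittings\<close>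

context split_filt
begin

text \<open>\<open>is_dsum\<close> speaks of the degrees in its index set only; in all other degrees
  both sides vanish because the pieces are zero.\<close>

lemma Prj_Inj: "Prj V q \<cdot> Inj V p = (if p = q then Idn C (Grd C V p) else Zero C (Grd C V p) (Grd C V q))"
proof (cases "p \<in> {- int r..int r} \<and> q \<in> {- int r..int r}")
  case True
  then show ?thesis using dsum_simps(10,11)[OF star_dsum] by auto
next
  case False
  then have "is_zero_ob C (Grd C V p) \<or> is_zero_ob C (Grd C V q)" using Grd_zero by blast
  then have "Prj V q \<cdot> Inj V p = Zero C (Grd C V p) (Grd C V q)"
    using zero_ob_Zero(1)[of "Grd C V p" "Prj V q \<cdot> Inj V p"] zero_ob_Zero(2)[of "Grd C V q" "Prj V q \<cdot> Inj V p"] by auto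
  moreover have "Idn C (Grd C V p) = Zero C (Grd C V p) (Grd C V p)" if "p = q"
    using that \<open>is_zero_ob C (Grd C V p) \<or> _\<close> zero_ob_Idn by auto
  ultimately show ?thesis by auto
qed

lemma sh_Prj_Inj: "\<lbrakk>f \<in> Mor C; Tgt C f = shO C m (Grd C V p)\<rbrakk> \<Longrightarrow>
    shA C m (Prj V q) \<cdot> (shA C m (Inj V p) \<cdot> f) = (if p = q then f else Zero C (Src C f) (shO C m (Grd C V q)))"
proof -
  assume f: "f \<in> Mor C" "Tgt C f = shO C m (Grd C V p)"
  have "shA C m (Prj V q) \<cdot> shA C m (Inj V p) = shA C m (Prj V q \<cdot> Inj V p)" by simp
  then show ?thesis using f by (subst Cmp_reassoc) (auto simp: Prj_Inj)
qed

lemma star_cancel: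
  assumes "\<And>p q. shA C m (Prj V q) \<cdot> (f \<cdot> Inj V p) = shA C m (Prj V q) \<cdot> (g \<cdot> Inj V p)"
    "f \<in> Hom C (Sum C V) (shO C m (Sum C V))" "g \<in> Hom C (Sum C V) (shO C m (Sum C V))"
  shows "f = g"
proof (rule dsum_cancel_op[OF star_dsum])
  fix p show "f \<cdot> Inj V p = g \<cdot> Inj V p"
    by (rule dsum_cancel[OF Shm.map_dsum[OF star_dsum, of m]]) (use assms in auto)
qed (use assms in auto)

lemma graded_arrow_Inj:
  assumes x: "\<And>p. x p \<in> Hom C (Grd C V p) Z" and Z: "Z \<in> Ob C"
  shows "hsum C (Sum C V) Z (\<lambda>p. x p \<cdot> Prj V p) {- int r..int r} \<in> Hom C (Sum C V) Z"
    "hsum C (Sum C V) Z (\<lambda>p. x p \<cdot> Prj V p) {- int r..int r} \<cdot> Inj V p = x p"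
proof -
  note * = dsum_copair[OF star_dsum Z x]
  show 1: "hsum C (Sum C V) Z (\<lambda>p. x p \<cdot> Prj V p) {- int r..int r} \<in> Hom C (Sum C V) Z" by (rule *(1))
  show "hsum C (Sum C V) Z (\<lambda>p. x p \<cdot> Prj V p) {- int r..int r} \<cdot> Inj V p = x p"
  proof (cases "p \<in> {- int r..int r}")
    case True
    then show ?thesis by (rule *(2))
  next
    case False
    then show ?thesis using Grd_zero_arrow(1)[of "x p" p 0] x[of p] 1
        Grd_zero_arrow(1)[of "hsum C (Sum C V) Z (\<lambda>p. x p \<cdot> Prj V p) {- int r..int r} \<cdot> Inj V p" p 0]
      by simp
  qed
qed

lemma comp_deg_component:
  assumes u: "u \<in> Hom C (Sum C V) (ShO C (Sum C V))"
  shows "comp_deg C r V d u \<in> Hom C (Sum C V) (ShO C (Sum C V))"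
    "ShA C (Prj V q) \<cdot> (comp_deg C r V d u \<cdot> Inj V p) =
      (if q = p + d then ShA C (Prj V q) \<cdot> (u \<cdot> Inj V p) else Zero C (Grd C V p) (ShO C (Grd C V q)))"
proof -
  let ?x = "\<lambda>p. ShA C (Inj V (p + d) \<cdot> Prj V (p + d)) \<cdot> (u \<cdot> Inj V p)"
  have x: "?x p \<in> Hom C (Grd C V p) (ShO C (Sum C V))" for p using u by simp
  have c: "comp_deg C r V d u = hsum C (Sum C V) (ShO C (Sum C V)) (\<lambda>p. ?x p \<cdot> Prj V p) {- int r..int r}"
    unfolding comp_deg_def using u by (intro hsum_cong) simp_all
  have g: "comp_deg C r V d u \<in> Hom C (Sum C V) (ShO C (Sum C V))" "comp_deg C r V d u \<cdot> Inj V p = ?x p"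
    unfolding c using graded_arrow_Inj[of ?x "ShO C (Sum C V)"] x by simp_all
  show "comp_deg C r V d u \<in> Hom C (Sum C V) (ShO C (Sum C V))" by (rule g(1))
  show "ShA C (Prj V q) \<cdot> (comp_deg C r V d u \<cdot> Inj V p) =
      (if q = p + d then ShA C (Prj V q) \<cdot> (u \<cdot> Inj V p) else Zero C (Grd C V p) (ShO C (Grd C V q)))"
    unfolding g(2) using u sh_Prj_Inj[of "ShA C (Prj V (p + d)) \<cdot> (u \<cdot> Inj V p)" 1 "p + d" q] by auto
qed

end

text \<open>The filtration \<open>star\<close> is only determined up to isomorphism; these are its properties that
  do not depend on the choice.\<close>

lemma (in linear_abelian) star_Fil:
  fixes p :: int
  assumes V: "is_filt C r V"
  defines "F \<equiv> Fil (star C r V) p"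
  shows "F \<in> Mor C" "Tgt C F = Sum C V" "Quo (star C r V) p = Prj V p \<cdot> F"
    "\<exists>\<iota> \<pi>. is_dsum C {j \<in> {- int r..int r}. j \<le> p} (Grd C V) (Src C F) \<iota> \<pi> \<and> (\<forall>j \<in> {j \<in> {- int r..int r}. j \<le> p}. F \<cdot> \<iota> j = Inj V j)"
proof -
  let ?I = "{j \<in> {- int r..int r}. j \<le> p}"
  let ?Q = "\<lambda>m. m \<in> Mor C \<and> Tgt C m = Sum C V \<and> (\<exists>\<iota> \<pi>. is_dsum C ?I (Grd C V) (Src C m) \<iota> \<pi> \<and> (\<forall>j \<in> ?I. m \<cdot> \<iota> j = Inj V j))"
  have S: "is_dsum C {- int r..int r} (Grd C V) (Sum C V) (Inj V) (Prj V)" using V by (simp add: is_filt_def)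
  have "finite ?I" by (rule finite_subset[of _ "{- int r..int r}"]) auto
  then have "\<exists>D \<iota> \<pi>. is_dsum C ?I (Grd C V) D \<iota> \<pi>"
    by (rule finite_dsum_exists) (use dsum_simps(3)[OF S] in auto)
  then obtain D \<iota> \<pi> where D: "is_dsum C ?I (Grd C V) D \<iota> \<pi>" by blast
  have "?Q (hsum C D (Sum C V) (\<lambda>i. Inj V i \<cdot> \<pi> i) ?I)"
    using dsum_copair[OF D, of "Sum C V" "Inj V"] dsum_simps[OF S] D by auto
  then have "?Q (SOME m. ?Q m)" by (rule someI)
  moreover have "F = (SOME m. ?Q m)" unfolding F_def star_def Let_def by simp
  ultimately have *: "?Q F" by simp
  then show "F \<in> Mor C" "Tgt C F = Sum C V"
    "\<exists>\<iota> \<pi>. is_dsum C {j \<in> {- int r..int r}. j \<le> p} (Grd C V) (Src C F) \<iota> \<pi> \<and> (\<forall>j \<in> {j \<in> {- int r..int r}. j \<le> p}. F \<cdot> \<iota> j = Inj V j)"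
    by blast+
  show "Quo (star C r V) p = Prj V p \<cdot> F" unfolding F_def star_def Let_def by simp
qed

text \<open>The point is \<open>Quo_eq\<close>. Goodness says that \<phi>, restricted to the p-th
  step of the star filtration and followed by \<open>Quo V p\<close>, is the projection to degree p.
  As the inverse of \<phi> respects filtrations too, this equation can be transported to F_p
  V.\<close>

lemma good_split_filt:
  fixes C :: "('o, 'a) shcat" (structure)
  assumes "shifted_abelian C" and V: "is_filt C r V" and \<phi>: "is_good C r V \<phi>"
  shows "split_filt C r V (\<lambda>p. \<phi> \<cdot> Inj V p) (\<lambda>p. Prj V p \<cdot> cinv C \<phi>)" "\<phi> \<in> Hom C (Sum C V) (Und C V)"
proof -
  interpret shifted_abelian C by fact
  let ?S = "star C r V" and ?R = "{- int r..int r}"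
  have S: "is_dsum C ?R (Grd C V) (Sum C V) (Inj V) (Prj V)" using V by (simp add: is_filt_def)
  have IP: "Inj V p \<in> Hom C (Grd C V p) (Sum C V)" "Prj V p \<in> Hom C (Sum C V) (Grd C V p)" for p
    using V by (simp_all add: is_filt_def)
  note [simp] = IP[unfolded Hom_iff]
  have [simp]: "Grd C V p \<in> Ob C" "Sum C V \<in> Ob C" for p using Ob_simps[of "Inj V p"] by simp_all
  have Vf: "is_mono C (Fil V p)" "Tgt C (Fil V p) = Und C V" "factors C (Fil V p) (Fil V (p - 1))"
    "is_coker C (fac C (Fil V p) (Fil V (p - 1))) (Quo V p)" for p
    using V unfolding is_filt_def is_filtration_def by (auto dest: spec[of _ "p - 1"])
  have zero: "is_zero_ob C (Grd C V p)" if "p \<notin> ?R" for p using V that by (simp add: is_filt_def)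
  have [simp]: "Fil V p \<in> Mor C" "Tgt C (Fil V p) = Und C V" "is_mono C (Fil V p)" for p using Vf mono_Mor by auto
  have Quo: "Quo V p \<in> Mor C" "Src C (Quo V p) = Src C (Fil V p)" "Tgt C (Quo V p) = Grd C V p"
    "Quo V p \<cdot> fac C (Fil V p) (Fil V (p - 1)) = Zero C (Src C (Fil V (p - 1))) (Grd C V p)" for p
    using Vf(4)[of p] fac_simps[OF Vf(1,3), of p] by (auto simp: is_coker_def Grd_def)
  note [simp] = Quo(1-3)
  define F where "F p = Fil ?S p" for p
  have F [simp]: "F p \<in> Mor C" "Tgt C (F p) = Sum C V" "Quo ?S p = Prj V p \<cdot> F p" for p
    using star_Fil[OF V, of p] by (simp_all add: F_def)
  have "\<exists>\<iota> \<pi>. is_dsum C {j \<in> ?R. j \<le> p} (Grd C V) (Src C (F p)) \<iota> \<pi> \<and> (\<forall>j \<in> {j \<in> ?R. j \<le> p}. F p \<cdot> \<iota> j = Inj V j)" for p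
    using star_Fil(4)[OF V, of p] by (simp add: F_def)
  then have "\<exists>\<iota>. \<forall>p. \<exists>\<pi>. is_dsum C {j \<in> ?R. j \<le> p} (Grd C V) (Src C (F p)) (\<iota> p) \<pi> \<and> (\<forall>j \<in> {j \<in> ?R. j \<le> p}. F p \<cdot> \<iota> p j = Inj V j)"
    by (intro choice allI) blast
  then obtain \<iota> where \<iota>': "\<And>p. \<exists>\<pi>. is_dsum C {j \<in> ?R. j \<le> p} (Grd C V) (Src C (F p)) (\<iota> p) \<pi>"
    "\<And>p. \<forall>j \<in> {j \<in> ?R. j \<le> p}. F p \<cdot> \<iota> p j = Inj V j" by blast
  have "\<exists>\<pi>. \<forall>p. is_dsum C {j \<in> ?R. j \<le> p} (Grd C V) (Src C (F p)) (\<iota> p) (\<pi> p)"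
    using \<iota>'(1) by (intro choice allI) blast
  then obtain \<pi> where D: "\<And>p. is_dsum C {j \<in> ?R. j \<le> p} (Grd C V) (Src C (F p)) (\<iota> p) (\<pi> p)" by blast
  have F\<iota>: "F p \<cdot> \<iota> p j = Inj V j" if "j \<in> ?R" "j \<le> p" for p j using \<iota>'(2)[of p] that by blast
  have \<iota> [simp]: "\<iota> p j \<in> Mor C" "Src C (\<iota> p j) = Grd C V j" "Tgt C (\<iota> p j) = Src C (F p)" if "j \<in> ?R" "j \<le> p" for p j
    using dsum_simps(4-6)[OF D[of p], of j] that by auto
  have PrjInj: "Prj V q \<cdot> Inj V p = (if p = q then Idn C (Grd C V p) else Zero C (Grd C V p) (Grd C V q))"
    if "p \<in> ?R" "q \<in> ?R" for p q
    using dsum_simps(10,11)[OF S] that by auto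
  have PrjF: "Prj V j \<cdot> F p = Zero C (Src C (F p)) (Grd C V j)" if "p < j" for p j
  proof (cases "j \<in> ?R")
    case True
    show ?thesis
    proof (rule dsum_cancel_op[OF D[of p]])
      fix l assume l: "l \<in> {j \<in> ?R. j \<le> p}"
      then have "Prj V j \<cdot> (F p \<cdot> \<iota> p l) = Zero C (Grd C V l) (Grd C V j)"
        using F\<iota>[of l p] PrjInj[of l j] True that by simp
      then show "(Prj V j \<cdot> F p) \<cdot> \<iota> p l = Zero C (Src C (F p)) (Grd C V j) \<cdot> \<iota> p l" using l by simp
    qed simp_all
  next
    case False
    then show ?thesis using zero_ob_Zero(2)[OF zero[OF False], of "Prj V j \<cdot> F p"] by simp
  qed
  have \<phi>_iso: "is_iso C \<phi>" and \<phi>_far: "is_farr C ?S V 0 0 \<phi>" and \<phi>'_far: "is_farr C V ?S 0 0 (cinv C \<phi>)"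
    and \<phi>_gr: "\<And>p. gr C ?S V 0 0 \<phi> p = Idn C (Grd C V p)"
    using \<phi> by (auto simp: is_good_def is_splitting_def)
  have US: "Und C ?S = Sum C V" using F(2)[of 0] unfolding F_def by (simp add: Und_def)
  have GS: "Grd C ?S p = Grd C V p" for p using F(3)[of p] by (simp add: Grd_def[of C ?S])
  show \<phi>_Hom: "\<phi> \<in> Hom C (Sum C V) (Und C V)" using \<phi>_far by (simp add: is_farr_def US)
  note [simp] = \<phi>_Hom[unfolded Hom_iff] \<phi>_iso
  have [simp]: "Und C V \<in> Ob C" using Ob_simps(2)[of \<phi>] by simp
  have \<phi>F: "factors C (Fil V p) (\<phi> \<cdot> F p)" for p using \<phi>_far by (simp add: is_farr_def F_def)
  have \<phi>'F: "factors C (F p) (cinv C \<phi> \<cdot> Fil V p)" for p using \<phi>'_far by (simp add: is_farr_def F_def)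
  have Inj_F: "factors C (F p) (Inj V j)" if "j \<le> p" for p j
  proof (cases "j \<in> ?R")
    case True
    then show ?thesis using F\<iota>[of j p] that by (intro factorsI[of _ "\<iota> p j"]) auto
  next
    case False
    then have "Inj V j = Zero C (Grd C V j) (Sum C V)" using zero_ob_Zero(1)[OF zero[OF False], of "Inj V j"] by simp
    then show ?thesis by (intro factorsI[of _ "Zero C (Grd C V j) (Src C (F p))"]) auto
  qed
  have fac_Inj: "factors C (Fil V p) (\<phi> \<cdot> Inj V j)" if jp: "j \<le> p" for p j
  proof -
    obtain h where h: "h \<in> Hom C (Grd C V j) (Src C (F p))" "F p \<cdot> h = Inj V j"
      using Inj_F[OF jp] by (auto simp: factors_def)
    have "Fil V p \<cdot> (fac C (Fil V p) (\<phi> \<cdot> F p) \<cdot> h) = (\<phi> \<cdot> F p) \<cdot> h"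
      using h fac_simps[OF Vf(1) \<phi>F, of p] by (subst Cmp_reassoc[OF fac_simps(4)[OF Vf(1) \<phi>F]]) auto
    then show ?thesis using h fac_simps[OF Vf(1) \<phi>F, of p]
      by (intro factorsI[of _ "fac C (Fil V p) (\<phi> \<cdot> F p) \<cdot> h"]) auto
  qed
  \<comment> \<open>\<open>y p\<close> is the arrow that descends along the quotient map of the star
    filtration to the degree p part of \<phi>.\<close>
  define y where "y p = Quo V p \<cdot> fac C (Fil V p) (\<phi> \<cdot> F p)" for p
  have y: "y p \<in> Mor C" "Src C (y p) = Src C (F p)" "Tgt C (y p) = Grd C V p" for p
    unfolding y_def using fac_simps[OF Vf(1) \<phi>F, of p] by auto
  have y\<iota>: "y p \<cdot> \<iota> p j = Quo V p \<cdot> fac C (Fil V p) (\<phi> \<cdot> Inj V j)" if "j \<in> ?R" "j \<le> p" for p j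
  proof -
    have "fac C (Fil V p) (\<phi> \<cdot> F p) \<cdot> \<iota> p j = fac C (Fil V p) (\<phi> \<cdot> Inj V j)"
      using that fac_simps[OF Vf(1) \<phi>F, of p] F\<iota>[OF that]
      by (intro fac_eqI[symmetric]) (auto simp: Cmp_reassoc[OF fac_simps(4)[OF Vf(1) \<phi>F]])
    then show ?thesis unfolding y_def using that fac_simps[OF Vf(1) \<phi>F, of p] by simp
  qed
  have y_eq: "y p = Prj V p \<cdot> F p" for p
  proof (cases "p \<in> ?R")
    case True
    have lower: "y p \<cdot> \<iota> p j = Zero C (Grd C V j) (Grd C V p)" if j: "j \<in> ?R" "j < p" for j
    proof -
      note f = fac_simps[OF Vf(1) fac_Inj[of j "p - 1"]] fac_simps[OF Vf(1) Vf(3), of p]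
      have "fac C (Fil V p) (\<phi> \<cdot> Inj V j) = fac C (Fil V p) (Fil V (p - 1)) \<cdot> fac C (Fil V (p - 1)) (\<phi> \<cdot> Inj V j)"
        using j f by (intro fac_eqI) (auto simp: Cmp_reassoc[OF fac_simps(4)[OF Vf(1) Vf(3)]])
      then have "y p \<cdot> \<iota> p j = Quo V p \<cdot> (fac C (Fil V p) (Fil V (p - 1)) \<cdot> fac C (Fil V (p - 1)) (\<phi> \<cdot> Inj V j))"
        using y\<iota>[of j p] j by simp
      also have "\<dots> = Zero C (Grd C V j) (Grd C V p)" using f j by (subst Cmp_reassoc[OF Quo(4)]) auto
      finally show ?thesis .
    qed
    have eq: "y p = (y p \<cdot> \<iota> p p) \<cdot> (Prj V p \<cdot> F p)"
    proof (rule dsum_cancel_op[OF D[of p]])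
      fix j assume "j \<in> {j \<in> ?R. j \<le> p}"
      then have j: "j \<in> ?R" "j \<le> p" by auto
      show "y p \<cdot> \<iota> p j = ((y p \<cdot> \<iota> p p) \<cdot> (Prj V p \<cdot> F p)) \<cdot> \<iota> p j"
        using True j y[of p] F\<iota>[OF j] PrjInj[OF j(1) True] lower[of j] by (cases "j = p") auto
    qed (use True y[of p] in auto)
    \<comment> \<open>\<open>\<iota> p p\<close> is a section of that quotient map, so composing
      with it evaluates the definite description in \<open>gr\<close>.\<close>
    have "gr C ?S V 0 0 \<phi> p = y p \<cdot> \<iota> p p"
      unfolding gr_def
    proof (rule the_equality)
      show "y p \<cdot> \<iota> p p \<in> Hom C (Grd C ?S p) (shO C 0 (Grd C V (p + 0))) \<and>
        y p \<cdot> \<iota> p p \<cdot> Quo ?S p = shA C 0 (Quo V (p + 0)) \<cdot> fac C (shA C 0 (Fil V (p + 0))) (\<phi> \<cdot> Fil ?S p)"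
        using eq y[of p] True by (simp add: GS F_def[symmetric] y_def[symmetric])
      fix g assume "g \<in> Hom C (Grd C ?S p) (shO C 0 (Grd C V (p + 0))) \<and>
        g \<cdot> Quo ?S p = shA C 0 (Quo V (p + 0)) \<cdot> fac C (shA C 0 (Fil V (p + 0))) (\<phi> \<cdot> Fil ?S p)"
      then have g: "g \<in> Hom C (Grd C V p) (Grd C V p)" "g \<cdot> (Prj V p \<cdot> F p) = y p"
        by (simp_all add: GS F_def[symmetric] y_def[symmetric])
      have "(g \<cdot> (Prj V p \<cdot> F p)) \<cdot> \<iota> p p = g" using g(1) True F\<iota>[of p p] PrjInj[of p p] by simp
      then show "g = y p \<cdot> \<iota> p p" unfolding g(2) ..
    qed
    then have "y p \<cdot> \<iota> p p = Idn C (Grd C V p)" using \<phi>_gr[of p] by simp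
    then show ?thesis using eq by simp
  next
    case False
    then show ?thesis using zero_ob_Zero(2)[OF zero[OF False], of "y p"] zero_ob_Zero(2)[OF zero[OF False], of "Prj V p \<cdot> F p"] y[of p]
      by simp
  qed
  have Z: "Prj V p = Zero C (Sum C V) (Grd C V p)" "Idn C (Grd C V p) = Zero C (Grd C V p) (Grd C V p)"
    "Inj V p = Zero C (Grd C V p) (Sum C V)" if "p \<notin> ?R" for p
    using zero_ob_Zero(2)[OF zero[OF that], of "Prj V p"] zero_ob_Idn[OF zero[OF that]] zero_ob_Zero(1)[OF zero[OF that], of "Inj V p"] by simp_all
  show "split_filt C r V (\<lambda>p. \<phi> \<cdot> Inj V p) (\<lambda>p. Prj V p \<cdot> cinv C \<phi>)"
  proof
    fix p q :: int
    show "(Prj V q \<cdot> cinv C \<phi>) \<cdot> (\<phi> \<cdot> Inj V p) = (if p = q then Idn C (Grd C V p) else Zero C (Grd C V p) (Grd C V q))"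
      using PrjInj[of p q] Z[of p] Z[of q] by (cases "p \<in> ?R \<and> q \<in> ?R") auto
    have "is_dsum C ?R (Grd C V) (Und C V) (\<lambda>p. \<phi> \<cdot> Inj V p) (\<lambda>p. Prj V p \<cdot> cinv C \<phi>)"
    proof (rule dsumI)
      fix t assume t: "t \<in> Mor C" "Tgt C t = Und C V" "\<And>i. i \<in> ?R \<Longrightarrow> (Prj V i \<cdot> cinv C \<phi>) \<cdot> t = Zero C (Src C t) (Grd C V i)"
      have "cinv C \<phi> \<cdot> t = Zero C (Src C t) (Sum C V)"
        by (rule dsum_cancel[OF S]) (use t in auto)
      then have "cinv C \<phi> \<cdot> t = cinv C \<phi> \<cdot> Zero C (Src C t) (Und C V)" using t(1) by simp
      then show "t = Zero C (Src C t) (Und C V)"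
        by (rule iso_cancel_left[OF iso_cinv[OF \<phi>_iso]]) (use t in auto)
    qed (use PrjInj in auto)
    then show "hsum C (Und C V) (Und C V) (\<lambda>p. (\<phi> \<cdot> Inj V p) \<cdot> (Prj V p \<cdot> cinv C \<phi>)) ?R = Idn C (Und C V)"
      by (rule dsum_simps(12))
    show "p \<notin> ?R \<Longrightarrow> is_zero_ob C (Grd C V p)" by (rule zero)
    show "factors C (Fil V p) (\<phi> \<cdot> Inj V q)" if "q \<le> p" using fac_Inj[OF that] .
    obtain h where h: "h \<in> Hom C (Src C (Fil V p)) (Src C (F p))" "F p \<cdot> h = cinv C \<phi> \<cdot> Fil V p"
      using \<phi>'F[of p] by (auto simp: factors_def)
    have PF: "(Prj V q \<cdot> cinv C \<phi>) \<cdot> Fil V p = (Prj V q \<cdot> F p) \<cdot> h" for q using h by simp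
    show "(Prj V q \<cdot> cinv C \<phi>) \<cdot> Fil V p = Zero C (Src C (Fil V p)) (Grd C V q)" if "p < q"
      unfolding PF PrjF[OF that] using h by simp
    note f = fac_simps[OF Vf(1) \<phi>F, of p]
    \<comment> \<open>\<open>h\<close> is the inverse of \<phi> restricted to F_p V; composing with
      it turns \<open>y p\<close> into \<open>Quo V p\<close>.\<close>
    have "fac C (Fil V p) (\<phi> \<cdot> F p) \<cdot> h = Idn C (Src C (Fil V p))"
      by (rule mono_cancel[OF Vf(1)[of p]]) (use f h in \<open>auto simp: Cmp_reassoc[OF fac_simps(4)[OF Vf(1) \<phi>F]]\<close>)
    then have "y p \<cdot> h = Quo V p" unfolding y_def using f h by simp
    then show "Quo V p = (Prj V p \<cdot> cinv C \<phi>) \<cdot> Fil V p" unfolding PF y_eq ..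
  qed (use S in auto)
qed

section \<open>Uniqueness of the third isomorphism\<close>

lemma (in linear_category) hmod_minus:
  assumes "f \<in> Hom C X Y" "g \<in> Hom C X Y"
  shows "f \<ominus>\<^bsub>hmod C X Y\<^esub> g = Add C f (Scal C (-1) g)"
proof -
  have XY: "X \<in> Ob C" "Y \<in> Ob C" using assms by auto
  interpret module rat_ring "hmod C X Y" by (rule Hom_module[OF XY])
  have "\<ominus>\<^bsub>hmod C X Y\<^esub> g = Scal C (-1) g"
    using assms Add_cancel[of g X Y] Add_commute[of g "Scal C (-1) g"]
    by (intro M.minus_equality) auto
  then show ?thesis by (simp add: a_minus_def)
qed

lemma (in linear_category) Add_Sub:
  assumes "f \<in> Mor C" "h \<in> Mor C" "Src C f = Src C h" "Tgt C f = Tgt C h"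
  shows "Add C h (Add C f (Scal C (-1) h)) = f" "Add C f (Scal C (-1) (Add C f (Scal C (-1) h))) = h"
proof -
  show "Add C h (Add C f (Scal C (-1) h)) = f"
    using assms Add_left_commute[of h f "Scal C (-1) h"] by (simp add: Add_cancel)
  show "Add C f (Scal C (-1) (Add C f (Scal C (-1) h))) = h"
    using assms Add_assoc[of f "Scal C (-1) f" h] by (simp add: Scal_Add Add_cancel)
qed

section \<open>The operator ad on components\<close>

context graded_split
begin

lemma gr_e: "gr C V V 2 1 e p = e_comp 1 p (p + 2)"
  using gre_eq[of "p + 2" p 1] by (simp add: gre_def)

abbreviation "g \<equiv> grmap C r V e"

lemma g_Inj: "g \<in> Hom C (Sum C V) (ShO C (Sum C V))" "g \<cdot> Inj V p = ShA C (Inj V (p + 2)) \<cdot> e_comp 1 p (p + 2)"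
  unfolding grmap_def gr_e
  using graded_arrow_Inj[of "\<lambda>p. ShA C (Inj V (p + 2)) \<cdot> e_comp 1 p (p + 2)" "ShO C (Sum C V)"] by simp_all

lemma Prj_g: "ShA C (Prj V q) \<cdot> g = e_comp 1 (q - 2) q \<cdot> Prj V (q - 2)"
proof (rule dsum_cancel_op[OF star_dsum])
  note [simp] = g_Inj(1)[unfolded Hom_iff]
  fix p
  have "ShA C (Prj V q) \<cdot> (g \<cdot> Inj V p) = (if p = q - 2 then e_comp 1 p q else Zero C (Grd C V p) (ShO C (Grd C V q)))"
    unfolding g_Inj(2) using sh_Prj_Inj[of "e_comp 1 p (p + 2)" 1 "p + 2" q] by auto
  then show "(ShA C (Prj V q) \<cdot> g) \<cdot> Inj V p = (e_comp 1 (q - 2) q \<cdot> Prj V (q - 2)) \<cdot> Inj V p"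
    by (simp add: Prj_Inj)
qed (use g_Inj(1) in auto)

definition component :: "nat \<Rightarrow> 'a \<Rightarrow> int \<Rightarrow> int \<Rightarrow> 'a" where
  "component m u p q = shA C m (Prj V q) \<cdot> (u \<cdot> Inj V p)"

definition ad_comp :: "nat \<Rightarrow> (int \<Rightarrow> int \<Rightarrow> 'a) \<Rightarrow> int \<Rightarrow> int \<Rightarrow> 'a" where
  "ad_comp m U p q = Add C (shA C m (e_comp 1 (q - 2) q) \<cdot> U p (q - 2)) (Scal C (-1) (ShA C (U (p + 2) q) \<cdot> e_comp 1 p (p + 2)))"

lemma adpow_step:
  assumes u: "u \<in> Hom C (Sum C V) (shO C m (Sum C V))"
  defines "u1 \<equiv> shA C m g \<cdot> u \<ominus>\<^bsub>hmod C (Sum C V) (shO C (Suc m) (Sum C V))\<^esub> ShA C u \<cdot> g"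
  shows "u1 \<in> Hom C (Sum C V) (shO C (Suc m) (Sum C V))" "component (Suc m) u1 p q = ad_comp m (component m u) p q"
proof -
  note [simp] = g_Inj(1)[unfolded Hom_iff]
  have u [simp]: "u \<in> Mor C" "Src C u = Sum C V" "Tgt C u = shO C m (Sum C V)" using u by auto
  have u1: "u1 = Add C (shA C m g \<cdot> u) (Scal C (-1) (ShA C u \<cdot> g))"
    unfolding u1_def by (intro hmod_minus) (simp_all add: funpow_swap1)
  show "u1 \<in> Hom C (Sum C V) (shO C (Suc m) (Sum C V))" unfolding u1 by (simp add: funpow_swap1)
  have "shA C m (ShA C (Prj V q)) \<cdot> shA C m g = shA C m (ShA C (Prj V q) \<cdot> g)" by simp
  also have "\<dots> = shA C m (e_comp 1 (q - 2) q) \<cdot> shA C m (Prj V (q - 2))" unfolding Prj_g by simp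
  finally have 1: "shA C m (ShA C (Prj V q)) \<cdot> (shA C m g \<cdot> (u \<cdot> Inj V p)) = shA C m (e_comp 1 (q - 2) q) \<cdot> component m u p (q - 2)"
    by (subst Cmp_reassoc) (simp_all add: component_def, rule assoc, simp_all)
  have 2: "shA C m (ShA C (Prj V q)) \<cdot> (ShA C u \<cdot> (g \<cdot> Inj V p)) = ShA C (component m u (p + 2) q) \<cdot> e_comp 1 p (p + 2)"
    unfolding g_Inj(2) by (simp add: component_def funpow_swap1)
  show "component (Suc m) u1 p q = ad_comp m (component m u) p q"
    unfolding u1 component_def[of "Suc m"] ad_comp_def 1[symmetric] 2[symmetric]
    by (simp add: Cmp_Add funpow_swap1)
qed

text \<open>A family \<open>U\<close> of degree \<open>2m - d\<close> with values in \<open>V\<^sub>q(m)\<close> becomes a map without shift when the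
  frame of the target is taken at \<open>s + d\<close> instead of \<open>s = r\<close>.\<close>

definition frame_map :: "nat \<Rightarrow> nat \<Rightarrow> (int \<Rightarrow> int \<Rightarrow> 'a) \<Rightarrow> int \<Rightarrow> int \<Rightarrow> 'a" where
  "frame_map d m U p q = (if q = p - int d + 2 * int m \<and> 0 \<le> p + int r then shA C (frame_shift (int r) p) (U p q)
     else Zero C (frame_ob (int r) p) (frame_ob (int r + int d) q))"

lemma frame_map_Hom:
  assumes "\<And>p q. U p q \<in> Hom C (Grd C V p) (shO C m (Grd C V q))"
  shows "frame_map d m U p q \<in> Hom C (frame_ob (int r) p) (frame_ob (int r + int d) q)"
proof (cases "q = p - int d + 2 * int m \<and> 0 \<le> p + int r")
  case True
  then have "frame_shift (int r + int d) q = frame_shift (int r) p + m"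
    using frame_shift_add[of p "int r" "p + 2 * int m" m] by (simp add: frame_shift_def add.commute add.left_commute)
  then show ?thesis using assms[of p q] True by (simp add: frame_map_def frame_ob_def funpow_add)
next
  case False
  then show ?thesis by (auto simp: frame_map_def)
qed

lemma frame_map_ad:
  assumes U: "\<And>p q. U p q \<in> Hom C (Grd C V p) (shO C m (Grd C V q))"
  shows "Add C (frame_pow (int r + int d) (q - 2) q \<cdot> frame_map d m U p (q - 2)) (Scal C (-1) (frame_map d m U (p + 2) q \<cdot> frame_pow (int r) p (p + 2)))
    = frame_map d (Suc m) (ad_comp m U) p q"
proof (cases "q = p - int d + 2 * int (Suc m) \<and> 0 \<le> p + int r")
  case True
  note [simp] = U[unfolded Hom_iff]
  let ?n = "frame_shift (int r) p"
  \<comment> \<open>Degree q - 2 in the frame at r + d has the same exponent as degree p + 2m in the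
    frame at r: the offset d compensates the degree -d.\<close>
  have "(q - 2) + (int r + int d) = (p + 2 * int m) + int r" using True by simp
  then have "frame_shift (int r + int d) (q - 2) = frame_shift (int r) (p + 2 * int m)" unfolding frame_shift_def by (simp only:)
  then have n: "frame_shift (int r + int d) (q - 2) = ?n + m" "frame_shift (int r) (p + 2) = ?n + 1"
    using True frame_shift_add[of p "int r" "p + 2 * int m" m] frame_shift_add[of p "int r" "p + 2" 1] by simp_all
  have R: "frame_pow (int r + int d) (q - 2) q = shA C ?n (shA C m (e_comp 1 (q - 2) q))"
    using frame_pow_eq[of "q - 2" "int r + int d" q 1] True n by (simp add: funpow_add)
  have R': "frame_pow (int r) p (p + 2) = shA C ?n (e_comp 1 p (p + 2))"
    using frame_pow_eq[of p "int r" "p + 2" 1] True by simp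
  have f: "frame_map d m U p (q - 2) = shA C ?n (U p (q - 2))" "frame_map d m U (p + 2) q = shA C ?n (ShA C (U (p + 2) q))"
    using True n by (simp_all add: frame_map_def funpow_swap1)
  have "frame_map d (Suc m) (ad_comp m U) p q = shA C ?n (ad_comp m U p q)" using True by (simp add: frame_map_def)
  then show ?thesis unfolding R R' f by (simp add: ad_comp_def funpow_swap1)
next
  case False
  note h = frame_map_Hom[OF U, of d] frame_pow_Hom
  have z: "frame_map d (Suc m) (ad_comp m U) p q = Zero C (frame_ob (int r) p) (frame_ob (int r + int d) q)"
    using False by (auto simp: frame_map_def)
  show ?thesis
  \<comment> \<open>With p in range the degree is the wrong one and both frame maps are zero;
    otherwise the source is a zero object.\<close>
  proof (cases "0 \<le> p + int r")
    case True
    then have "frame_map d m U p (q - 2) = Zero C (frame_ob (int r) p) (frame_ob (int r + int d) (q - 2))"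
      "frame_map d m U (p + 2) q = Zero C (frame_ob (int r) (p + 2)) (frame_ob (int r + int d) q)"
      using False by (auto simp: frame_map_def)
    then show ?thesis unfolding z using h by simp
  next
    case neg: False
    let ?x = "Add C (frame_pow (int r + int d) (q - 2) q \<cdot> frame_map d m U p (q - 2)) (Scal C (-1) (frame_map d m U (p + 2) q \<cdot> frame_pow (int r) p (p + 2)))"
    have "?x \<in> Hom C (frame_ob (int r) p) (frame_ob (int r + int d) q)" using h by simp
    then show ?thesis unfolding z using zero_ob_Zero(1)[OF frame_ob_zero[of p "int r"], of ?x] neg by simp
  qed
qed

end

section \<open>Comparison of two good splittings\<close>

context lefschetz_split
begin

text \<open>\<open>frame_map\<close> retains only the entries of degree -(d + 1), so
  \<open>U\<close> may be the full matrix comparing two splittings. In the matching degree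
  \<open>u\<close> is ad of that part, which is thus killed by the power d + 1 of ad while having
  weight -(d + 1), the extreme case of \<open>ad_pow_inj\<close>.\<close>

lemma ad_injective:
  assumes U: "\<And>p q. U p q \<in> Hom C (Grd C V p) (Grd C V q)"
    and u: "u \<in> Hom C (Sum C V) (ShO C (Sum C V))"
    and uU: "\<And>p. component 1 u p (p + 2 - int (Suc d)) = ad_comp 0 U p (p + 2 - int (Suc d))"
    and z: "adpow C (Sum C V) g d 1 u = Zero C (Sum C V) (shO C (Suc d) (Sum C V))"
  shows "U p (p - int (Suc d)) = Zero C (Grd C V p) (Grd C V (p - int (Suc d)))"
proof -
  have "\<exists>k. \<forall>i. is_ker C (e_comp (i + 1) (- int i) (int i + 2)) (k i)"
    by (intro choice allI ex_ker) simp
  then obtain k where k: "\<And>i. is_ker C (e_comp (i + 1) (- int i) (int i + 2)) (k i)" by blast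
  let ?d = "Suc d"
  let ?k = "\<lambda>s i. if i \<le> r then shA C (frame_shift s (- int i)) (k i) else Idn C (frame_ob s (- int i))"
  interpret X: lefschetz C "frame_ob (int r)" "frame_pow (int r)" r "?k (int r)"
    using k by (intro frame_lefschetz) auto
  interpret Y: lefschetz C "frame_ob (int r + int ?d)" "frame_pow (int r + int ?d)" r "?k (int r + int ?d)"
    using k by (intro frame_lefschetz) auto
  interpret L: two_lefschetz C "frame_ob (int r)" "frame_pow (int r)" r "?k (int r)" "frame_ob (int r + int ?d)" "frame_pow (int r + int ?d)" "?k (int r + int ?d)"
    by unfold_locales
  have ad: "L.ad (frame_map ?d m W) = frame_map ?d (Suc m) (ad_comp m W)" if "\<And>p q. W p q \<in> Hom C (Grd C V p) (shO C m (Grd C V q))" for m W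
    by (intro ext) (simp add: L.ad_def frame_map_ad[OF that] del: of_nat_Suc)
  have component: "component m v p q \<in> Hom C (Grd C V p) (shO C m (Grd C V q))" if "v \<in> Hom C (Sum C V) (shO C m (Sum C V))" for m v p q
    using that by (simp add: component_def)
  have pow: "(L.ad ^^ l) (frame_map ?d m (component m v)) = L.zmat"
    if "v \<in> Hom C (Sum C V) (shO C m (Sum C V))" "adpow C (Sum C V) g l m v = Zero C (Sum C V) (shO C (l + m) (Sum C V))" for l m v
    using that
  proof (induction l arbitrary: m v)
    case 0
    then have v: "v = Zero C (Sum C V) (shO C m (Sum C V))" by simp
    have "frame_map ?d m (component m v) = L.zmat"
    proof (intro ext)
      fix p q
      have "component m v p q = Zero C (Grd C V p) (shO C m (Grd C V q))" unfolding component_def v by simp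
      then show "frame_map ?d m (component m v) p q = L.zmat p q"
        using frame_map_Hom[OF component[OF 0(1)], of ?d p q] by (auto simp: frame_map_def L.zmat_def simp del: of_nat_Suc)
    qed
    then show ?case by simp
  next
    case (Suc l)
    define v1 where "v1 = shA C m g \<cdot> v \<ominus>\<^bsub>hmod C (Sum C V) (shO C (Suc m) (Sum C V))\<^esub> ShA C v \<cdot> g"
    note v1 = adpow_step[OF Suc.prems(1), folded v1_def]
    have c: "component (Suc m) v1 = ad_comp m (component m v)" by (intro ext v1(2))
    have "(L.ad ^^ l) (frame_map ?d (Suc m) (component (Suc m) v1)) = L.zmat"
      by (rule Suc.IH[OF v1(1)]) (use Suc.prems(2) in \<open>simp add: v1_def\<close>)
    then show ?case unfolding c ad[OF component[OF Suc.prems(1)], symmetric] by (simp add: funpow_swap1)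
  qed
  have U0: "\<And>p q. U p q \<in> Hom C (Grd C V p) (shO C 0 (Grd C V q))" using U by simp
  have "frame_map ?d 1 (component 1 u) = frame_map ?d 1 (ad_comp 0 U)"
  proof (intro ext)
    fix p q show "frame_map ?d 1 (component 1 u) p q = frame_map ?d 1 (ad_comp 0 U) p q"
    proof (cases "q = p + 2 - int ?d")
      case True
      have "component 1 u p q = ad_comp 0 U p q" unfolding True by (rule uU)
      then show ?thesis unfolding frame_map_def by (simp only:)
    next
      case False
      then have "q \<noteq> p - int ?d + 2 * int 1" by simp
      then show ?thesis unfolding frame_map_def by (simp only: simp_thms if_False)
    qed
  qed
  then have "(L.ad ^^ d) (L.ad (frame_map ?d 0 U)) = L.zmat"
    using pow[of u 1 d] u z ad[OF U0] by simp
  then have z': "(L.ad ^^ ?d) (frame_map ?d 0 U) = L.zmat" by (simp add: funpow_swap1)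
  have "frame_map ?d 0 U p q = Zero C (frame_ob (int r) p) (frame_ob (int r + int ?d) q)" if "q \<noteq> p + - int ?d" for p q
    using that by (simp add: frame_map_def del: of_nat_Suc)
  with frame_map_Hom[OF U0, of ?d] have "frame_map ?d 0 U \<in> L.M (- int ?d)"
    unfolding L.M_def by (simp del: of_nat_Suc Hom_iff)
  then have *: "frame_map ?d 0 U = L.zmat" by (rule L.ad_pow_inj[OF _ order_refl z'])
  show ?thesis
  proof (cases "0 \<le> p + int r")
    case True
    let ?q = "p - int ?d"
    \<comment> \<open>Thanks to the offset of the frames the entry of degree -(d + 1) is shifted by
      the same exponent on both sides, and faithfulness of that shift removes it.\<close>
    have n: "frame_shift (int r + int ?d) ?q = frame_shift (int r) p" by (simp add: frame_shift_def)
    have "shA C (frame_shift (int r) p) (U p ?q) = shA C (frame_shift (int r) p) (Zero C (Grd C V p) (Grd C V ?q))"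
      using fun_cong[OF fun_cong[OF *], of p ?q] True n by (simp add: frame_map_def L.zmat_def frame_ob_def del: of_nat_Suc)
    then show ?thesis by (rule Shm.faithful) (use U in auto)
  next
    case False
    then show ?thesis using Grd_zero_arrow(1)[of "U p (p - int ?d)" p 0] U[of p "p - int ?d"] by auto
  qed
qed

text \<open>Here \<open>I'\<close>, \<open>P'\<close> come from a competing splitting and
  \<open>u\<close> is the conjugate of \<open>e\<close> by it. If \<open>I' p\<close> and
  \<open>I p\<close> agree in all degrees above p - d - 1, the first discrepancy enters the degree 1
  - d part of \<open>u\<close> linearly, because \<open>P' q\<close> and \<open>P q\<close> coincide
  on F_q.\<close>

lemma third_unique:
  assumes S': "split_filt C r V I' P'"
    and u: "u \<in> Hom C (Sum C V) (ShO C (Sum C V))"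
    and uI': "\<And>p q. ShA C (Prj V q) \<cdot> (u \<cdot> Inj V p) = ShA C (P' q) \<cdot> (e \<cdot> I' p)"
    and z: "\<And>d. adpow C (Sum C V) g d 1 (comp_deg C r V (1 - int d) u) = Zero C (Sum C V) (shO C (Suc d) (Sum C V))"
  shows "I' p = I p"
proof -
  interpret S': split_filt C r V I' P' by (rule S')
  define \<delta> where "\<delta> p = Add C (I' p) (Scal C (-1) (I p))" for p
  have \<delta> [simp]: "\<delta> p \<in> Mor C" "Src C (\<delta> p) = Grd C V p" "Tgt C (\<delta> p) = Und C V" for p by (simp_all add: \<delta>_def)
  have P\<delta>: "P q \<cdot> \<delta> p = Add C (P q \<cdot> I' p) (Scal C (-1) (P q \<cdot> I p))" for p q by (simp add: \<delta>_def Cmp_Add)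
  have PI'_gt: "P q \<cdot> I' p = Zero C (Grd C V p) (Grd C V q)" if "p < q" for p q
    using P_factors_Fil[OF S'.I_factors[of p p] that] by simp
  text \<open>On \<open>F\<^sub>q\<close> both projections induce the quotient map to \<open>V\<^sub>q\<close>.\<close>
  have P'_P: "P' q \<cdot> t = P q \<cdot> t" if t: "factors C (Fil V q) t" for q t
  proof -
    note f = fac_simps[OF Fil_mono t]
    have "P' q \<cdot> (Fil V q \<cdot> fac C (Fil V q) t) = P q \<cdot> (Fil V q \<cdot> fac C (Fil V q) t)"
      using f(1-3) S'.Quo_eq[of q] Quo_eq[of q] by (simp flip: assoc)
    then show ?thesis using f(4) by simp
  qed
  have shP'_P: "ShA C (P' q) \<cdot> t = ShA C (P q) \<cdot> t" if t: "factors C (ShA C (Fil V q)) t" for q t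
  proof -
    have m: "is_mono C (ShA C (Fil V q))" using sh_mono[of 1 q] by simp
    note f = fac_simps[OF m t]
    have "ShA C (P' q) \<cdot> ShA C (Fil V q) = ShA C (P q) \<cdot> ShA C (Fil V q)"
      using S'.Quo_eq[of q] Quo_eq[of q] by (metis IP_simps(4,6,13) Sh.map_simps(6) S'.IP_simps(4,6) Fil_Tgt)
    then have "(ShA C (P' q) \<cdot> ShA C (Fil V q)) \<cdot> fac C (ShA C (Fil V q)) t = (ShA C (P q) \<cdot> ShA C (Fil V q)) \<cdot> fac C (ShA C (Fil V q)) t"
      by simp
    then show ?thesis using f by simp
  qed
  have PI'_same: "P p \<cdot> I' p = Idn C (Grd C V p)" for p
    using P'_P[OF S'.I_factors[of p p]] S'.P_I[of p p] by simp
  have main: "P (p - int (Suc d)) \<cdot> I' p = Zero C (Grd C V p) (Grd C V (p - int (Suc d)))" for d p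
  proof (induction d arbitrary: p rule: less_induct)
    case (less d)
    let ?d = "int (Suc d)"
    have \<delta>F: "factors C (Fil V (p - ?d)) (\<delta> p)" for p
    proof (rule factors_Fil)
      fix j assume j: "p - ?d < j"
      consider "p < j" | "j = p" | c where "c < d" "j = p - int (Suc c)"
      proof -
        have "j < p \<Longrightarrow> nat (p - j - 1) < d \<and> j = p - int (Suc (nat (p - j - 1)))" using j by auto
        then show thesis using that by (meson linorder_less_linear)
      qed
      then show "P j \<cdot> \<delta> p = Zero C (Src C (\<delta> p)) (Grd C V j)"
        by cases (use less.IH in \<open>auto simp: P\<delta> P_I PI'_gt PI'_same Add_cancel\<close>)
    qed auto
    have "P (p - ?d) \<cdot> I' p = Zero C (Grd C V p) (Grd C V (p - ?d))"
    proof (rule ad_injective[where U = "\<lambda>p q. P q \<cdot> I' p" and u = "comp_deg C r V (1 - int d) u"])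
      show "P q \<cdot> I' p \<in> Hom C (Grd C V p) (Grd C V q)" for p q by simp
      show "comp_deg C r V (1 - int d) u \<in> Hom C (Sum C V) (ShO C (Sum C V))" by (rule comp_deg_component(1)[OF u])
      show "adpow C (Sum C V) g d 1 (comp_deg C r V (1 - int d) u) = Zero C (Sum C V) (shO C (Suc d) (Sum C V))" by (rule z)
      fix p
      let ?q = "p + 2 - ?d"
      have P\<delta>_eq: "P (p - ?d) \<cdot> \<delta> p = P (p - ?d) \<cdot> I' p" for p
        unfolding P\<delta> by (simp add: P_I)
      have I': "I' p = Add C (I p) (\<delta> p)" for p
        unfolding \<delta>_def by (rule Add_Sub(1)[symmetric]) simp_all
      have I: "I p = Add C (I' p) (Scal C (-1) (\<delta> p))" for p
        unfolding \<delta>_def by (rule Add_Sub(2)[symmetric]) simp_all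
      \<comment> \<open>The inverse of the competitor contributes the minus sign of ad:
        \<open>?q\<close> differs from p + 2, so \<open>P' ?q\<close> kills
        \<open>I' (p + 2)\<close> and sees only -\<delta>.\<close>
      have "P' ?q \<cdot> I (p + 2) = Scal C (-1) (P' ?q \<cdot> \<delta> (p + 2))"
        by (subst I) (simp add: Cmp_Add S'.P_I)
      also have "P' ?q \<cdot> \<delta> (p + 2) = P ?q \<cdot> I' (p + 2)"
        using P'_P[OF \<delta>F[of "p + 2"]] P\<delta>_eq[of "p + 2"] by simp
      finally have 1: "P' ?q \<cdot> I (p + 2) = Scal C (-1) (P ?q \<cdot> I' (p + 2))" .
      have eI: "e \<cdot> I p = ShA C (I (p + 2)) \<cdot> e_comp 1 p (p + 2)" using epow_I[of "p + 2" p 1] by simp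
      have "ShA C (P' ?q) \<cdot> (e \<cdot> I p) = ShA C (P' ?q \<cdot> I (p + 2)) \<cdot> e_comp 1 p (p + 2)" unfolding eI by simp
      then have A: "ShA C (P' ?q) \<cdot> (e \<cdot> I p) = Scal C (-1) (ShA C (P ?q \<cdot> I' (p + 2)) \<cdot> e_comp 1 p (p + 2))"
        unfolding 1 by simp
      have e1: "ShA C (P j) \<cdot> (e \<cdot> t) = e_comp 1 (j - 2) j \<cdot> (P (j - 2) \<cdot> t)" if "t \<in> Mor C" "Tgt C t = Und C V" for j t
        using P_epow_Cmp[of "j - 2" j 1 t] that by simp
      \<comment> \<open>\<open>e\<close> raises degrees by 2, so e \<delta> lies in the shifted step
        \<open>?q\<close> of the filtration, where \<open>P'\<close> may be replaced by
        \<open>P\<close>.\<close>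
      have "factors C (ShA C (Fil V ?q)) (e \<cdot> \<delta> p)"
        using factors_shFil[of "e \<cdot> \<delta> p" 1 ?q] e1[of "\<delta> p"] P_factors_Fil[OF \<delta>F[of p]] by simp
      then have "ShA C (P' ?q) \<cdot> (e \<cdot> \<delta> p) = ShA C (P ?q) \<cdot> (e \<cdot> \<delta> p)" by (rule shP'_P)
      also have "\<dots> = e_comp 1 (?q - 2) ?q \<cdot> (P (?q - 2) \<cdot> \<delta> p)" by (rule e1) simp_all
      also have "P (?q - 2) \<cdot> \<delta> p = P (?q - 2) \<cdot> I' p"
      proof -
        have "?q - 2 = p - ?d" by simp
        then show ?thesis using P\<delta>_eq[of p] by (simp only:)
      qed
      finally have B: "ShA C (P' ?q) \<cdot> (e \<cdot> \<delta> p) = e_comp 1 (?q - 2) ?q \<cdot> (P (?q - 2) \<cdot> I' p)" .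
      have "component 1 (comp_deg C r V (1 - int d) u) p ?q = ShA C (P' ?q) \<cdot> (e \<cdot> I' p)"
        using comp_deg_component(2)[OF u, of ?q "1 - int d" p] uI'[of ?q p] by (simp add: component_def)
      also have "\<dots> = Add C (ShA C (P' ?q) \<cdot> (e \<cdot> I p)) (ShA C (P' ?q) \<cdot> (e \<cdot> \<delta> p))"
        by (subst I') (simp add: Cmp_Add)
      also have "\<dots> = ad_comp 0 (\<lambda>p q. P q \<cdot> I' p) p ?q"
        unfolding A B ad_comp_def by (subst Add_commute) simp_all
      finally show "component 1 (comp_deg C r V (1 - int d) u) p ?q = ad_comp 0 (\<lambda>p q. P q \<cdot> I' p) p ?q" .
    qed
    then show ?case .
  qed
  show "I' p = I p"
  proof (rule shV_cancel[where m = 0])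
    fix q
    consider "p < q" | "q = p" | "q < p" by linarith
    then show "shA C 0 (P q) \<cdot> I' p = shA C 0 (P q) \<cdot> I p"
    proof cases
      case 3
      then have "q = p - int (Suc (nat (p - q - 1)))" by auto
      then show ?thesis using main[where p = p and d = "nat (p - q - 1)"] 3 by (metis P_I less_irrefl funpow_0)
    qed (auto simp: P_I PI'_gt PI'_same)
  qed auto
qed

end

lemma (in shifted_abelian) etilde_component:
  assumes "is_iso C \<phi>" "\<phi> \<in> Hom C X Y" "e \<in> Hom C Y (ShO C Y)"
  shows "etilde C e \<phi> \<in> Hom C X (ShO C X)"
    "\<lbrakk>i \<in> Hom C Z X; p \<in> Hom C X W\<rbrakk> \<Longrightarrow>
      ShA C p \<cdot> (etilde C e \<phi> \<cdot> i) = ShA C (p \<cdot> cinv C \<phi>) \<cdot> (e \<cdot> (\<phi> \<cdot> i))"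
  using assms by (simp_all add: etilde_def)

text \<open>Read through \<phi>, the absence of components of the conjugate of \<open>e\<close> off
  degree 2 is the axiom \<open>e_graded\<close>. Once that is available, \<open>gre_eq\<close> turns
  HL into invertibility of the components.\<close>

lemma e_good_lefschetz_split:
  fixes C :: "('o, 'a) shcat" (structure)
  assumes "shifted_abelian C" and V: "is_filt C r V" and e: "is_farr C V V 2 1 e" and "HL C V e"
    and \<phi>: "is_e_good C r V e \<phi>"
  shows "lefschetz_split C r V (\<lambda>p. \<phi> \<cdot> Inj V p) (\<lambda>p. Prj V p \<cdot> cinv C \<phi>) e"
proof -
  have g: "is_good C r V \<phi>" and d2: "etilde C e \<phi> = comp_deg C r V 2 (etilde C e \<phi>)"
    using \<phi> by (simp_all add: is_e_good_def)
  interpret split_filt C r V "\<lambda>p. \<phi> \<cdot> Inj V p" "\<lambda>p. Prj V p \<cdot> cinv C \<phi>"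
    by (rule good_split_filt) fact+
  have \<phi>_Hom: "\<phi> \<in> Hom C (Sum C V) (Und C V)" by (rule good_split_filt) fact+
  have iso: "is_iso C \<phi>" using g by (simp add: is_good_def is_splitting_def)
  have e_Hom: "e \<in> Hom C (Und C V) (ShO C (Und C V))" using e by (simp add: is_farr_def)
  note et = etilde_component[OF iso \<phi>_Hom e_Hom]
  have grd: "ShA C (Prj V q \<cdot> cinv C \<phi>) \<cdot> (e \<cdot> (\<phi> \<cdot> Inj V p)) = Zero C (Grd C V p) (ShO C (Grd C V q))" if "q \<noteq> p + 2" for p q
  proof -
    have "ShA C (Prj V q \<cdot> cinv C \<phi>) \<cdot> (e \<cdot> (\<phi> \<cdot> Inj V p)) = ShA C (Prj V q) \<cdot> (comp_deg C r V 2 (etilde C e \<phi>) \<cdot> Inj V p)"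
      using et(2)[OF Inj_Hom Prj_Hom, of q p] d2 by simp
    then show ?thesis using comp_deg_component(2)[OF et(1), of q 2 p] that by simp
  qed
  interpret graded_split C r V "\<lambda>p. \<phi> \<cdot> Inj V p" "\<lambda>p. Prj V p \<cdot> cinv C \<phi>" e
    by unfold_locales (fact e_Hom, fact grd)
  show ?thesis
  proof
    fix k
    show "is_iso C (e_comp k (- int k) (int k))"
      using \<open>HL C V e\<close> by (subst gre_eq[symmetric]) (simp_all add: HL_def)
  qed
qed

context lefschetz_split
begin

lemma adpow_Zero: "adpow C (Sum C V) g k m (Zero C (Sum C V) (shO C m (Sum C V))) = Zero C (Sum C V) (shO C (k + m) (Sum C V))"
proof (induction k arbitrary: m)
  case (Suc k)
  note [simp] = g_Inj(1)[unfolded Hom_iff]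
  let ?X = "Sum C V"
  have "shA C m g \<cdot> Zero C ?X (shO C m ?X) \<ominus>\<^bsub>hmod C ?X (shO C (Suc m) ?X)\<^esub> ShA C (Zero C ?X (shO C m ?X)) \<cdot> g
    = Zero C ?X (shO C (Suc m) ?X)"
    by (subst hmod_minus) (simp_all add: funpow_swap1)
  then show ?case using Suc.IH[of "Suc m"] by simp
qed simp

end

theorem proposition2p6p3:
  fixes C :: "('o, 'a) shcat" and r :: nat and V :: "'a filt" and e :: 'a
  assumes "shifted_abelian C"
    and "is_filt C r V"
    and "is_farr C V V 2 1 e"
    and "HL C V e"
    and "\<exists>\<phi>. is_e_good C r V e \<phi>"
  shows "(\<exists>!\<phi>. is_e_good C r V e \<phi>) \<and> is_e_good C r V e (phi_III C r V e) \<and>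
    omega_I C r V e = omega_II C r V e \<and>
    omega_II C r V e = phi_I C r V e \<and>
    phi_I C r V e = phi_II C r V e \<and>
    phi_II C r V e = phi_III C r V e"
proof -
  obtain \<phi> where \<phi>: "is_e_good C r V e \<phi>" using assms(5) by blast
  interpret lefschetz_split C r V "\<lambda>p. \<phi> \<cdot>\<^bsub>C\<^esub> Inj V p" "\<lambda>p. Prj V p \<cdot>\<^bsub>C\<^esub> cinv C \<phi>" e
    by (rule e_good_lefschetz_split) (fact assms \<phi>)+
  let ?third = "\<lambda>\<psi>. \<forall>d\<le>1. adpow C (Sum C V) g (nat (1 - d)) 1 (comp_deg C r V d (etilde C e \<psi>)) =
        Zero C (Sum C V) (shO C (nat (1 - d) + 1) (Sum C V))"
  have Hom: "\<psi> \<in> Hom C (Sum C V) (Und C V)" "is_iso C \<psi>" if "is_good C r V \<psi>" for \<psi>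
    using good_split_filt(2)[OF assms(1,2) that] that by (simp_all add: is_good_def is_splitting_def)
  \<comment> \<open>Only the degree 2 component of the conjugate of \<open>e\<close> is present, so
    for d <= 1 the power of ad is applied to zero.\<close>
  have third: "?third \<psi>" if \<psi>: "is_e_good C r V e \<psi>" for \<psi>
  proof (intro allI impI)
    fix d :: int assume d: "d \<le> 1"
    have "is_good C r V \<psi>" using \<psi> by (simp add: is_e_good_def)
    note et = etilde_component(1)[OF Hom(2,1)[OF this] e_Hom]
    let ?u = "comp_deg C r V 2 (etilde C e \<psi>)"
    have u: "etilde C e \<psi> = ?u" using \<psi> by (simp add: is_e_good_def)
    have "comp_deg C r V d ?u = Zero C (Sum C V) (shO C 1 (Sum C V))"
    proof (rule star_cancel[where m = 1])
      fix p q
      show "shA C 1 (Prj V q) \<cdot>\<^bsub>C\<^esub> (comp_deg C r V d ?u \<cdot>\<^bsub>C\<^esub> Inj V p) = shA C 1 (Prj V q) \<cdot>\<^bsub>C\<^esub> (Zero C (Sum C V) (shO C 1 (Sum C V)) \<cdot>\<^bsub>C\<^esub> Inj V p)"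
        using comp_deg_component(2)[OF comp_deg_component(1)[OF et, of 2], of q d p] comp_deg_component(2)[OF et, of q 2 p] d by auto
    qed (use comp_deg_component(1)[OF comp_deg_component(1)[OF et, of 2], of d] in auto)
    then have "comp_deg C r V d (etilde C e \<psi>) = Zero C (Sum C V) (shO C 1 (Sum C V))" using u by metis
    then show "adpow C (Sum C V) g (nat (1 - d)) 1 (comp_deg C r V d (etilde C e \<psi>)) =
        Zero C (Sum C V) (shO C (nat (1 - d) + 1) (Sum C V))"
      by (simp only: adpow_Zero)
  qed
  \<comment> \<open>Both uniqueness claims rest on this: for the condition that defines
    \<open>phi_III\<close>, and by way of \<open>third\<close> for e-good splittings.\<close>
  have unique: "\<psi> = \<phi>" if \<psi>: "is_good C r V \<psi>" "?third \<psi>" for \<psi>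
  proof (rule dsum_cancel_op[OF star_dsum])
    note et = etilde_component[OF Hom(2,1)[OF \<psi>(1)] e_Hom]
    fix p
    show "\<psi> \<cdot>\<^bsub>C\<^esub> Inj V p = \<phi> \<cdot>\<^bsub>C\<^esub> Inj V p"
    proof (rule third_unique[OF good_split_filt(1)[OF assms(1,2) \<psi>(1)] et(1)])
      show "ShA C (Prj V q) \<cdot>\<^bsub>C\<^esub> (etilde C e \<psi> \<cdot>\<^bsub>C\<^esub> Inj V p) = ShA C (Prj V q \<cdot>\<^bsub>C\<^esub> cinv C \<psi>) \<cdot>\<^bsub>C\<^esub> (e \<cdot>\<^bsub>C\<^esub> (\<psi> \<cdot>\<^bsub>C\<^esub> Inj V p))" for p q
        by (rule et(2)[OF Inj_Hom Prj_Hom])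
      fix d
      show "adpow C (Sum C V) g d 1 (comp_deg C r V (1 - int d) (etilde C e \<psi>)) = Zero C (Sum C V) (shO C (Suc d) (Sum C V))"
        using \<psi>(2)[rule_format, of "1 - int d"] by simp
    qed
  qed (use Hom[OF \<psi>(1)] Hom[of \<phi>] \<phi> in \<open>auto simp: is_e_good_def\<close>)
  have good: "is_good C r V \<psi>" if "is_e_good C r V e \<psi>" for \<psi> using that by (simp add: is_e_good_def)
  have III: "phi_III C r V e = \<phi>"
    unfolding phi_III_def
    by (rule the_equality) (use good[OF \<phi>] third[OF \<phi>] unique in blast)+
  have \<Phi>: "\<Phi> = \<phi>" using Hom(1)[OF good[OF \<phi>]] by (intro \<Phi>_eqI[symmetric]) auto
  have ex1: "\<exists>!\<phi>. is_e_good C r V e \<phi>"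
    using \<phi> by (rule ex1I) (rule unique[OF good third])
  show ?thesis
    unfolding III omega_I_eq omega_II_eq phi_I_eq phi_II_eq
    by (intro conjI) (rule ex1 \<phi> refl \<Phi>)+
qed

end
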